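(* (a) Let $\mu,\nu\in\mathbb{C}$. For $i\in\{1,2\}$ and all $j\in\mathbb{Z}$, and, when $\mu$ is a positive odd integer, also for $i\in\{3,4\}$ and all $j\in\mathbb{Z}$, one has $\mathcal{D}_{\mu,\nu}\Lambda_{i,j}^{\mu,\nu}=\lambda_j^{\mu,\nu}\Lambda_{i,j}^{\mu,\nu}$ on $\mathbb{R}_+$. (b) If $\mu$ is a positive odd integer and $\nu>0$ is real with $\mu-\nu\notin2\mathbb{Z}$, then for every fixed $j\in\mathbb{N}_0$ the four functions $\Lambda_{1,j}^{\mu,\nu},\Lambda_{2,j}^{\mu,\nu},\Lambda_{3,j}^{\mu,\nu},\Lambda_{4,j}^{\mu,\nu}$ are linearly independent and form a fundamental system of solutions of $\mathcal{D}_{\mu,\nu}u=\lambda_j^{\mu,\nu}u$ on $\mathbb{R}_+$.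
   Context: $\theta=x\frac{d}{dx}$; $\mathcal{D}_{\mu,\nu}=\frac{1}{x^2}\big((\theta+\nu)(\theta+\mu+\nu)-x^2\big)\big(\theta(\theta+\mu)-x^2\big)-\frac{(\mu-\nu)(\mu+\nu+2)}{2}$ (products = composition). $\lambda_j^{\mu,\nu}=(2j+\mu+1)^2-\frac{(\mu+1)^2}{2}-\frac{(\nu+1)^2}{2}$. Normalized modified Bessel functions: $\widetilde I_\alpha(z)=(z/2)^{-\alpha}I_\alpha(z)$, $\widetilde K_\alpha(z)=(z/2)^{-\alpha}K_\alpha(z)$. For $x>0$ and $t$ near $0$ (principal branch of $(1-t)^{-s}$): $G_1^{\mu,\nu}=(1-t)^{-\frac{\mu+\nu+2}{2}}\widetilde I_{\mu/2}(\tfrac{tx}{1-t})\widetilde I_{\nu/2}(\tfrac{x}{1-t})$, $G_2^{\mu,\nu}=(1-t)^{-\frac{\mu+\nu+2}{2}}\widetilde I_{\mu/2}(\tfrac{tx}{1-t})\widetilde K_{\nu/2}(\tfrac{x}{1-t})$, $G_3^{\mu,\nu}=(1-t)^{-\frac{\mu+\nu+2}{2}}\widetilde K_{\mu/2}(\tfrac{tx}{1-t})\widetilde I_{\nu/2}(\tfrac{x}{1-t})$, $G_4^{\mu,\nu}=(1-t)^{-\frac{\mu+\nu+2}{2}}\widetilde K_{\mu/2}(\tfrac{tx}{1-t})\widetilde K_{\nu/2}(\tfrac{x}{1-t})$; $\Lambda_{i,j}^{\mu,\nu}(x)$ are the coefficients of the Taylor ($i=1,2$) resp. Laurent ($i=3,4$,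 $\mu$ odd integer) expansion $G_i^{\mu,\nu}(t,x)=\sum_{j\in\mathbb{Z}}t^j\Lambda_{i,j}^{\mu,\nu}(x)$. *)

theory Defs
  imports "HOL-Analysis.Analysis"
begin

definition bessel_I :: "complex \<Rightarrow> complex \<Rightarrow> complex" where
  "bessel_I \<alpha> z = (z / 2) powr \<alpha> *
      (\<Sum>k. (z / 2) ^ (2 * k) * rGamma (\<alpha> + of_nat k + 1) / fact k)"

definition bessel_K_aux :: "complex \<Rightarrow> complex \<Rightarrow> complex" where
  "bessel_K_aux \<alpha> z = of_real pi / 2 * (bessel_I (- \<alpha>) z - bessel_I \<alpha> z) / sin (\<alpha> * of_real pi)"

definition bessel_K :: "complex \<Rightarrow> complex \<Rightarrow> complex" where
  "bessel_K \<alpha> z = (if sin (\<alpha> * of_real pi) \<noteq> 0 then bessel_K_aux \<alpha> z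
                    else Lim (at \<alpha>) (\<lambda>\<beta>. bessel_K_aux \<beta> z))"

definition bessel_I_tilde :: "complex \<Rightarrow> complex \<Rightarrow> complex" where
  "bessel_I_tilde \<alpha> z = (z / 2) powr (- \<alpha>) * bessel_I \<alpha> z"

definition bessel_K_tilde :: "complex \<Rightarrow> complex \<Rightarrow> complex" where
  "bessel_K_tilde \<alpha> z = (z / 2) powr (- \<alpha>) * bessel_K \<alpha> z"

definition genfun :: "nat \<Rightarrow> complex \<Rightarrow> complex \<Rightarrow> complex \<Rightarrow> real \<Rightarrow> complex" where
  "genfun i \<mu> \<nu> t x =
     (let pre = (1 - t) powr (- (\<mu> + \<nu> + 2) / 2);
          a = t * of_real x / (1 - t);
          b = of_real x / (1 - t)
      in if i = 1 then pre * bessel_I_tilde (\<mu>/2) a * bessel_I_tilde (\<nu>/2) b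
         else if i = 2 then pre * bessel_I_tilde (\<mu>/2) a * bessel_K_tilde (\<nu>/2) b
         else if i = 3 then pre * bessel_K_tilde (\<mu>/2) a * bessel_I_tilde (\<nu>/2) b
         else pre * bessel_K_tilde (\<mu>/2) a * bessel_K_tilde (\<nu>/2) b)"

text \<open>Laurent (resp. Taylor) coefficients in t about t = 0: the unique family (c_j)_{j in Z} with
  G(t,x) = sum_j c_j t^j on a punctured disc around 0.\<close>
definition Lambda :: "nat \<Rightarrow> complex \<Rightarrow> complex \<Rightarrow> int \<Rightarrow> real \<Rightarrow> complex" where
  "Lambda i \<mu> \<nu> j x =
     (THE c :: int \<Rightarrow> complex. \<exists>r>0. \<forall>t. 0 < norm t \<and> norm t < r \<longrightarrow>
         ((\<lambda>n. c n * t powi n) has_sum genfun i \<mu> \<nu> t x) UNIV) j"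

definition theta :: "(real \<Rightarrow> complex) \<Rightarrow> real \<Rightarrow> complex" where
  "theta f x = of_real x * vector_derivative f (at x)"

text \<open>theta(theta+mu) - x^2\<close>
definition opP :: "complex \<Rightarrow> (real \<Rightarrow> complex) \<Rightarrow> real \<Rightarrow> complex" where
  "opP \<mu> f x = theta (theta f) x + \<mu> * theta f x - of_real (x\<^sup>2) * f x"

text \<open>(theta+nu)(theta+mu+nu) - x^2\<close>
definition opQ :: "complex \<Rightarrow> complex \<Rightarrow> (real \<Rightarrow> complex) \<Rightarrow> real \<Rightarrow> complex" where
  "opQ \<mu> \<nu> g x = theta (theta g) x + (\<mu> + 2 * \<nu>) * theta g x + \<nu> * (\<mu> + \<nu>) * g x
                   - of_real (x\<^sup>2) * g x"

definition opD :: "complex \<Rightarrow> complex \<Rightarrow> (real \<Rightarrow> complex) \<Rightarrow> real \<Rightarrow> complex" where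
  "opD \<mu> \<nu> u x = opQ \<mu> \<nu> (opP \<mu> u) x / of_real (x\<^sup>2)
                  - (\<mu> - \<nu>) * (\<mu> + \<nu> + 2) / 2 * u x"

definition eigval :: "complex \<Rightarrow> complex \<Rightarrow> int \<Rightarrow> complex" where
  "eigval \<mu> \<nu> j = (2 * of_int j + \<mu> + 1)\<^sup>2 - (\<mu> + 1)\<^sup>2 / 2 - (\<nu> + 1)\<^sup>2 / 2"

text \<open>u solves D u = lam u on R_+ (with the theta-iterates up to order 3 differentiable there,
  so that all derivatives occurring in D exist).\<close>
definition solves_on_Rplus :: "complex \<Rightarrow> complex \<Rightarrow> complex \<Rightarrow> (real \<Rightarrow> complex) \<Rightarrow> bool" where
  "solves_on_Rplus \<mu> \<nu> lam u \<longleftrightarrow>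
     (\<forall>x>0. (\<forall>k<4. (theta ^^ k) u differentiable (at x)) \<and> opD \<mu> \<nu> u x = lam * u x)"

end

theory Submission
  imports Defs "HOL-Complex_Analysis.Complex_Analysis" "HOL-Real_Asymp.Real_Asymp"
begin

text \<open>
  Write \<open>G = (1 - t)\<^bsup>-s\<^esup> A(tx/(1-t)) B(x/(1-t))\<close> with \<open>s = (\<mu> + \<nu> + 2)/2\<close>, where \<open>\<theta>(\<theta> + \<mu>)A = z\<^sup>2 A\<close> and
  \<open>\<theta>(\<theta> + \<nu>)B = z\<^sup>2 B\<close>. Since the four products of \<open>A, \<theta>A\<close> with \<open>B, \<theta>B\<close> span a module stable under
  \<open>\<theta>\<^sub>x\<close> and \<open>\<theta>\<^sub>t\<close>, a polynomial identity shows that \<open>D\<^sub>x G\<close> equals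
  \<open>((2\<theta>\<^sub>t + \<mu> + 1)\<^sup>2 - (\<mu> + 1)\<^sup>2/2 - (\<nu> + 1)\<^sup>2/2) G\<close>. The coefficients \<open>\<Lambda>\<^sub>j\<close> are means of \<open>t\<^bsup>-j\<^esup> G\<close> over
  the circle \<open>|t| = 1/2\<close>; differentiation under the integral and integration by parts turn \<open>\<theta>\<^sub>t\<close> into
  multiplication by \<open>j\<close>.

  For the second part, letting \<open>x\<close> tend to 0 inside the circle mean shows that the four functions behave like
  nonzero multiples of \<open>x\<^bsup>-e\<^esup>\<close> with \<open>e = 0, \<nu>, \<mu>, \<mu> + \<nu>\<close>. The constants contain a coefficient of the
  binomial series of \<open>(1 - t)\<^bsup>e - s\<^esup>\<close>, which does not vanish because \<open>\<mu> - \<nu>\<close> is not an even integer. Distinct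
  exponents give independence, and uniqueness for the initial value problem shows that the functions span.
\<close>

text \<open>As t circles the origin, so does the first argument \<open>t*x/(1-t)\<close>, whereas
  \<open>x/(1-t)\<close> stays in the right half plane for \<open>|t| < 1\<close>. So the first
  factor must solve its equation on the whole punctured plane, with at most a pole at 0. For K in
  that place an odd \<mu> secures this: no logarithm occurs and \<open>z powr (-\<mu>)\<close> is an
  integral power. The second factor is needed on the half plane only, which leaves \<nu> free. The
  price is that \<open>\<nu>/2\<close> may be an integer; K is then a limit in the order, made
  explicit by differentiating the series in the order. In the unit disc the only possible
  singularity in t is 0, whatever x is, so one fixed circle serves all x. In the second part
  \<open>j \<ge> 0\<close> matters, since the two Taylor families vanish identically for negative
  j.\<close>

section \<open>Laurent coefficients as circle means\<close>

text \<open>Cauchy's coefficient formula in the parametrisation \<open>t = r * cis \<phi>\<close>,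
  where \<open>dt/t = \<i> d\<phi>\<close> absorbs one power of t and the factor \<i>. As an
  integral over a real interval it is open to the Leibniz rule and to the fundamental theorem of
  calculus.\<close>

definition circle_coeff :: "real \<Rightarrow> int \<Rightarrow> (complex \<Rightarrow> complex) \<Rightarrow> complex" where
  "circle_coeff r n g =
     integral {0..2*pi} (\<lambda>\<phi>. g (of_real r * cis \<phi>) * (of_real r * cis \<phi>) powi (-n)) / (2 * of_real pi)"

lemma rcis_in_sphere: "r > 0 \<Longrightarrow> norm (of_real r * cis \<phi>) = r"
  by (simp add: norm_mult)

lemma has_integral_cis_powi:
  "((\<lambda>\<phi>. cis \<phi> powi n) has_integral (if n = 0 then 2 * of_real pi else 0)) {0..2*pi}"
proof (cases "n = 0")
  case True
  then show ?thesis
    using has_integral_const_real[of "1::complex" 0 "2*pi"] by (simp add: scaleR_conv_of_real)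
next
  case False
  have eq: "cis \<phi> powi n = exp (\<i> * of_real (of_int n * \<phi>))" for \<phi>
    unfolding cis_power_int by (simp add: cis_conv_exp)
  have "((\<lambda>\<phi>. cis \<phi> powi n) has_integral
          (exp (\<i> * of_real (of_int n * (2*pi))) / (\<i> * of_int n) - exp (\<i> * of_real (of_int n * 0)) / (\<i> * of_int n))) {0..2*pi}"
    unfolding eq
  proof (rule fundamental_theorem_of_calculus)
    fix \<phi> :: real
    have "((\<lambda>z. exp (\<i> * (of_int n * z)) / (\<i> * of_int n)) has_field_derivative exp (\<i> * (of_int n * of_real \<phi>)))
            (at (of_real \<phi>))"
      using False by (auto intro!: derivative_eq_intros simp: mult.commute mult.left_commute)
    then show "((\<lambda>\<phi>. exp (\<i> * of_real (of_int n * \<phi>)) / (\<i> * of_int n)) has_vector_derivative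
            exp (\<i> * of_real (of_int n * \<phi>))) (at \<phi> within {0..2*pi})"
      using has_vector_derivative_real_field by fastforce
  qed simp
  moreover have "exp (\<i> * of_real (of_int n * (2*pi))) = 1"
    by (simp add: exp_eq_1)
  ultimately show ?thesis using False by simp
qed

lemma circle_integrable:
  assumes "r > 0" "continuous_on (sphere 0 r) g"
  shows "continuous_on {0..2*pi} (\<lambda>\<phi>. g (of_real r * cis \<phi>) * (of_real r * cis \<phi>) powi n)"
    and "(\<lambda>\<phi>. g (of_real r * cis \<phi>) * (of_real r * cis \<phi>) powi n) integrable_on {0..2*pi}"
proof -
  show c: "continuous_on {0..2*pi} (\<lambda>\<phi>. g (of_real r * cis \<phi>) * (of_real r * cis \<phi>) powi n)"
    using assms
    by (intro continuous_intros continuous_on_compose2[OF assms(2)]) (auto simp: norm_mult)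
  show "(\<lambda>\<phi>. g (of_real r * cis \<phi>) * (of_real r * cis \<phi>) powi n) integrable_on {0..2*pi}"
    by (rule integrable_continuous_real[OF c])
qed

lemma circle_coeff_cong:
  assumes "r > 0" "\<And>t. norm t = r \<Longrightarrow> f t = g t"
  shows "circle_coeff r n f = circle_coeff r n g"
  unfolding circle_coeff_def using assms by (simp add: norm_mult)

lemma circle_coeff_add:
  assumes "r > 0" "continuous_on (sphere 0 r) f" "continuous_on (sphere 0 r) g"
  shows "circle_coeff r n (\<lambda>t. f t + g t) = circle_coeff r n f + circle_coeff r n g"
  unfolding circle_coeff_def
  using integral_add[OF circle_integrable(2)[OF assms(1,2)] circle_integrable(2)[OF assms(1,3)], of "-n" "-n"]
  by (simp add: add_divide_distrib distrib_right)

lemma circle_coeff_cmult: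
  shows "circle_coeff r n (\<lambda>t. c * g t) = c * circle_coeff r n g"
  unfolding circle_coeff_def by (simp add: mult.assoc)

lemma circle_coeff_diff:
  assumes "r > 0" "continuous_on (sphere 0 r) f" "continuous_on (sphere 0 r) g"
  shows "circle_coeff r n (\<lambda>t. f t - g t) = circle_coeff r n f - circle_coeff r n g"
proof -
  have "circle_coeff r n (\<lambda>t. f t + (-1) * g t) = circle_coeff r n f + circle_coeff r n (\<lambda>t. (-1) * g t)"
    by (intro circle_coeff_add continuous_intros assms)
  then show ?thesis
    unfolding circle_coeff_cmult by simp
qed

lemma circle_coeff_bound:
  assumes "r > 0" "continuous_on (sphere 0 r) g" "\<And>t. norm t = r \<Longrightarrow> norm (g t) \<le> M"
  shows "norm (circle_coeff r n g) \<le> M * r powi (-n)"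
proof -
  have "norm (integral {0..2*pi} (\<lambda>\<phi>. g (of_real r * cis \<phi>) * (of_real r * cis \<phi>) powi (-n)))
        \<le> (M * r powi (-n)) * (2*pi - 0)"
  proof (rule integral_bound)
    show "norm (g (of_real r * cis t) * (of_real r * cis t) powi (-n)) \<le> M * r powi (-n)" for t
      using assms by (auto simp: norm_mult norm_power_int intro!: mult_right_mono)
  qed (use circle_integrable(1)[OF assms(1,2)] in auto)
  then show ?thesis
    by (simp add: circle_coeff_def norm_divide norm_mult field_simps)
qed

text \<open>Termwise integration. For complex terms unordered summability is absolute, so the moduli
  at the single point \<open>t = r\<close> already form a Weierstrass majorant on the whole
  circle.\<close>

lemma circle_coeff_has_sum:
  assumes r: "r > 0"
    and hs: "\<And>t. norm t = r \<Longrightarrow> ((\<lambda>n. c n * t powi n) has_sum g t) UNIV"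
  shows "circle_coeff r n g = c n"
proof -
  define f where "f = (\<lambda>k \<phi>. c k * (of_real r * cis \<phi>) powi k * (of_real r * cis \<phi>) powi (-n))"
  have "(\<lambda>k. c k * of_real r powi k) summable_on UNIV"
    using hs[of "of_real r"] r by (auto simp: summable_on_def)
  then have "(\<lambda>k. norm (c k * of_real r powi k)) summable_on UNIV"
    by (simp add: summable_on_iff_abs_summable_on_complex)
  then have sm: "(\<lambda>k. norm (c k * of_real r powi k) * r powi (-n)) summable_on UNIV"
    by (rule summable_on_cmult_left)
  have ul: "uniform_limit {0..2*pi} (\<lambda>X \<phi>. \<Sum>k\<in>X. f k \<phi>)
        (\<lambda>\<phi>. g (of_real r * cis \<phi>) * (of_real r * cis \<phi>) powi (-n)) (finite_subsets_at_top UNIV)"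
  proof (rule Weierstrass_m_test_general'[OF _ _ sm])
    show "norm (f k \<phi>) \<le> norm (c k * of_real r powi k) * r powi (-n)" for k \<phi>
      using r by (simp add: f_def norm_mult norm_power_int)
    show "((\<lambda>k. f k \<phi>) has_sum g (of_real r * cis \<phi>) * (of_real r * cis \<phi>) powi (-n)) UNIV" for \<phi>
      unfolding f_def by (intro has_sum_cmult_left hs) (use r in \<open>simp add: norm_mult\<close>)
  qed
  have fint: "(f k has_integral (if k = n then 2 * of_real pi * c n else 0)) {0..2*pi}" for k
  proof -
    have "((\<lambda>\<phi>. c k * of_real r powi (k - n) * cis \<phi> powi (k - n)) has_integral
             c k * of_real r powi (k - n) * (if k - n = 0 then 2 * of_real pi else 0)) {0..2*pi}"
      by (intro has_integral_mult_right has_integral_cis_powi)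
    moreover have "f k = (\<lambda>\<phi>. c k * of_real r powi (k - n) * cis \<phi> powi (k - n))"
    proof
      fix \<phi>
      have "f k \<phi> = c k * (of_real r * cis \<phi>) powi (k + - n)"
        unfolding f_def using r by (subst power_int_add) auto
      then show "f k \<phi> = c k * of_real r powi (k - n) * cis \<phi> powi (k - n)"
        by (simp add: power_int_mult_distrib)
    qed
    ultimately show ?thesis by (cases "k = n") (simp_all add: mult.commute)
  qed
  obtain I J where IJ: "\<And>X. ((\<lambda>\<phi>. \<Sum>k\<in>X. f k \<phi>) has_integral I X) {0..2*pi}"
     "((\<lambda>\<phi>. g (of_real r * cis \<phi>) * (of_real r * cis \<phi>) powi (-n)) has_integral J) {0..2*pi}"
     "(I \<longlongrightarrow> J) (finite_subsets_at_top UNIV)"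
    using r by (rule_tac uniform_limit_integral[OF ul]) (auto simp: f_def intro!: continuous_intros)
  \<comment> \<open>By orthogonality every finite partial sum that contains the index n has the same
    integral.\<close>
  have "eventually (\<lambda>X. I X = 2 * of_real pi * c n) (finite_subsets_at_top UNIV)"
  proof -
    have "eventually (\<lambda>X. finite X \<and> {n} \<subseteq> X) (finite_subsets_at_top UNIV)"
      unfolding eventually_finite_subsets_at_top by (rule exI[of _ "{n}"]) auto
    then show ?thesis
    proof eventually_elim
      case (elim X)
      have "((\<lambda>\<phi>. \<Sum>k\<in>X. f k \<phi>) has_integral (\<Sum>k\<in>X. if k = n then 2 * of_real pi * c n else 0)) {0..2*pi}"
        using elim by (intro has_integral_sum fint) auto
      then have "I X = (\<Sum>k\<in>X. if k = n then 2 * of_real pi * c n else 0)"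
        using IJ(1) has_integral_unique by blast
      then show ?case using elim by simp
    qed
  qed
  then have "(I \<longlongrightarrow> 2 * of_real pi * c n) (finite_subsets_at_top UNIV)"
    by (rule tendsto_eventually)
  then have "J = 2 * of_real pi * c n"
    using IJ(3) tendsto_unique finite_subsets_at_top_neq_bot by blast
  then show ?thesis using IJ(2) by (simp add: circle_coeff_def integral_unique)
qed

lemma circle_coeff_has_vector_derivative:
  fixes g g' :: "complex \<Rightarrow> real \<Rightarrow> complex"
  assumes r: "r > 0" and x: "x \<in> U" and U: "open U" "convex U"
    and der: "\<And>t x. norm t = r \<Longrightarrow> x \<in> U \<Longrightarrow> (g t has_vector_derivative g' t x) (at x)"
    and cont: "\<And>x. x \<in> U \<Longrightarrow> continuous_on (sphere 0 r) (\<lambda>t. g t x)"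
    and cont': "continuous_on (U \<times> sphere 0 r) (\<lambda>(x, t). g' t x)"
  shows "((\<lambda>x. circle_coeff r n (\<lambda>t. g t x)) has_vector_derivative circle_coeff r n (\<lambda>t. g' t x)) (at x)"
proof -
  define w where "w = (\<lambda>\<phi>. (of_real r * cis \<phi>) powi (-n))"
  have "((\<lambda>x. integral (cbox 0 (2*pi)) (\<lambda>\<phi>. g (of_real r * cis \<phi>) x * w \<phi>)) has_vector_derivative
      integral (cbox 0 (2*pi)) (\<lambda>\<phi>. g' (of_real r * cis \<phi>) x * w \<phi>)) (at x within U)"
  proof (rule leibniz_rule_vector_derivative[where U = U])
    show "((\<lambda>x. g (of_real r * cis \<phi>) x * w \<phi>) has_vector_derivative g' (of_real r * cis \<phi>) y * w \<phi>) (at y within U)"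
      if "y \<in> U" for y \<phi>
      using der[OF rcis_in_sphere[OF r] that, of \<phi>]
      by (intro has_vector_derivative_mult_left) (rule has_vector_derivative_at_within)
    show "(\<lambda>\<phi>. g (of_real r * cis \<phi>) y * w \<phi>) integrable_on cbox 0 (2*pi)" if "y \<in> U" for y
      unfolding w_def using circle_integrable(2)[OF r cont[OF that]] by simp
    have "continuous_on (U \<times> cbox 0 (2*pi)) (\<lambda>p. (\<lambda>(x, t). g' t x) (fst p, of_real r * cis (snd p)))"
      by (rule continuous_on_compose2[OF cont']) (use r in \<open>auto intro!: continuous_intros simp: norm_mult\<close>)
    then show "continuous_on (U \<times> cbox 0 (2*pi)) (\<lambda>(y, \<phi>). g' (of_real r * cis \<phi>) y * w \<phi>)"
      unfolding split_beta w_def using r by (intro continuous_intros) auto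
  qed (use x U in auto)
  then have "((\<lambda>x. integral {0..2*pi} (\<lambda>\<phi>. g (of_real r * cis \<phi>) x * w \<phi>) / (2 * of_real pi)) has_vector_derivative
      integral {0..2*pi} (\<lambda>\<phi>. g' (of_real r * cis \<phi>) x * w \<phi>) / (2 * of_real pi)) (at x)"
    by (intro has_vector_derivative_divide) (simp add: at_within_open[OF x U(1)])
  then show ?thesis unfolding circle_coeff_def w_def .
qed

text \<open>Integration by parts: the derivative of \<open>g t * t powi (-n)\<close> in the angle is
  \<open>\<i>\<close> times \<open>(t * g' t - n * g t) * t powi (-n)\<close>, and it integrates to
  0 because an integral power of t returns to its value after a full turn.\<close>

lemma circle_coeff_theta:
  assumes r: "r > 0"
    and der: "\<And>t. norm t = r \<Longrightarrow> (g has_field_derivative g' t) (at t)"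
    and cont: "continuous_on (sphere 0 r) g'"
  shows "circle_coeff r n (\<lambda>t. t * g' t) = of_int n * circle_coeff r n g"
proof -
  have contg: "continuous_on (sphere 0 r) g"
    by (rule continuous_at_imp_continuous_on) (auto intro!: DERIV_isCont der)
  define F where "F = (\<lambda>\<phi>. g (of_real r * cis \<phi>) * (of_real r * cis \<phi>) powi (-n))"
  define f where "f = (\<lambda>t. t * g' t - of_int n * g t)"
  have F': "(F has_vector_derivative \<i> * (f (of_real r * cis \<phi>) * (of_real r * cis \<phi>) powi (-n))) (at \<phi> within X)" for \<phi> X
  proof -
    define t where "t = of_real r * cis \<phi>"
    have t: "norm t = r" "t \<noteq> 0" using r by (auto simp: t_def norm_mult)
    have 1: "((\<lambda>\<phi>. of_real r * cis \<phi>) has_vector_derivative \<i> * t) (at \<phi> within X)"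
      unfolding t_def cis_conv_exp 
      by (auto intro!: derivative_eq_intros has_vector_derivative_real_field)
    have 2: "((\<lambda>t. g t * t powi (-n)) has_field_derivative (g' t * t powi (-n) + g t * (of_int (-n) * t powi (-n - 1)))) (at t)"
      using t by (auto intro!: derivative_eq_intros der)
    have "(F has_vector_derivative \<i> * t * (g' t * t powi (-n) + g t * (of_int (-n) * t powi (-n - 1)))) (at \<phi> within X)"
      using field_vector_diff_chain_within[OF 1 has_field_derivative_at_within[OF 2[unfolded t_def]]]
      by (simp add: F_def o_def t_def)
    also have "t powi (-n - 1) = t powi (-n) / t"
      using t by (subst power_int_diff) auto
    finally show ?thesis using t unfolding t_def[symmetric] by (simp add: f_def algebra_simps)
  qed
  have "((\<lambda>\<phi>. \<i> * (f (of_real r * cis \<phi>) * (of_real r * cis \<phi>) powi (-n))) has_integral F (2*pi) - F 0) {0..2*pi}"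
    by (rule fundamental_theorem_of_calculus) (auto intro: F')
  then have "((\<lambda>\<phi>. (-\<i>) * (\<i> * (f (of_real r * cis \<phi>) * (of_real r * cis \<phi>) powi (-n)))) has_integral (-\<i>) * (F (2*pi) - F 0)) {0..2*pi}"
    by (rule has_integral_mult_right)
  then have "circle_coeff r n f = 0"
    by (simp add: F_def circle_coeff_def integral_unique)
  moreover have "circle_coeff r n f = circle_coeff r n (\<lambda>t. t * g' t) - circle_coeff r n (\<lambda>t. of_int n * g t)"
    unfolding f_def by (intro circle_coeff_diff r continuous_intros cont contg)
  ultimately show ?thesis by (simp add: circle_coeff_cmult)
qed

lemma circle_coeff_tendsto:
  assumes r: "r > 0" 
    and lim: "uniform_limit (sphere 0 r) f g F"
    and cont: "\<forall>\<^sub>F x in F. continuous_on (sphere 0 r) (f x)" "continuous_on (sphere 0 r) g"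
  shows "((\<lambda>x. circle_coeff r n (f x)) \<longlongrightarrow> circle_coeff r n g) F"
proof (rule tendstoI)
  fix e :: real assume "e > 0"
  \<comment> \<open>The power of r cancels the factor \<open>r powi (-n)\<close> lost in
    \<open>circle_coeff_bound\<close>; the half makes the final inequality strict.\<close>
  define d where "d = e / 2 * r powi n"
  have d: "d > 0" using \<open>e > 0\<close> r by (simp add: d_def)
  have "\<forall>\<^sub>F x in F. \<forall>t\<in>sphere 0 r. dist (f x t) (g t) < d"
    using uniform_limitD[OF lim d] .
  with cont(1) show "\<forall>\<^sub>F x in F. dist (circle_coeff r n (f x)) (circle_coeff r n g) < e"
  proof eventually_elim
    case (elim x)
    have "norm (circle_coeff r n (\<lambda>t. f x t - g t)) \<le> d * r powi (-n)"
      using elim by (intro circle_coeff_bound r continuous_intros cont) (auto simp: dist_norm less_imp_le)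
    also have "d * r powi (-n) = e / 2"
      using r by (simp add: d_def power_int_minus)
    finally show ?case
      using \<open>e > 0\<close> by (subst (asm) circle_coeff_diff) (use elim r cont in \<open>auto simp: dist_norm\<close>)
  qed
qed

lemma circle_coeff_sum:
  assumes "r > 0" "finite I" "\<And>i. i \<in> I \<Longrightarrow> continuous_on (sphere 0 r) (f i)"
  shows "circle_coeff r n (\<lambda>t. \<Sum>i\<in>I. f i t) = (\<Sum>i\<in>I. circle_coeff r n (f i))"
  using assms(2,3)
proof (induction I)
  case empty
  show ?case by (simp add: circle_coeff_def)
next
  case (insert i I)
  then show ?case
    by (simp add: circle_coeff_add[OF assms(1)] continuous_on_sum)
qed

text \<open>Dividing a Taylor series by \<open>t ^ N\<close> gives a Laurent series indexed by all
  integers. \<open>has_sum\<close> demands absolute convergence, which comes from ordinary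
  convergence at a radius strictly between \<open>|t|\<close> and 1.\<close>

lemma shifted_power_series_has_sum:
  fixes b :: "nat \<Rightarrow> complex"
  assumes sums: "\<And>t. norm t < 1 \<Longrightarrow> (\<lambda>n. b n * t ^ n) sums h t"
    and t: "0 < norm t" "norm t < 1"
  shows "((\<lambda>j::int. (if j + int N \<ge> 0 then b (nat (j + int N)) else 0) * t powi j) has_sum h t / t ^ N) UNIV"
proof -
  obtain \<rho> where \<rho>: "norm t < \<rho>" "\<rho> < 1" using t(2) dense by blast
  then have "\<rho> > 0" using norm_ge_zero[of t] by linarith
  have "summable (\<lambda>n. norm (b n * t ^ n))"
    using sums[of "of_real \<rho>"] \<rho> \<open>\<rho> > 0\<close> by (intro powser_insidea[where x = "of_real \<rho>"]) (auto simp: sums_iff)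
  then have "((\<lambda>n. b n * t ^ n) has_sum h t) UNIV"
    by (rule norm_summable_imp_has_sum) (rule sums[OF t(2)])
  then have "((\<lambda>n. b n * t ^ n * inverse (t ^ N)) has_sum h t * inverse (t ^ N)) UNIV"
    by (rule has_sum_cmult_left)
  moreover define f where "f = (\<lambda>j::int. (if j + int N \<ge> 0 then b (nat (j + int N)) else 0) * t powi j)"
  have "(\<lambda>n. b n * t ^ n * inverse (t ^ N)) = f \<circ> (\<lambda>n. int n - int N)"
    using t by (auto simp: f_def fun_eq_iff power_int_diff divide_inverse)
  ultimately have "(f \<circ> (\<lambda>n. int n - int N) has_sum h t / t ^ N) UNIV" by (simp add: divide_inverse)
  then have "(f has_sum h t / t ^ N) (range (\<lambda>n. int n - int N))"
    by (subst has_sum_reindex) (auto simp: inj_on_def)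
  moreover have "f j = 0" if "j \<notin> range (\<lambda>n. int n - int N)" for j
  proof -
    have "\<not> j + int N \<ge> 0"
    proof
      assume "j + int N \<ge> 0"
      then have "j = int (nat (j + int N)) - int N" by simp
      with that show False by blast
    qed
    then show ?thesis by (simp add: f_def)
  qed
  ultimately have "(f has_sum h t / t ^ N) UNIV"
    using has_sum_cong_neutral[where S = "range (\<lambda>n. int n - int N)" and T = UNIV and f = f and g = f] by blast
  then show ?thesis by (simp add: f_def)
qed

lemma Lambda_eq_circle_coeff:
  assumes "\<And>t. 0 < norm t \<Longrightarrow> norm t < 1 \<Longrightarrow> genfun i \<mu> \<nu> t x = g t"
    and c: "\<And>t. 0 < norm t \<Longrightarrow> norm t < 1 \<Longrightarrow> ((\<lambda>n. c n * t powi n) has_sum g t) UNIV"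
  shows "Lambda i \<mu> \<nu> j x = circle_coeff (1/2) j g"
proof -
  have "(THE c. \<exists>r>0. \<forall>t. 0 < norm t \<and> norm t < r \<longrightarrow>
         ((\<lambda>n. c n * t powi n) has_sum genfun i \<mu> \<nu> t x) UNIV) = c"
  proof (rule the_equality)
    show "\<exists>r>0. \<forall>t. 0 < norm t \<and> norm t < r \<longrightarrow> ((\<lambda>n. c n * t powi n) has_sum genfun i \<mu> \<nu> t x) UNIV"
      using assms by (intro exI[of _ 1]) auto
  next
    fix d assume "\<exists>r>0. \<forall>t. 0 < norm t \<and> norm t < r \<longrightarrow> ((\<lambda>n. d n * t powi n) has_sum genfun i \<mu> \<nu> t x) UNIV"
    then obtain r where r: "r > 0" "\<And>t. 0 < norm t \<Longrightarrow> norm t < r \<Longrightarrow> ((\<lambda>n. d n * t powi n) has_sum genfun i \<mu> \<nu> t x) UNIV"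
      by auto
    \<comment> \<open>A rival family comes with its own radius, possibly below 1/2, so the two are
      compared on a circle lying inside both discs.\<close>
    define \<rho> where "\<rho> = min (r / 2) (1 / 2)"
    have \<rho>: "0 < \<rho>" "\<rho> < r" "\<rho> < 1" using r(1) by (auto simp: \<rho>_def)
    show "d = c"
    proof
      fix n
      have "circle_coeff \<rho> n (\<lambda>t. genfun i \<mu> \<nu> t x) = d n"
        by (rule circle_coeff_has_sum[OF \<rho>(1)]) (use r(2) \<rho> in auto)
      moreover have "circle_coeff \<rho> n (\<lambda>t. genfun i \<mu> \<nu> t x) = c n"
        by (rule circle_coeff_has_sum[OF \<rho>(1)]) (use assms \<rho> in auto)
      ultimately show "d n = c n" by simp
    qed
  qed
  moreover have "circle_coeff (1/2) j g = c j"
    by (rule circle_coeff_has_sum) (auto intro!: c)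
  ultimately show ?thesis by (simp add: Lambda_def)
qed

section \<open>Modified Bessel functions\<close>

text \<open>With \<open>d = rGamma\<close> and \<open>w = (z/2)^2\<close> this is the normalised
  function \<open>bessel_I_tilde\<close>, and with \<open>d = deriv rGamma\<close> its derivative in
  the order. The coefficient depends on \<alpha> and k through their sum, so differentiation in w
  raises \<alpha> by one in both cases.\<close>

definition shift_series :: "(complex \<Rightarrow> complex) \<Rightarrow> complex \<Rightarrow> complex \<Rightarrow> complex" where
  "shift_series d \<alpha> w = (\<Sum>k. d (\<alpha> + of_nat k + 1) / fact k * w ^ k)"

abbreviation bessel_phi :: "complex \<Rightarrow> complex \<Rightarrow> complex" where
  "bessel_phi \<equiv> shift_series rGamma"

abbreviation bessel_psi :: "complex \<Rightarrow> complex \<Rightarrow> complex" where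
  "bessel_psi \<equiv> shift_series (deriv rGamma)"

text \<open>From \<open>rGamma z = z * rGamma (z + 1)\<close>, a step to the right does not increase
  the modulus once \<open>|z| \<ge> 1\<close>. N is so large that all later translates of the ball
  satisfy this; the finitely many earlier ones are bounded by compactness.\<close>

lemma rGamma_translates_bounded:
  fixes \<alpha>0 :: complex
  obtains M where "\<And>\<alpha> k. \<alpha> \<in> cball \<alpha>0 1 \<Longrightarrow> norm (rGamma (\<alpha> + of_nat k + 1)) \<le> M"
proof -
  obtain N :: nat where N: "norm \<alpha>0 + 2 \<le> real N" using real_arch_simple by blast
  have "\<exists>M. \<forall>\<alpha>\<in>cball \<alpha>0 1. norm (rGamma (\<alpha> + of_nat k + 1)) \<le> M" for k
  proof -
    have "compact ((\<lambda>\<alpha>. rGamma (\<alpha> + of_nat k + 1)) ` cball \<alpha>0 1)"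
      by (intro compact_continuous_image continuous_intros continuous_on_compose2[OF continuous_on_rGamma]) auto
    then show ?thesis
      by (auto dest!: compact_imp_bounded simp: bounded_iff)
  qed
  then obtain M where M: "\<And>k \<alpha>. \<alpha> \<in> cball \<alpha>0 1 \<Longrightarrow> norm (rGamma (\<alpha> + of_nat k + 1)) \<le> M k"
    by metis
  have nonneg: "M k \<ge> 0" for k using order_trans[OF norm_ge_zero M[of \<alpha>0 k]] by simp
  have tail: "norm (rGamma (\<alpha> + of_nat (N + i) + 1)) \<le> M N" if \<alpha>: "\<alpha> \<in> cball \<alpha>0 1" for \<alpha> i
  proof (induction i)
    case 0 show ?case using M[OF \<alpha>, of N] by simp
  next
    case (Suc i)
    define z where "z = \<alpha> + of_nat (N + i) + 1"
    have "norm \<alpha> \<le> norm \<alpha>0 + 1"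
      using \<alpha> norm_triangle_ineq2[of \<alpha> \<alpha>0] by (simp add: dist_norm norm_minus_commute)
    moreover have "norm (of_nat (N + i + 1) :: complex) - norm \<alpha> \<le> norm z"
      using norm_triangle_ineq2[of "of_nat (N + i + 1)" "-\<alpha>"] unfolding z_def
      by (simp add: algebra_simps)
    moreover have "norm (of_nat (N + i + 1) :: complex) = real (N + i + 1)"
      using norm_of_nat by blast
    ultimately have z: "norm z \<ge> 1" using N by simp
    have "norm (rGamma (z + 1)) * 1 \<le> norm (rGamma (z + 1)) * norm z"
      using z by (intro mult_left_mono) auto
    also have "\<dots> = norm (rGamma z)"
      by (metis norm_mult mult.commute rGamma_plus1)
    also have "\<dots> \<le> M N" using Suc by (simp add: z_def)
    finally show ?case by (simp add: z_def algebra_simps)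
  qed
  show ?thesis
  proof (rule that[of "\<Sum>k\<le>N. M k"])
    fix \<alpha> k assume \<alpha>: "\<alpha> \<in> cball \<alpha>0 1"
    have "M i \<le> (\<Sum>k\<le>N. M k)" if "i \<le> N" for i
      using that nonneg by (intro member_le_sum) auto
    moreover have "norm (rGamma (\<alpha> + of_nat k + 1)) \<le> M (min k N)"
      using M[OF \<alpha>, of k] tail[OF \<alpha>, of "k - N"] by (cases "k \<le> N") (auto simp: min_def)
    ultimately show "norm (rGamma (\<alpha> + of_nat k + 1)) \<le> (\<Sum>k\<le>N. M k)"
      using order_trans by (metis min.cobounded2)
  qed
qed

text \<open>The variable here is the order: for fixed w the terms are entire in \<alpha> and locally
  uniformly dominated by \<open>M * |w|^k / k!\<close>. One comparison theorem then gives both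
  summabilities together with termwise differentiation.\<close>

lemma bessel_phi_series:
  shows summable_bessel_phi: "summable (\<lambda>k. rGamma (\<alpha> + of_nat k + 1) / fact k * w ^ k)"
    and summable_bessel_psi: "summable (\<lambda>k. deriv rGamma (\<alpha> + of_nat k + 1) / fact k * w ^ k)"
    and has_field_derivative_bessel_phi_order:
      "((\<lambda>\<alpha>. bessel_phi \<alpha> w) has_field_derivative bessel_psi \<alpha> w) (at \<alpha>)"
proof -
  define f where "f = (\<lambda>k \<alpha>. rGamma (\<alpha> + of_nat k + 1) / fact k * w ^ k)"
  define f' where "f' = (\<lambda>k \<alpha>. deriv rGamma (\<alpha> + of_nat k + 1) / fact k * w ^ k)"
  have "\<exists>g g'. \<forall>x \<in> UNIV. ((\<lambda>n. f n x) sums g x) \<and> ((\<lambda>n. f' n x) sums g' x) \<and> (g has_field_derivative g' x) (at x)"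
  proof (rule series_and_derivative_comparison_complex)
    fix n and x :: complex
    have "(rGamma has_field_derivative deriv rGamma (x + of_nat n + 1)) (at (x + of_nat n + 1))"
      using field_differentiable_rGamma DERIV_deriv_iff_field_differentiable by blast
    then have "((\<lambda>x. rGamma (x + of_nat n + 1)) has_field_derivative deriv rGamma (x + of_nat n + 1) * 1) (at x)"
      by (rule DERIV_chain2) (auto intro!: derivative_eq_intros)
    then show "(f n has_field_derivative f' n x) (at x)"
      unfolding f_def f'_def by (intro DERIV_cmult_right DERIV_cdivide) simp
  next
    fix \<alpha>0 :: complex
    obtain M where M: "\<And>\<alpha> k. \<alpha> \<in> cball \<alpha>0 1 \<Longrightarrow> norm (rGamma (\<alpha> + of_nat k + 1)) \<le> M"
      using rGamma_translates_bounded by blast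
    define h where "h = (\<lambda>n. of_real (M * (inverse (fact n) * norm w ^ n)) :: complex)"
    have M0: "M \<ge> 0" using order_trans[OF norm_ge_zero M[of \<alpha>0 0]] by simp
    have "summable h" unfolding h_def by (intro summable_of_real summable_mult summable_exp)
    moreover have "range h \<subseteq> \<real>\<^sub>\<ge>\<^sub>0" 
    proof (intro image_subsetI)
      show "h n \<in> \<real>\<^sub>\<ge>\<^sub>0" for n
        unfolding h_def nonneg_Reals_of_real_iff using M0 by simp
    qed
    moreover have "norm (f n y) \<le> norm (h n)" if "y \<in> ball \<alpha>0 1" for n y
      using M[of y n] that M0
      by (simp add: f_def h_def norm_mult norm_divide norm_power abs_mult divide_inverse mult.assoc mult_right_mono)
    ultimately show "\<exists>d (h :: nat \<Rightarrow> complex). 0 < d \<and> summable h \<and> range h \<subseteq> \<real>\<^sub>\<ge>\<^sub>0 \<and>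
        (\<forall>\<^sub>F n in sequentially. \<forall>y\<in>ball \<alpha>0 d \<inter> UNIV. norm (f n y) \<le> norm (h n))"
      by (intro exI[of _ 1] exI[of _ h]) auto
  qed auto
  then obtain g g' where g: "\<And>x. (\<lambda>n. f n x) sums g x" "\<And>x. (\<lambda>n. f' n x) sums g' x"
       "\<And>x. (g has_field_derivative g' x) (at x)" by auto
  have "g = (\<lambda>\<alpha>. bessel_phi \<alpha> w)" "g' = (\<lambda>\<alpha>. bessel_psi \<alpha> w)"
    using g(1,2) by (auto simp: fun_eq_iff shift_series_def f_def f'_def sums_iff)
  with g show "summable (\<lambda>k. rGamma (\<alpha> + of_nat k + 1) / fact k * w ^ k)"
    "summable (\<lambda>k. deriv rGamma (\<alpha> + of_nat k + 1) / fact k * w ^ k)"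
    "((\<lambda>\<alpha>. bessel_phi \<alpha> w) has_field_derivative bessel_psi \<alpha> w) (at \<alpha>)"
    by (auto simp: f_def f'_def sums_iff)
qed

lemma has_field_derivative_shift_series:
  assumes "\<And>w. summable (\<lambda>k. d (\<alpha> + of_nat k + 1) / fact k * w ^ k)"
  shows "(shift_series d \<alpha> has_field_derivative shift_series d (\<alpha> + 1) w) (at w)"
proof -
  have "((\<lambda>w. \<Sum>k. d (\<alpha> + of_nat k + 1) / fact k * w ^ k) has_field_derivative
        (\<Sum>k. diffs (\<lambda>k. d (\<alpha> + of_nat k + 1) / fact k) k * w ^ k)) (at w)"
    by (intro termdiffs_strong_converges_everywhere assms)
  moreover have "diffs (\<lambda>k. d (\<alpha> + of_nat k + 1) / fact k) k = d (\<alpha> + 1 + of_nat k + 1) / fact k" for k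
    by (simp add: diffs_def field_simps del: of_nat_Suc) (simp add: add_ac)
  ultimately show ?thesis by (simp add: shift_series_def[abs_def])
qed

lemmas has_field_derivative_bessel_phi = has_field_derivative_shift_series[OF summable_bessel_phi]
lemmas has_field_derivative_bessel_psi = has_field_derivative_shift_series[OF summable_bessel_psi]

lemma shift_series_0 [simp]: "shift_series d \<alpha> 0 = d (\<alpha> + 1)"
  unfolding shift_series_def using powser_zero[of "\<lambda>k. d (\<alpha> + of_nat k + 1) / fact k"] by simp

text \<open>Termwise it is \<open>rGamma z = z * rGamma (z + 1)\<close> at
  \<open>z = \<alpha> + k + 1\<close>, with the factor z split as \<open>k + (\<alpha> + 1)\<close>.
  Since differentiation raises the order, it is Bessel's differential equation in the variable
  w.\<close>

lemma bessel_phi_recurrence: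
  "w * bessel_phi (\<alpha> + 2) w + (\<alpha> + 1) * bessel_phi (\<alpha> + 1) w = bessel_phi \<alpha> w"
proof -
  have "(\<lambda>k. w * (rGamma (\<alpha> + 2 + of_nat k + 1) / fact k * w ^ k)) sums (w * bessel_phi (\<alpha> + 2) w)"
    unfolding shift_series_def by (intro sums_mult summable_sums summable_bessel_phi)
  also have "(\<lambda>k. w * (rGamma (\<alpha> + 2 + of_nat k + 1) / fact k * w ^ k)) =
     (\<lambda>k. of_nat (Suc k) * rGamma (\<alpha> + 1 + of_nat (Suc k) + 1) / fact (Suc k) * w ^ Suc k)"
  proof
    fix k
    have e: "\<alpha> + 1 + of_nat (Suc k) + 1 = \<alpha> + 2 + of_nat k + 1" by simp
    show "w * (rGamma (\<alpha> + 2 + of_nat k + 1) / fact k * w ^ k) =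
        of_nat (Suc k) * rGamma (\<alpha> + 1 + of_nat (Suc k) + 1) / fact (Suc k) * w ^ Suc k"
      unfolding e by (simp del: of_nat_Suc)
  qed
  finally have 1: "(\<lambda>k. of_nat k * rGamma (\<alpha> + 1 + of_nat k + 1) / fact k * w ^ k) sums (w * bessel_phi (\<alpha> + 2) w)"
    by (subst (asm) sums_Suc_iff) simp
  have 2: "(\<lambda>k. (\<alpha> + 1) * (rGamma (\<alpha> + 1 + of_nat k + 1) / fact k * w ^ k)) sums ((\<alpha> + 1) * bessel_phi (\<alpha> + 1) w)"
    unfolding shift_series_def by (intro sums_mult summable_sums summable_bessel_phi)
  have "of_nat k * rGamma (\<alpha> + 1 + of_nat k + 1) / fact k * w ^ k + (\<alpha> + 1) * (rGamma (\<alpha> + 1 + of_nat k + 1) / fact k * w ^ k)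
     = rGamma (\<alpha> + of_nat k + 1) / fact k * w ^ k" for k
  proof -
    have "rGamma (\<alpha> + of_nat k + 1) = (\<alpha> + of_nat k + 1) * rGamma (\<alpha> + 1 + of_nat k + 1)"
      using rGamma_plus1[of "\<alpha> + of_nat k + 1"] by (simp add: add_ac)
    then show ?thesis by (simp add: add_divide_distrib distrib_right mult.assoc)
  qed
  with sums_add[OF 1 2] show ?thesis
    by (simp add: shift_series_def sums_iff)
qed

text \<open>The derivative of \<open>bessel_phi_recurrence\<close> in the order; the extra
  \<open>bessel_phi\<close> comes from the factor \<open>\<alpha> + 1\<close> and later makes the
  equation of \<open>bessel_psi\<close> inhomogeneous.\<close>

lemma bessel_psi_recurrence:
  "w * bessel_psi (\<alpha> + 2) w + bessel_phi (\<alpha> + 1) w + (\<alpha> + 1) * bessel_psi (\<alpha> + 1) w = bessel_psi \<alpha> w"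
proof -
  have D: "((\<lambda>\<alpha>. bessel_phi (\<alpha> + c) w) has_field_derivative bessel_psi (\<alpha> + c) w) (at \<alpha>)" for c
    using DERIV_shift[of "\<lambda>\<alpha>. bessel_phi \<alpha> w"] has_field_derivative_bessel_phi_order by blast
  have "((\<lambda>\<alpha>. w * bessel_phi (\<alpha> + 2) w + (\<alpha> + 1) * bessel_phi (\<alpha> + 1) w) has_field_derivative
      w * bessel_psi (\<alpha> + 2) w + (bessel_phi (\<alpha> + 1) w + (\<alpha> + 1) * bessel_psi (\<alpha> + 1) w)) (at \<alpha>)"
    by (auto intro!: derivative_eq_intros D)
  then show ?thesis
    unfolding bessel_phi_recurrence using DERIV_unique has_field_derivative_bessel_phi_order
    by (metis add.assoc)
qed

text \<open>The symmetry of I under \<open>n \<mapsto> -n\<close>: \<open>rGamma\<close> vanishes at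
  the nonpositive integers, which kills the first n terms, and the rest is an index shift.\<close>

lemma bessel_phi_minus_of_nat: "bessel_phi (- of_nat n) w = w ^ n * bessel_phi (of_nat n) w"
proof -
  have "(\<lambda>k. w ^ n * (rGamma (of_nat n + of_nat k + 1) / fact k * w ^ k)) sums (w ^ n * bessel_phi (of_nat n) w)"
    unfolding shift_series_def by (intro sums_mult summable_sums summable_bessel_phi)
  also have "(\<lambda>k. w ^ n * (rGamma (of_nat n + of_nat k + 1) / fact k * w ^ k)) =
    (\<lambda>k. rGamma (- of_nat n + of_nat (k + n) + 1) / fact (k + n) * w ^ (k + n))"
  proof
    fix k
    have "rGamma (of_nat n + of_nat k + 1 :: complex) = inverse (fact (n + k))"
      using rGamma_of_int[of "int (n + k + 1)", where ?'a=complex] by (simp add: nat_add_distrib add_ac)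
    moreover have "rGamma (- of_nat n + of_nat (k + n) + 1 :: complex) = inverse (fact k)"
      using rGamma_of_int[of "int (k + 1)", where ?'a=complex] by (simp add: add_ac)
    ultimately show "w ^ n * (rGamma (of_nat n + of_nat k + 1) / fact k * w ^ k) =
        rGamma (- of_nat n + of_nat (k + n) + 1) / fact (k + n) * w ^ (k + n)"
      by (simp add: power_add field_simps)
  qed
  finally have "(\<lambda>k. rGamma (- of_nat n + of_nat k + 1) / fact k * w ^ k) sums
     (w ^ n * bessel_phi (of_nat n) w + (\<Sum>k<n. rGamma (- of_nat n + of_nat k + 1) / fact k * w ^ k))"
    by (subst (asm) sums_iff_shift)
  moreover have "rGamma (- of_nat n + of_nat k + 1) = (0::complex)" if "k < n" for k
    using rGamma_of_int[of "- int n + int k + 1", where ?'a=complex] that by simp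
  ultimately show ?thesis by (simp add: shift_series_def sums_iff)
qed

section \<open>Bessel's equation with a remainder term, and operations on its solutions\<close>

text \<open>The operator form is \<open>\<theta>(\<theta> + \<nu>) F = z\<^sup>2 F + R\<close> with \<open>F1 = \<theta> F\<close>.\<close>
definition bessel_system ::
    "complex \<Rightarrow> complex set \<Rightarrow> (complex \<Rightarrow> complex) \<Rightarrow> (complex \<Rightarrow> complex) \<Rightarrow> (complex \<Rightarrow> complex) \<Rightarrow> bool" where
  "bessel_system \<nu> S R F F1 \<longleftrightarrow> 0 \<notin> S \<and> (\<forall>z\<in>S. (F has_field_derivative F1 z / z) (at z) \<and>
      (F1 has_field_derivative (z\<^sup>2 * F z - \<nu> * F1 z + R z) / z) (at z))"

lemma bessel_systemD:
  assumes "bessel_system \<nu> S R F F1" "z \<in> S"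
  shows "(F has_field_derivative F1 z / z) (at z)"
    and "(F1 has_field_derivative (z\<^sup>2 * F z - \<nu> * F1 z + R z) / z) (at z)"
    and "z \<noteq> 0"
  using assms unfolding bessel_system_def by auto

lemma bessel_system_lincomb:
  assumes "bessel_system \<nu> S R F F1" "bessel_system \<nu> S R' G G1"
  shows "bessel_system \<nu> S (\<lambda>z. a * R z + b * R' z) (\<lambda>z. a * F z + b * G z) (\<lambda>z. a * F1 z + b * G1 z)"
  unfolding bessel_system_def
proof (intro conjI ballI)
  show "0 \<notin> S" using assms(1) by (simp add: bessel_system_def)
  fix z assume z: "z \<in> S"
  note F = bessel_systemD[OF assms(1) z] and G = bessel_systemD[OF assms(2) z]
  show "((\<lambda>z. a * F z + b * G z) has_field_derivative (a * F1 z + b * G1 z) / z) (at z)"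
    using F(3) by (auto intro!: derivative_eq_intros F(1) G(1) simp: add_divide_distrib mult.commute)
  show "((\<lambda>z. a * F1 z + b * G1 z) has_field_derivative
        (z\<^sup>2 * (a * F z + b * G z) - \<nu> * (a * F1 z + b * G1 z) + (a * R z + b * R' z)) / z) (at z)"
    by (rule derivative_eq_intros F(2) G(2) refl)+ (use F(3) in \<open>simp add: field_simps\<close>)
qed

lemma bessel_system_cong:
  assumes "bessel_system \<nu> S R F F1" "open S" "\<And>z. z \<in> S \<Longrightarrow> G z = F z" "\<And>z. z \<in> S \<Longrightarrow> R' z = R z"
  shows "bessel_system \<nu> S R' G F1"
  unfolding bessel_system_def
proof (intro conjI ballI)
  show "0 \<notin> S" using assms(1) by (simp add: bessel_system_def)
  fix z assume z: "z \<in> S"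
  note F = bessel_systemD[OF assms(1) z]
  show "(G has_field_derivative F1 z / z) (at z)"
    by (rule has_field_derivative_transform_within_open[OF F(1) assms(2) z]) (simp add: assms(3))
  show "(F1 has_field_derivative (z\<^sup>2 * G z - \<nu> * F1 z + R' z) / z) (at z)"
    using F(2) assms(3,4)[OF z] by simp
qed

text \<open>P behaves like \<open>z powr (-\<nu>)\<close>, and conjugation by it replaces \<theta>
  by \<open>\<theta> - \<nu>\<close>. Hence \<open>\<theta>(\<theta> + \<nu>)(P F) = P (\<theta> -
  \<nu>)\<theta> F\<close>. This supplies the second solution, built from the order
  \<open>-\<nu>/2\<close>.\<close>

lemma bessel_system_twist:
  assumes "bessel_system (-\<nu>) S R F F1"
    and P: "\<And>z. z \<in> S \<Longrightarrow> (P has_field_derivative - \<nu> * P z / z) (at z)"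
  shows "bessel_system \<nu> S (\<lambda>z. P z * R z) (\<lambda>z. P z * F z) (\<lambda>z. P z * (F1 z - \<nu> * F z))"
  unfolding bessel_system_def
proof (intro conjI ballI)
  show "0 \<notin> S" using assms(1) by (simp add: bessel_system_def)
  fix z assume z: "z \<in> S"
  note F = bessel_systemD[OF assms(1) z]
  show "((\<lambda>z. P z * F z) has_field_derivative (P z * (F1 z - \<nu> * F z)) / z) (at z)"
    by (rule derivative_eq_intros F(1) P[OF z] refl)+ (use F(3) in \<open>simp add: field_simps\<close>)
  show "((\<lambda>z. P z * (F1 z - \<nu> * F z)) has_field_derivative
       (z\<^sup>2 * (P z * F z) - \<nu> * (P z * (F1 z - \<nu> * F z)) + P z * R z) / z) (at z)"
    by (rule derivative_eq_intros F(1,2) P[OF z] refl)+ (use F(3) in \<open>simp add: field_simps power2_eq_square\<close>)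
qed

text \<open>With \<open>w = (z/2)^2\<close> the operator \<theta> in z is twice that in w, whence
  the parameter \<open>2 * \<alpha>\<close> and the factor \<open>z^2/2\<close>. The equation itself
  is \<open>bessel_phi_recurrence\<close>.\<close>

lemma bessel_system_phi:
  assumes "0 \<notin> S"
  shows "bessel_system (2 * \<alpha>) S (\<lambda>z. 0) (\<lambda>z. bessel_phi \<alpha> ((z/2)\<^sup>2)) (\<lambda>z. z\<^sup>2 / 2 * bessel_phi (\<alpha> + 1) ((z/2)\<^sup>2))"
  unfolding bessel_system_def
proof (intro conjI ballI)
  fix z assume "z \<in> S"
  then have z: "z \<noteq> 0" using assms by auto
  have D: "((\<lambda>z. bessel_phi \<alpha> ((z/2)\<^sup>2)) has_field_derivative bessel_phi (\<alpha> + 1) ((z/2)\<^sup>2) * (z / 2)) (at z)" for \<alpha>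
    by (rule DERIV_chain2[OF has_field_derivative_bessel_phi])
       (auto intro!: derivative_eq_intros simp: power2_eq_square)
  have E: "((\<lambda>z. z\<^sup>2 / 2) has_field_derivative z) (at z)"
    by (auto intro!: derivative_eq_intros)
  show "((\<lambda>z. bessel_phi \<alpha> ((z/2)\<^sup>2)) has_field_derivative z\<^sup>2 / 2 * bessel_phi (\<alpha> + 1) ((z/2)\<^sup>2) / z) (at z)"
    using D[of \<alpha>] z by (simp add: power2_eq_square field_simps)
  have rec: "bessel_phi \<alpha> ((z/2)\<^sup>2) = (z/2)\<^sup>2 * bessel_phi (\<alpha> + 1 + 1) ((z/2)\<^sup>2) + (\<alpha> + 1) * bessel_phi (\<alpha> + 1) ((z/2)\<^sup>2)"
    using bessel_phi_recurrence[of "(z/2)\<^sup>2" \<alpha>] by (simp add: add.commute)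
  show "((\<lambda>z. z\<^sup>2 / 2 * bessel_phi (\<alpha> + 1) ((z/2)\<^sup>2)) has_field_derivative
      (z\<^sup>2 * bessel_phi \<alpha> ((z/2)\<^sup>2) - 2 * \<alpha> * (z\<^sup>2 / 2 * bessel_phi (\<alpha> + 1) ((z/2)\<^sup>2)) + 0) / z) (at z)"
    unfolding rec
    by (rule DERIV_cong[OF DERIV_mult[OF E D]])
       (use z in \<open>simp_all add: field_simps power2_eq_square\<close>)
qed fact

text \<open>Differentiating \<open>\<theta>(\<theta> + 2\<alpha>) F = z^2 F\<close> in \<alpha>
  leaves the extra term \<open>2 \<theta> F\<close>, which for \<open>F = bessel_phi\<close> is
  \<open>z^2\<close> times the function of order \<open>\<alpha> + 1\<close>; moved to the right it
  becomes the remainder.\<close>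

lemma bessel_system_psi:
  assumes "0 \<notin> S"
  shows "bessel_system (2 * \<alpha>) S (\<lambda>z. - z\<^sup>2 * bessel_phi (\<alpha> + 1) ((z/2)\<^sup>2))
     (\<lambda>z. bessel_psi \<alpha> ((z/2)\<^sup>2)) (\<lambda>z. z\<^sup>2 / 2 * bessel_psi (\<alpha> + 1) ((z/2)\<^sup>2))"
  unfolding bessel_system_def
proof (intro conjI ballI)
  fix z assume "z \<in> S"
  then have z: "z \<noteq> 0" using assms by auto
  have D: "((\<lambda>z. bessel_psi \<alpha> ((z/2)\<^sup>2)) has_field_derivative bessel_psi (\<alpha> + 1) ((z/2)\<^sup>2) * (z / 2)) (at z)" for \<alpha>
    by (rule DERIV_chain2[OF has_field_derivative_bessel_psi])
       (auto intro!: derivative_eq_intros simp: power2_eq_square)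
  have E: "((\<lambda>z. z\<^sup>2 / 2) has_field_derivative z) (at z)"
    by (auto intro!: derivative_eq_intros)
  show "((\<lambda>z. bessel_psi \<alpha> ((z/2)\<^sup>2)) has_field_derivative z\<^sup>2 / 2 * bessel_psi (\<alpha> + 1) ((z/2)\<^sup>2) / z) (at z)"
    using D[of \<alpha>] z by (simp add: power2_eq_square field_simps)
  have rec: "bessel_psi \<alpha> ((z/2)\<^sup>2) = (z/2)\<^sup>2 * bessel_psi (\<alpha> + 1 + 1) ((z/2)\<^sup>2) +
        bessel_phi (\<alpha> + 1) ((z/2)\<^sup>2) + (\<alpha> + 1) * bessel_psi (\<alpha> + 1) ((z/2)\<^sup>2)"
    using bessel_psi_recurrence[of "(z/2)\<^sup>2" \<alpha>] by (simp add: add.commute)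
  show "((\<lambda>z. z\<^sup>2 / 2 * bessel_psi (\<alpha> + 1) ((z/2)\<^sup>2)) has_field_derivative
      (z\<^sup>2 * bessel_psi \<alpha> ((z/2)\<^sup>2) - 2 * \<alpha> * (z\<^sup>2 / 2 * bessel_psi (\<alpha> + 1) ((z/2)\<^sup>2)) +
        - z\<^sup>2 * bessel_phi (\<alpha> + 1) ((z/2)\<^sup>2)) / z) (at z)"
    unfolding rec
    by (rule DERIV_cong[OF DERIV_mult[OF E D]])
       (use z in \<open>simp_all add: field_simps power2_eq_square\<close>)
qed fact

text \<open>Since \<theta> maps the logarithm to 1, the Leibniz rule leaves
  \<open>(2\<theta> + \<nu>) F\<close>, the formal derivative of
  \<open>\<theta>(\<theta> + \<nu>)\<close> applied to F. The right half plane keeps clear of the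
  cut.\<close>

lemma bessel_system_Ln:
  assumes "bessel_system \<nu> S (\<lambda>z. 0) F F1" "\<And>z. z \<in> S \<Longrightarrow> Re z > 0"
  shows "bessel_system \<nu> S (\<lambda>z. 2 * F1 z + \<nu> * F z) (\<lambda>z. Ln (z/2) * F z) (\<lambda>z. Ln (z/2) * F1 z + F z)"
  unfolding bessel_system_def
proof (intro conjI ballI)
  show "0 \<notin> S" using assms(1) by (simp add: bessel_system_def)
  fix z assume z: "z \<in> S"
  note F = bessel_systemD[OF assms(1) z]
  have L: "((\<lambda>z. Ln (z/2)) has_field_derivative 1 / z) (at z)"
    using assms(2)[OF z] by (auto intro!: derivative_eq_intros simp: complex_nonpos_Reals_iff)
  show "((\<lambda>z. Ln (z/2) * F z) has_field_derivative (Ln (z/2) * F1 z + F z) / z) (at z)"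
    by (rule derivative_eq_intros F(1) L refl)+ (use F(3) in \<open>simp add: field_simps\<close>)
  show "((\<lambda>z. Ln (z/2) * F1 z + F z) has_field_derivative
      (z\<^sup>2 * (Ln (z/2) * F z) - \<nu> * (Ln (z/2) * F1 z + F z) + (2 * F1 z + \<nu> * F z)) / z) (at z)"
    by (rule derivative_eq_intros F(1,2) L refl)+ (use F(3) in \<open>simp add: field_simps power2_eq_square\<close>)
qed

section \<open>The normalised functions I and K as solutions of Bessel's equation\<close>

lemma bessel_I_conv_phi: "bessel_I \<alpha> z = (z/2) powr \<alpha> * bessel_phi \<alpha> ((z/2)\<^sup>2)"
  by (simp add: bessel_I_def shift_series_def power_mult[symmetric] mult.commute)

lemma bessel_I_tilde_conv_phi: "z \<noteq> 0 \<Longrightarrow> bessel_I_tilde \<alpha> z = bessel_phi \<alpha> ((z/2)\<^sup>2)"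
  unfolding bessel_I_tilde_def bessel_I_conv_phi by (simp add: powr_minus)

lemma bessel_K_tilde_noninteger:
  assumes "z \<noteq> 0" "sin (\<alpha> * of_real pi) \<noteq> 0"
  shows "bessel_K_tilde \<alpha> z = of_real pi / (2 * sin (\<alpha> * of_real pi)) *
     ((z/2) powr (-(2 * \<alpha>)) * bessel_phi (-\<alpha>) ((z/2)\<^sup>2) - bessel_phi \<alpha> ((z/2)\<^sup>2))"
proof -
  define u where "u = (z/2) powr (-\<alpha>)"
  have "(z/2) powr (-(2 * \<alpha>)) = u * u"
    unfolding u_def powr_add[symmetric] by simp
  moreover have "(z/2) powr \<alpha> = inverse u" "u \<noteq> 0"
    using assms unfolding u_def by (auto simp: powr_minus)
  ultimately show ?thesis
    using assms unfolding bessel_K_tilde_def bessel_K_def bessel_K_aux_def bessel_I_conv_phi u_def[symmetric]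
    by (simp add: field_simps)
qed

lemma bessel_phi_minus_of_int:
  assumes "z \<noteq> 0"
  shows "(z/2) powr (-(2 * of_int n)) * bessel_phi (- of_int n) ((z/2)\<^sup>2) = bessel_phi (of_int n) ((z/2)\<^sup>2)"
proof (cases "n \<ge> 0")
  case True
  then obtain k where k: "n = int k" using nonneg_int_cases by blast
  have "(z/2) powr (-(2 * of_int n)) = inverse (((z/2)\<^sup>2) ^ k)"
    using assms powr_nat[of "z/2" "2 * k"] unfolding k powr_minus
    by (simp add: power_mult[symmetric] mult.commute powr_of_int)
  then show ?thesis using assms bessel_phi_minus_of_nat[of k "(z/2)\<^sup>2"] unfolding k by simp
next
  case False
  then obtain k where k: "n = - int k" using nonpos_int_cases[of n] by fastforce
  have "(z/2) powr (-(2 * of_int n)) = ((z/2)\<^sup>2) ^ k"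
    using assms powr_nat[of "z/2" "2 * k"] unfolding k
    by (simp add: power_mult[symmetric] mult.commute)
  then show ?thesis using bessel_phi_minus_of_nat[of k "(z/2)\<^sup>2"] unfolding k by simp
qed

text \<open>L'Hopital in the order variable; \<open>bessel_psi\<close> is the derivative of \<open>bessel_phi\<close> in its order.\<close>
lemma bessel_K_tilde_integer:
  fixes n :: int
  assumes z: "z \<noteq> 0"
  shows "bessel_K_tilde (of_int n) z = - 1 / (2 * cos (of_int n * of_real pi)) *
     (2 * (Ln (z/2) * bessel_phi (of_int n) ((z/2)\<^sup>2)) + bessel_psi (of_int n) ((z/2)\<^sup>2)
       + (z/2) powr (-(2 * of_int n)) * bessel_psi (- of_int n) ((z/2)\<^sup>2))"
proof -
  define w where "w = (z/2)\<^sup>2"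
  define L where "L = Ln (z/2)"
  define a where "a = (of_int n :: complex)"
  define u where "u = (z/2) powr (-a)"
  have u: "u \<noteq> 0" "(z/2) powr a = inverse u"
    using z unfolding u_def by (auto simp: powr_minus)
  have uu: "(z/2) powr (-(2 * a)) = u * u"
    unfolding u_def powr_add[symmetric] by simp
  \<comment> \<open>The symmetry of I at integral order. It makes the numerator vanish at
    \<open>a\<close>, as L'Hopital requires, and at the end merges the two logarithmic terms into
    one.\<close>
  have sym: "u * u * bessel_phi (-a) w = bessel_phi a w"
    using bessel_phi_minus_of_int[OF z, of n] uu unfolding a_def w_def by simp
  define h where "h = (\<lambda>\<beta>. (z/2) powr (-\<beta>) * bessel_phi (-\<beta>) w - (z/2) powr \<beta> * bessel_phi \<beta> w)"
  define h' where "h' = - (u * (L * bessel_phi (-a) w + bessel_psi (-a) w)) - inverse u * (L * bessel_phi a w + bessel_psi a w)"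
  have D1: "((\<lambda>\<beta>. (z/2) powr \<beta>) has_field_derivative L * (z/2) powr \<beta>) (at \<beta>)" for \<beta>
    using z unfolding L_def powr_def by (auto intro!: derivative_eq_intros)
  have D2: "((\<lambda>\<beta>. (z/2) powr (-\<beta>)) has_field_derivative - (L * (z/2) powr (-\<beta>))) (at \<beta>)" for \<beta>
    using z unfolding L_def powr_def by (auto intro!: derivative_eq_intros)
  have D3: "((\<lambda>\<beta>. bessel_phi (-\<beta>) w) has_field_derivative - bessel_psi (-\<beta>) w) (at \<beta>)" for \<beta>
    using DERIV_chain2[OF has_field_derivative_bessel_phi_order DERIV_minus[OF DERIV_ident]] by simp
  have "(h has_field_derivative h') (at a)"
    unfolding h_def h'_def
    by (rule derivative_eq_intros D1 D2 D3 has_field_derivative_bessel_phi_order refl)+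
       (simp add: u(2) u_def[symmetric] algebra_simps)
  moreover have "((\<lambda>\<beta>. sin (\<beta> * of_real pi)) has_field_derivative cos (a * of_real pi) * of_real pi) (at a)"
    by (auto intro!: derivative_eq_intros)
  moreover have "h a = 0" unfolding h_def u(2) u_def[symmetric]
    using u(1) sym by (simp add: field_simps)
  moreover have s0: "sin (a * of_real pi) = 0"
    unfolding a_def using sin_integer_2pi sin_times_pi_eq_0[of "of_int n"]
    by (metis Ints_of_int of_real_of_int_eq of_real_mult sin_of_real of_real_eq_0_iff sin_times_pi_eq_0 mult.commute)
  moreover have c0: "cos (a * of_real pi) \<noteq> 0"
    using s0 sin_cos_squared_add[of "a * of_real pi"] by auto
  ultimately have "((\<lambda>\<beta>. h \<beta> / sin (\<beta> * of_real pi)) \<longlongrightarrow> h' / (cos (a * of_real pi) * of_real pi)) (at a)"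
    by (intro lhopital_complex_simple[where g = "\<lambda>\<beta>. sin (\<beta> * of_real pi)"]) auto
  from tendsto_mult_left[OF this, of "of_real pi / 2"]
  have "((\<lambda>\<beta>. of_real pi / 2 * (h \<beta> / sin (\<beta> * of_real pi))) \<longlongrightarrow>
        of_real pi / 2 * (h' / (cos (a * of_real pi) * of_real pi))) (at a)" .
  then have "((\<lambda>\<beta>. bessel_K_aux \<beta> z) \<longlongrightarrow> of_real pi / 2 * (h' / (cos (a * of_real pi) * of_real pi))) (at a)"
    unfolding bessel_K_aux_def bessel_I_conv_phi h_def w_def by simp
  then have "bessel_K a z = h' / (2 * cos (a * of_real pi))"
    unfolding bessel_K_def using s0 by (subst tendsto_Lim) auto
  then have "bessel_K_tilde a z = u * h' / (2 * cos (a * of_real pi))"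
    by (simp add: bessel_K_tilde_def u_def)
  also have "u * h' = - (L * (u * u * bessel_phi (-a) w) + u * u * bessel_psi (-a) w + L * bessel_phi a w + bessel_psi a w)"
    using u(1) by (simp add: h'_def field_simps)
  finally show ?thesis
    unfolding sym a_def[symmetric] w_def[symmetric] L_def[symmetric] uu using c0 by (simp add: field_simps)
qed

lemma sin_times_pi_eq_0_complex:
  fixes \<alpha> :: complex
  assumes "sin (\<alpha> * of_real pi) = 0"
  obtains n :: int where "\<alpha> = of_int n"
proof -
  obtain n :: int where "\<alpha> * of_real pi = of_real (of_int n * pi)"
    using assms sin_eq_0 by metis
  then show ?thesis using that[of n] by simp
qed

lemma has_field_derivative_half_powr:
  assumes "Re z > 0"
  shows "((\<lambda>z. (z/2) powr (-\<nu>)) has_field_derivative - \<nu> * (z/2) powr (-\<nu>) / z) (at z)"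
proof -
  have "z / 2 \<notin> \<real>\<^sub>\<le>\<^sub>0" "z \<noteq> 0" using assms by (auto simp: complex_nonpos_Reals_iff)
  then show ?thesis
    by (auto intro!: derivative_eq_intros simp: powr_diff field_simps)
qed

lemma bessel_system_I_tilde:
  assumes "0 \<notin> S" "open S"
  obtains F1 where "bessel_system \<nu> S (\<lambda>_. 0) (bessel_I_tilde (\<nu>/2)) F1"
proof -
  have "bessel_system (2 * (\<nu>/2)) S (\<lambda>_. 0) (bessel_I_tilde (\<nu>/2)) (\<lambda>z. z\<^sup>2 / 2 * bessel_phi (\<nu>/2 + 1) ((z/2)\<^sup>2))"
    by (rule bessel_system_cong[OF bessel_system_phi[OF assms(1)] assms(2)])
       (use assms(1) in \<open>auto intro!: bessel_I_tilde_conv_phi\<close>)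
  then show ?thesis using that by simp
qed

lemma half_odd_not_int: "of_nat (2*m+1) / 2 \<noteq> (of_int n :: complex)"
proof
  assume "of_nat (2*m+1) / 2 = (of_int n :: complex)"
  then have "(of_int (int (2*m+1)) :: complex) = of_int (2 * n)" by (simp add: field_simps)
  then have "int (2*m+1) = 2 * n" using of_int_eq_iff by blast
  then show False by presburger
qed

lemma holomorphic_bessel_phi [holomorphic_intros]:
  assumes "f holomorphic_on A"
  shows "(\<lambda>z. bessel_phi \<alpha> (f z)) holomorphic_on A"
proof -
  have "bessel_phi \<alpha> holomorphic_on UNIV"
    unfolding holomorphic_on_def field_differentiable_def
    using has_field_derivative_bessel_phi has_field_derivative_at_within by blast
  from holomorphic_on_compose_gen[OF assms this] show ?thesis by (simp add: o_def)
qed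

text \<open>At half-odd order the noninteger formula applies and its power
  \<open>(z/2) powr (-\<mu>)\<close> is the inverse of a polynomial. So there is no cut, and what
  remains at 0 is a pole of order \<open>2*m+1\<close> whose leading coefficient is
  \<open>H 0\<close>.\<close>

lemma bessel_K_tilde_half_odd:
  fixes m :: nat
  defines "\<mu> \<equiv> of_nat (2*m+1) :: complex"
  obtains F1 H where "bessel_system \<mu> (- {0}) (\<lambda>_. 0) (bessel_K_tilde (\<mu>/2)) F1"
    and "H holomorphic_on UNIV" "\<And>z. z \<noteq> 0 \<Longrightarrow> z ^ (2*m+1) * bessel_K_tilde (\<mu>/2) z = H z" "H 0 \<noteq> 0"
proof -
  define S where "S = (- {0} :: complex set)"
  have S: "0 \<notin> S" "open S" by (auto simp: S_def)
  define \<alpha> where "\<alpha> = \<mu>/2"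
  have \<mu>: "\<mu> = 2 * \<alpha>" by (simp add: \<alpha>_def)
  have \<alpha>: "\<alpha> \<noteq> of_int n" for n unfolding \<alpha>_def \<mu>_def by (rule half_odd_not_int)
  then have sin: "sin (\<alpha> * of_real pi) \<noteq> 0" using sin_times_pi_eq_0_complex by blast
  define P where "P = (\<lambda>z::complex. inverse ((z/2) ^ (2*m+1)))"
  have P: "(P has_field_derivative - \<mu> * P z / z) (at z)" if "z \<in> S" for z
  proof -
    have "z \<noteq> 0" using that S by auto
    have D: "((\<lambda>z::complex. (z/2) ^ Suc (2*m)) has_field_derivative (1 + of_nat (2*m)) * (1/2 * (z/2) ^ (2*m))) (at z)"
      by (rule DERIV_power_Suc) (auto intro!: derivative_eq_intros)
    show ?thesis unfolding P_def \<mu>_def Suc_eq_plus1[symmetric]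
      by (rule DERIV_cong[OF DERIV_inverse'[OF D]]) (use \<open>z \<noteq> 0\<close> in \<open>simp_all add: field_simps\<close>)
  qed
  have P_eq: "(z/2) powr (-(2 * \<alpha>)) = P z" if "z \<noteq> 0" for z
    unfolding \<mu>[symmetric] \<mu>_def powr_minus P_def using that by (simp add: powr_nat del: of_nat_add of_nat_mult of_nat_Suc)
  note phi = bessel_system_phi[OF S(1), of \<alpha>, folded \<mu>]
  have phi': "bessel_system (-\<mu>) S (\<lambda>z. 0) (\<lambda>z. bessel_phi (-\<alpha>) ((z/2)\<^sup>2)) (\<lambda>z. z\<^sup>2 / 2 * bessel_phi (-\<alpha> + 1) ((z/2)\<^sup>2))"
    using bessel_system_phi[OF S(1), of "-\<alpha>"] by (simp add: \<mu>)
  define c where "c = of_real pi / (2 * sin (\<alpha> * of_real pi))"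
  have K: "bessel_K_tilde \<alpha> z = c * (P z * bessel_phi (-\<alpha>) ((z/2)\<^sup>2)) + - c * bessel_phi \<alpha> ((z/2)\<^sup>2)" if "z \<noteq> 0" for z
    using bessel_K_tilde_noninteger[OF that sin] unfolding c_def[symmetric] P_eq[OF that]
    by (simp add: algebra_simps)
  define H where "H = (\<lambda>z. c * (2 ^ (2*m+1) * bessel_phi (-\<alpha>) ((z/2)\<^sup>2)) + - c * (z ^ (2*m+1) * bessel_phi \<alpha> ((z/2)\<^sup>2)))"
  show ?thesis
  proof (rule that[of _ H, folded \<alpha>_def S_def])
    show "bessel_system \<mu> S (\<lambda>_. 0) (bessel_K_tilde \<alpha>) (\<lambda>z. c * (P z * (z\<^sup>2 / 2 * bessel_phi (-\<alpha> + 1) ((z/2)\<^sup>2) - \<mu> * bessel_phi (-\<alpha>) ((z/2)\<^sup>2))) + - c * (z\<^sup>2 / 2 * bessel_phi (\<alpha> + 1) ((z/2)\<^sup>2)))"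
      by (rule bessel_system_cong[OF bessel_system_lincomb[OF bessel_system_twist[OF phi' P] phi, of c "-c"] S(2)])
         (use K in \<open>auto simp: S_def\<close>)
    show "H holomorphic_on UNIV" unfolding H_def by (intro holomorphic_intros) auto
    show "z ^ (2*m+1) * bessel_K_tilde \<alpha> z = H z" if "z \<noteq> 0" for z
    proof -
      have "z ^ (2*m+1) * P z = 2 ^ (2*m+1)"
        unfolding P_def power_divide using that by simp
      then show ?thesis unfolding K[OF that] H_def by (simp add: algebra_simps)
    qed
    \<comment> \<open>Only the first summand of H survives at 0, because the second carries a
      positive power of z; its value is a nonzero multiple of
      \<open>rGamma (1 - \<alpha>)\<close>.\<close>
    have "- \<alpha> + 1 \<notin> \<int>\<^sub>\<le>\<^sub>0"
    proof
      assume "- \<alpha> + 1 \<in> \<int>\<^sub>\<le>\<^sub>0"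
      then obtain n where "- \<alpha> + 1 = of_int n" by (auto elim: nonpos_Ints_cases)
      then have "\<alpha> = of_int (1 - n)" by (simp add: algebra_simps)
      then show False using \<alpha> by blast
    qed
    then have "rGamma (- \<alpha> + 1) \<noteq> 0" by (simp add: rGamma_eq_zero_iff)
    then show "H 0 \<noteq> 0" unfolding H_def using sin by (simp add: c_def)
  qed
qed

text \<open>At nonintegral order K is a combination of a solution and a twisted one. At integral
  order no summand of the explicit formula solves the equation by itself, and the remainders have to
  cancel.\<close>

lemma bessel_system_K_tilde:
  obtains F1 where "bessel_system \<nu> {z. Re z > 0} (\<lambda>_. 0) (bessel_K_tilde (\<nu>/2)) F1"
proof -
  define S where "S = {z. Re z > 0}"
  have S: "0 \<notin> S" "open S" by (auto simp: S_def open_halfspace_Re_gt)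
  define P where "P = (\<lambda>z. (z/2) powr (-\<nu>))"
  have P: "(P has_field_derivative - \<nu> * P z / z) (at z)" if "z \<in> S" for z
    unfolding P_def using that by (intro has_field_derivative_half_powr) (auto simp: S_def)
  define \<alpha> where "\<alpha> = \<nu>/2"
  have \<nu>: "\<nu> = 2 * \<alpha>" by (simp add: \<alpha>_def)
  note phi = bessel_system_phi[OF S(1), of \<alpha>, folded \<nu>]
  have phi': "bessel_system (-\<nu>) S (\<lambda>z. 0) (\<lambda>z. bessel_phi (-\<alpha>) ((z/2)\<^sup>2)) (\<lambda>z. z\<^sup>2 / 2 * bessel_phi (-\<alpha> + 1) ((z/2)\<^sup>2))"
    using bessel_system_phi[OF S(1), of "-\<alpha>"] by (simp add: \<nu>)
  show ?thesis
  proof (cases "sin (\<alpha> * of_real pi) = 0")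
    case False
    define c where "c = of_real pi / (2 * sin (\<alpha> * of_real pi))"
    note sys = bessel_system_lincomb[OF bessel_system_twist[OF phi' P] phi, of c "-c"]
    show ?thesis
    proof (rule that[unfolded S_def[symmetric] \<alpha>_def[symmetric]], rule bessel_system_cong[OF sys S(2)])
      fix z assume "z \<in> S"
      then have "z \<noteq> 0" using S by auto
      from bessel_K_tilde_noninteger[OF this False]
      show "bessel_K_tilde \<alpha> z = c * (P z * bessel_phi (-\<alpha>) ((z/2)\<^sup>2)) + - c * bessel_phi \<alpha> ((z/2)\<^sup>2)"
        unfolding c_def[symmetric] P_def \<nu> by (simp add: algebra_simps)
      show "0 = c * (P z * 0) + - c * 0" by simp
    qed
  next
    case True
    then obtain n where n: "\<alpha> = of_int n" using sin_times_pi_eq_0_complex by blast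
    have psi': "bessel_system (-\<nu>) S (\<lambda>z. - z\<^sup>2 * bessel_phi (-\<alpha> + 1) ((z/2)\<^sup>2)) (\<lambda>z. bessel_psi (-\<alpha>) ((z/2)\<^sup>2))
           (\<lambda>z. z\<^sup>2 / 2 * bessel_psi (-\<alpha> + 1) ((z/2)\<^sup>2))"
      using bessel_system_psi[OF S(1), of "-\<alpha>"] by (simp add: \<nu>)
    have Re: "\<And>z. z \<in> S \<Longrightarrow> Re z > 0" by (simp add: S_def)
    \<comment> \<open>The formula for integral order is split evenly: Y is
      \<open>Ln * bessel_phi + bessel_psi\<close> at order \<alpha>, Z the twist of the same
      expression at \<open>-\<alpha>\<close>. Their remainders reduce to \<nu> times
      \<open>bessel_phi \<alpha>\<close> and \<open>-\<nu>\<close> times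
      \<open>P * bessel_phi (-\<alpha>)\<close>, which cancel by \<open>sym\<close> below.\<close>
    note Y = bessel_system_lincomb[OF bessel_system_Ln[OF phi Re] bessel_system_psi[OF S(1), of \<alpha>, folded \<nu>], of 1 1]
    note Z = bessel_system_twist[OF bessel_system_lincomb[OF bessel_system_Ln[OF phi' Re] psi', of 1 1] P]
    define c where "c = - 1 / (2 * cos (of_int n * of_real pi) :: complex)"
    note sys = bessel_system_lincomb[OF Y Z, of c c]
    have sym: "P z * bessel_phi (-\<alpha>) ((z/2)\<^sup>2) = bessel_phi \<alpha> ((z/2)\<^sup>2)" if "z \<in> S" for z
      using bessel_phi_minus_of_int[of z n] that S unfolding P_def \<nu> n by auto
    show ?thesis
      unfolding S_def[symmetric] \<alpha>_def[symmetric]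
    proof (rule that[unfolded S_def[symmetric] \<alpha>_def[symmetric]], rule bessel_system_cong[OF sys S(2)])
      fix z assume z: "z \<in> S"
      then have z0: "z \<noteq> 0" using S by auto
      show "bessel_K_tilde \<alpha> z = c * (1 * (Ln (z/2) * bessel_phi \<alpha> ((z/2)\<^sup>2)) + 1 * bessel_psi \<alpha> ((z/2)\<^sup>2)) +
           c * (P z * (1 * (Ln (z/2) * bessel_phi (-\<alpha>) ((z/2)\<^sup>2)) + 1 * bessel_psi (-\<alpha>) ((z/2)\<^sup>2)))"
        using bessel_K_tilde_integer[OF z0, of n] sym[OF z, symmetric]
        unfolding n[symmetric] c_def[symmetric, folded n] \<nu>[symmetric] P_def[symmetric]
        by (simp add: algebra_simps P_def)
      show "0 = c * (1 * (2 * (z\<^sup>2 / 2 * bessel_phi (\<alpha> + 1) ((z/2)\<^sup>2)) + \<nu> * bessel_phi \<alpha> ((z/2)\<^sup>2)) +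
              1 * (- z\<^sup>2 * bessel_phi (\<alpha> + 1) ((z/2)\<^sup>2))) +
           c * (P z * (1 * (2 * (z\<^sup>2 / 2 * bessel_phi (-\<alpha> + 1) ((z/2)\<^sup>2)) + (-\<nu>) * bessel_phi (-\<alpha>) ((z/2)\<^sup>2)) +
              1 * (- z\<^sup>2 * bessel_phi (-\<alpha> + 1) ((z/2)\<^sup>2))))"
        using sym[OF z, symmetric] by (simp add: algebra_simps)
    qed
  qed
qed


section \<open>Limits of the Bessel functions at the origin\<close>

lemma tendsto_half_powr_0:
  assumes "\<nu> > 0"
  shows "((\<lambda>z. (z/2) powr of_real \<nu>) \<longlongrightarrow> 0) (at (0::complex) within S)"
proof (rule tendsto_norm_zero_cancel)
  have "((\<lambda>z::complex. norm (z/2) powr \<nu>) \<longlongrightarrow> 0) (at 0 within S)"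
    using assms by (auto intro!: tendsto_eq_intros tendsto_zero_powrI[where b = \<nu>])
  then show "((\<lambda>z::complex. norm ((z/2) powr of_real \<nu>)) \<longlongrightarrow> 0) (at 0 within S)"
    by (simp add: norm_powr_real_powr')
qed

text \<open>The imaginary part of the principal logarithm is bounded by pi, so the claim reduces to
  a real limit in the modulus.\<close>

lemma tendsto_half_powr_Ln_0:
  assumes "\<nu> > 0"
  shows "((\<lambda>z. (z/2) powr of_real \<nu> * Ln (z/2)) \<longlongrightarrow> 0) (at (0::complex) within S)"
proof (rule Lim_null_comparison)
  show "\<forall>\<^sub>F z in at 0 within S. norm ((z/2) powr of_real \<nu> * Ln (z/2)) \<le>
      norm (z/2) powr \<nu> * (\<bar>ln (norm (z/2))\<bar> + pi)"
    unfolding eventually_at_filter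
  proof (intro always_eventually allI impI)
    fix z :: complex assume "z \<noteq> 0"
    then have "norm (Ln (z/2)) \<le> \<bar>ln (norm (z/2))\<bar> + pi"
      using cmod_le[of "Ln (z/2)"] mpi_less_Im_Ln[of "z/2"] Im_Ln_le_pi[of "z/2"] by simp
    then show "norm ((z/2) powr of_real \<nu> * Ln (z/2)) \<le> norm (z/2) powr \<nu> * (\<bar>ln (norm (z/2))\<bar> + pi)"
      unfolding norm_mult by (intro mult_mono) (auto simp: norm_powr_real_powr')
  qed
  have "((\<lambda>x::real. x powr \<nu> * (\<bar>ln x\<bar> + pi)) \<longlongrightarrow> 0) (at_right 0)"
    using assms by real_asymp
  moreover have "filterlim (\<lambda>z::complex. norm (z/2)) (at_right 0) (at 0 within S)"
    unfolding filterlim_at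
    by (auto simp: eventually_at_filter intro!: tendsto_eq_intros always_eventually)
  ultimately show "((\<lambda>z::complex. norm (z/2) powr \<nu> * (\<bar>ln (norm (z/2))\<bar> + pi)) \<longlongrightarrow> 0) (at 0 within S)"
    by (rule filterlim_compose)
qed

lemma tendsto_shift_series_half:
  assumes "\<And>w. (shift_series d \<alpha> has_field_derivative D w) (at w)"
  shows "((\<lambda>z. shift_series d \<alpha> ((z/2)\<^sup>2)) \<longlongrightarrow> d (\<alpha> + 1)) (at 0 within S)"
proof -
  have "isCont (shift_series d \<alpha>) 0" using assms DERIV_isCont by blast
  moreover have "((\<lambda>z::complex. (z/2)\<^sup>2) \<longlongrightarrow> 0) (at 0 within S)"
    by (auto intro!: tendsto_eq_intros)
  ultimately have "((\<lambda>z. shift_series d \<alpha> ((z/2)\<^sup>2)) \<longlongrightarrow> shift_series d \<alpha> 0) (at 0 within S)"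
    by (rule isCont_tendsto_compose)
  then show ?thesis by simp
qed

lemmas tendsto_bessel_phi_half = tendsto_shift_series_half[OF has_field_derivative_bessel_phi]
lemmas tendsto_bessel_psi_half = tendsto_shift_series_half[OF has_field_derivative_bessel_psi]

text \<open>The zeros of 1/Gamma are simple. At positive integral order
  \<open>rGamma (1 - \<alpha>)\<close>, the leading factor of K at other orders, is zero, and this
  derivative takes its place.\<close>

lemma rGamma_deriv_nonpos_int: "deriv rGamma (- of_nat n :: complex) \<noteq> 0"
proof -
  have "(rGamma has_field_derivative (-1)^n * fact n) (at (- of_nat n :: complex))"
    by (rule has_field_derivative_rGamma_nonpos_int)
  from DERIV_imp_deriv[OF this] show ?thesis by simp
qed

lemma bessel_I_tilde_at_0:
  assumes "\<nu> > 0"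
  obtains C where "(bessel_I_tilde (of_real \<nu> / 2) \<longlongrightarrow> C) (at 0 within {z. Re z > 0})" "C \<noteq> 0"
proof
  have "\<forall>\<^sub>F z in at 0 within {z. Re z > 0}. bessel_phi (of_real \<nu> / 2) ((z/2)\<^sup>2) = bessel_I_tilde (of_real \<nu> / 2) z"
    unfolding eventually_at_filter by (auto intro!: always_eventually simp: bessel_I_tilde_conv_phi)
  with tendsto_bessel_phi_half
  show "(bessel_I_tilde (of_real \<nu> / 2) \<longlongrightarrow> rGamma (of_real \<nu> / 2 + 1)) (at 0 within {z. Re z > 0})"
    by (rule Lim_transform_eventually)
  have "Re (of_real \<nu> / 2 + 1) > 0" using assms by simp
  then have "(of_real \<nu> / 2 + 1 :: complex) \<notin> \<int>\<^sub>\<le>\<^sub>0"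
    by (metis nonpos_Ints_cases Re_complex_of_real of_real_of_int_eq of_int_0_less_iff not_less)
  then show "rGamma (of_real \<nu> / 2 + 1 :: complex) \<noteq> 0" by (simp add: rGamma_eq_zero_iff)
qed

text \<open>For \<open>\<nu> > 0\<close> the part carrying \<open>(z/2) powr (-\<nu>)\<close>
  dominates; the factor \<open>(z/2) powr \<nu>\<close> cancels it and drives everything else,
  including a logarithm, to 0. The constant is a nonzero multiple of
  \<open>rGamma (1 - \<nu>/2)\<close> or, at integral order, of
  \<open>deriv rGamma (1 - \<nu>/2)\<close>.\<close>

lemma bessel_K_tilde_at_0:
  assumes \<nu>: "\<nu> > 0"
  obtains C where "((\<lambda>z. (z/2) powr of_real \<nu> * bessel_K_tilde (of_real \<nu> / 2) z) \<longlongrightarrow> C) (at 0 within {z. Re z > 0})" "C \<noteq> 0"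
proof -
  define S where "S = {z. Re z > 0}"
  define \<alpha> where "\<alpha> = (of_real \<nu> / 2 :: complex)"
  have \<nu>\<alpha>: "of_real \<nu> = 2 * \<alpha>" by (simp add: \<alpha>_def)
  have ev: "\<forall>\<^sub>F z in at 0 within S. z \<noteq> 0"
    unfolding eventually_at_filter by simp
  have cancel: "(z/2) powr of_real \<nu> * (z/2) powr (-(2*\<alpha>)) = 1" if "z \<noteq> 0" for z
    unfolding \<nu>\<alpha> using that by (simp add: powr_minus)
  note lims = tendsto_half_powr_0[OF \<nu>] tendsto_half_powr_Ln_0[OF \<nu>]
    tendsto_bessel_phi_half tendsto_bessel_psi_half
  show ?thesis
  proof (cases "sin (\<alpha> * of_real pi) = 0")
    case False
    define c where "c = of_real pi / (2 * sin (\<alpha> * of_real pi))"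
    have "((\<lambda>z. c * (bessel_phi (-\<alpha>) ((z/2)\<^sup>2) - (z/2) powr of_real \<nu> * bessel_phi \<alpha> ((z/2)\<^sup>2))) \<longlongrightarrow>
             c * (rGamma (-\<alpha> + 1) - 0 * rGamma (\<alpha> + 1))) (at 0 within S)"
      by (intro tendsto_intros lims)
    moreover have "\<forall>\<^sub>F z in at 0 within S. c * (bessel_phi (-\<alpha>) ((z/2)\<^sup>2) - (z/2) powr of_real \<nu> * bessel_phi \<alpha> ((z/2)\<^sup>2))
        = (z/2) powr of_real \<nu> * bessel_K_tilde \<alpha> z"
      using ev
    proof eventually_elim
      case (elim z)
      have "(z/2) powr of_real \<nu> * bessel_K_tilde \<alpha> z =
          c * (((z/2) powr of_real \<nu> * (z/2) powr (-(2*\<alpha>))) * bessel_phi (-\<alpha>) ((z/2)\<^sup>2) - (z/2) powr of_real \<nu> * bessel_phi \<alpha> ((z/2)\<^sup>2))"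
        unfolding bessel_K_tilde_noninteger[OF elim False] c_def[symmetric] by (simp only: algebra_simps)
      then show ?case unfolding cancel[OF elim] by simp
    qed
    ultimately have L: "((\<lambda>z. (z/2) powr of_real \<nu> * bessel_K_tilde \<alpha> z) \<longlongrightarrow>
             c * (rGamma (-\<alpha> + 1) - 0 * rGamma (\<alpha> + 1))) (at 0 within S)"
      by (rule Lim_transform_eventually)
    have "- \<alpha> + 1 \<notin> \<int>\<^sub>\<le>\<^sub>0"
    proof
      assume "- \<alpha> + 1 \<in> \<int>\<^sub>\<le>\<^sub>0"
      then obtain n where "- \<alpha> + 1 = of_int n" by (auto elim: nonpos_Ints_cases)
      then have "\<alpha> = of_int (1 - n)" by (simp add: algebra_simps)
      then have "\<alpha> * of_real pi = of_real (of_int (1 - n) * pi)" by simp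
      then show False using False sin_eq_0 by metis
    qed
    then have "rGamma (- \<alpha> + 1) \<noteq> 0" by (simp add: rGamma_eq_zero_iff)
    then show ?thesis using that L False unfolding S_def \<alpha>_def[symmetric] by (simp add: c_def)
  next
    case True
    then obtain n where n: "\<alpha> = of_int n" using sin_times_pi_eq_0_complex by blast
    have "of_real (\<nu> / 2) = (of_real (of_int n) :: complex)" using n by (simp add: \<alpha>_def)
    then have "\<nu> / 2 = of_int n" using of_real_eq_iff by blast
    then have "n > 0" using \<nu> by auto
    then obtain k where k: "n = int (Suc k)" by (metis zero_less_imp_eq_int gr0_implies_Suc)
    define c where "c = - 1 / (2 * cos (of_int n * of_real pi) :: complex)"
    have "((\<lambda>z. c * (2 * (((z/2) powr of_real \<nu> * Ln (z/2)) * bessel_phi \<alpha> ((z/2)\<^sup>2)) + (z/2) powr of_real \<nu> * bessel_psi \<alpha> ((z/2)\<^sup>2)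
        + bessel_psi (-\<alpha>) ((z/2)\<^sup>2))) \<longlongrightarrow>
        c * (2 * (0 * rGamma (\<alpha> + 1)) + 0 * deriv rGamma (\<alpha> + 1) + deriv rGamma (-\<alpha> + 1))) (at 0 within S)"
      by (intro tendsto_intros lims)
    moreover have "\<forall>\<^sub>F z in at 0 within S. c * (2 * (((z/2) powr of_real \<nu> * Ln (z/2)) * bessel_phi \<alpha> ((z/2)\<^sup>2)) + (z/2) powr of_real \<nu> * bessel_psi \<alpha> ((z/2)\<^sup>2)
        + bessel_psi (-\<alpha>) ((z/2)\<^sup>2)) = (z/2) powr of_real \<nu> * bessel_K_tilde \<alpha> z"
      using ev
    proof eventually_elim
      case (elim z)
      have "(z/2) powr of_real \<nu> * bessel_K_tilde \<alpha> z =
        c * (2 * (((z/2) powr of_real \<nu> * Ln (z/2)) * bessel_phi \<alpha> ((z/2)\<^sup>2)) + (z/2) powr of_real \<nu> * bessel_psi \<alpha> ((z/2)\<^sup>2)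
        + ((z/2) powr of_real \<nu> * (z/2) powr (-(2*\<alpha>))) * bessel_psi (-\<alpha>) ((z/2)\<^sup>2))"
        unfolding n bessel_K_tilde_integer[OF elim] c_def[symmetric] by (simp only: algebra_simps)
      then show ?case unfolding cancel[OF elim] by simp
    qed
    ultimately have L: "((\<lambda>z. (z/2) powr of_real \<nu> * bessel_K_tilde \<alpha> z) \<longlongrightarrow>
        c * (2 * (0 * rGamma (\<alpha> + 1)) + 0 * deriv rGamma (\<alpha> + 1) + deriv rGamma (-\<alpha> + 1))) (at 0 within S)"
      by (rule Lim_transform_eventually)
    have "- \<alpha> + 1 = - of_nat k" by (simp add: n k)
    then have "deriv rGamma (- \<alpha> + 1) \<noteq> 0" using rGamma_deriv_nonpos_int by simp
    moreover have "cos (of_int n * of_real pi :: complex) \<noteq> 0"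
      using True sin_cos_squared_add[of "\<alpha> * of_real pi"] unfolding n by auto
    ultimately show ?thesis using that L unfolding S_def \<alpha>_def[symmetric] by (simp add: c_def)
  qed
qed

section \<open>The fourth-order equation\<close>

text \<open>A relational form of \<theta> that also records differentiability on the positive axis;
  the function \<open>theta\<close> is total and has a value even where no derivative
  exists.\<close>

definition has_theta :: "(real \<Rightarrow> complex) \<Rightarrow> (real \<Rightarrow> complex) \<Rightarrow> bool" where
  "has_theta f g \<longleftrightarrow> (\<forall>x>0. (f has_vector_derivative g x / of_real x) (at x))"

lemma has_thetaD: "has_theta f g \<Longrightarrow> x > 0 \<Longrightarrow> (f has_vector_derivative g x / of_real x) (at x)"
  by (simp add: has_theta_def)

lemma theta_eq: "has_theta f g \<Longrightarrow> x > 0 \<Longrightarrow> theta f x = g x"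
  by (simp add: theta_def vector_derivative_at[OF has_thetaD])

lemma has_theta_cong:
  assumes "has_theta f g" "\<And>x. x > 0 \<Longrightarrow> f' x = f x" "\<And>x. x > 0 \<Longrightarrow> g' x = g x"
  shows "has_theta f' g'"
  unfolding has_theta_def
proof (intro allI impI)
  fix x :: real assume x: "x > 0"
  have "(f' has_vector_derivative g x / of_real x) (at x)"
    by (rule has_vector_derivative_transform_within_open[OF has_thetaD[OF assms(1) x], of "{0<..}"])
       (use x assms(2) in auto)
  then show "(f' has_vector_derivative g' x / of_real x) (at x)" using assms(3) x by simp
qed

lemma has_theta_add: "has_theta f f1 \<Longrightarrow> has_theta g g1 \<Longrightarrow> has_theta (\<lambda>x. f x + g x) (\<lambda>x. f1 x + g1 x)"
  unfolding has_theta_def by (auto intro!: derivative_eq_intros simp: add_divide_distrib)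

lemma has_theta_diff: "has_theta f f1 \<Longrightarrow> has_theta g g1 \<Longrightarrow> has_theta (\<lambda>x. f x - g x) (\<lambda>x. f1 x - g1 x)"
  unfolding has_theta_def by (auto intro!: derivative_eq_intros simp: diff_divide_distrib)

lemma has_theta_cmult: "has_theta f f1 \<Longrightarrow> has_theta (\<lambda>x. c * f x) (\<lambda>x. c * f1 x)"
  unfolding has_theta_def by (auto intro!: derivative_eq_intros)

lemma has_theta_sum:
  "(\<And>i. i \<in> I \<Longrightarrow> has_theta (f i) (g i)) \<Longrightarrow> has_theta (\<lambda>x. \<Sum>i\<in>I. f i x) (\<lambda>x. \<Sum>i\<in>I. g i x)"
  unfolding has_theta_def by (auto intro!: derivative_eq_intros simp: sum_divide_distrib)

lemma has_theta_square_mult: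
  assumes "has_theta f f1"
  shows "has_theta (\<lambda>x. of_real (x\<^sup>2) * f x) (\<lambda>x. of_real (x\<^sup>2) * (2 * f x + f1 x))"
  unfolding has_theta_def
proof (intro allI impI)
  fix x :: real assume x: "x > 0"
  have "((\<lambda>x. of_real (x\<^sup>2) :: complex) has_vector_derivative 2 * of_real x) (at x)"
    by (rule has_vector_derivative_eq_rhs, rule has_vector_derivative_of_real)
       (auto intro!: derivative_eq_intros)
  from has_vector_derivative_mult[OF this has_thetaD[OF assms x]]
  show "((\<lambda>x. of_real (x\<^sup>2) * f x) has_vector_derivative of_real (x\<^sup>2) * (2 * f x + f1 x) / of_real x) (at x)"
    by (rule has_vector_derivative_eq_rhs) (use x in \<open>simp add: field_simps power2_eq_square\<close>)
qed

text \<open>A function together with explicit candidates for its iterates under \<theta>, so that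
  the fourth-order operator becomes a linear expression in \<open>u 0\<close> to
  \<open>u 4\<close>.\<close>

definition theta_tower :: "(nat \<Rightarrow> real \<Rightarrow> complex) \<Rightarrow> bool" where
  "theta_tower u \<longleftrightarrow> (\<forall>k<4. has_theta (u k) (u (Suc k)))"

text \<open>The fourth-order operator \<open>opQ \<mu> \<nu> \<circ> opP \<mu>\<close> expanded in powers of \<open>\<theta>\<close>, using \<open>\<theta> x\<^sup>2 = x\<^sup>2 (\<theta> + 2)\<close>.\<close>
definition opQP :: "complex \<Rightarrow> complex \<Rightarrow> (nat \<Rightarrow> real \<Rightarrow> complex) \<Rightarrow> real \<Rightarrow> complex" where
  "opQP \<mu> \<nu> u x =
     (u 4 x + \<mu> * u 3 x - of_real (x\<^sup>2) * (4 * u 0 x + 4 * u 1 x + u 2 x))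
     + (\<mu> + 2 * \<nu>) * (u 3 x + \<mu> * u 2 x - of_real (x\<^sup>2) * (2 * u 0 x + u 1 x))
     + \<nu> * (\<mu> + \<nu>) * (u 2 x + \<mu> * u 1 x - of_real (x\<^sup>2) * u 0 x)
     - of_real (x\<^sup>2) * (u 2 x + \<mu> * u 1 x - of_real (x\<^sup>2) * u 0 x)"

lemma opQ_opP_tower:
  assumes "theta_tower u" "x > 0"
  shows "opQ \<mu> \<nu> (opP \<mu> (u 0)) x = opQP \<mu> \<nu> u x"
proof -
  have T: "has_theta (u 0) (u 1)" "has_theta (u 1) (u 2)" "has_theta (u 2) (u 3)" "has_theta (u 3) (u 4)"
    using assms(1) by (auto simp: theta_tower_def numeral_eq_Suc)
  have th: "theta (u 0) y = u 1 y" if "y > 0" for y using theta_eq[OF T(1) that] .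
  have "has_theta (theta (u 0)) (u 2)" by (rule has_theta_cong[OF T(2)]) (use th in auto)
  then have th2: "theta (theta (u 0)) y = u 2 y" if "y > 0" for y using theta_eq that by blast
  define w where "w = (\<lambda>x. u 2 x + \<mu> * u 1 x - of_real (x\<^sup>2) * u 0 x)"
  define w1 where "w1 = (\<lambda>x. u 3 x + \<mu> * u 2 x - of_real (x\<^sup>2) * (2 * u 0 x + u 1 x))"
  define w2 where "w2 = (\<lambda>x. u 4 x + \<mu> * u 3 x - of_real (x\<^sup>2) * (2 * (2 * u 0 x + u 1 x) + (2 * u 1 x + u 2 x)))"
  have P: "opP \<mu> (u 0) y = w y" if "y > 0" for y
    using that by (simp add: opP_def w_def th th2)
  have w: "has_theta w w1" unfolding w_def w1_def
    by (intro has_theta_add has_theta_diff has_theta_cmult has_theta_square_mult T)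
  have w1: "has_theta w1 w2" unfolding w1_def w2_def
    by (intro has_theta_add has_theta_diff has_theta_cmult has_theta_square_mult T)
  have "has_theta (opP \<mu> (u 0)) w1" by (rule has_theta_cong[OF w]) (use P in auto)
  then have t1: "theta (opP \<mu> (u 0)) y = w1 y" if "y > 0" for y using theta_eq that by blast
  have "has_theta (theta (opP \<mu> (u 0))) w2" by (rule has_theta_cong[OF w1]) (use t1 in auto)
  then have t2: "theta (theta (opP \<mu> (u 0))) y = w2 y" if "y > 0" for y using theta_eq that by blast
  show ?thesis
    unfolding opQ_def t1[OF assms(2)] t2[OF assms(2)] P[OF assms(2)] opQP_def w_def w1_def w2_def
    by (simp add: algebra_simps)
qed

definition opC :: "complex \<Rightarrow> complex \<Rightarrow> complex" where
  "opC \<mu> \<nu> = (\<mu> - \<nu>) * (\<mu> + \<nu> + 2) / 2"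

lemma opD_tower_iff:
  assumes "theta_tower u" "x > 0"
  shows "opD \<mu> \<nu> (u 0) x = lam * u 0 x \<longleftrightarrow> opQP \<mu> \<nu> u x = of_real (x\<^sup>2) * ((lam + opC \<mu> \<nu>) * u 0 x)"
  unfolding opD_def opQ_opP_tower[OF assms] opC_def[symmetric] using assms(2)
  by (auto simp: field_simps)

lemma solves_on_RplusI:
  assumes u: "theta_tower u" and f: "\<And>x. x > 0 \<Longrightarrow> f x = u 0 x"
    and eq: "\<And>x. x > 0 \<Longrightarrow> opQP \<mu> \<nu> u x = of_real (x\<^sup>2) * ((lam + opC \<mu> \<nu>) * u 0 x)"
  shows "solves_on_Rplus \<mu> \<nu> lam f"
proof -
  \<comment> \<open>f is known to agree with \<open>u 0\<close> on the positive axis only, so the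
    bottom of the tower is replaced by f itself.\<close>
  define v where "v = u(0 := f)"
  have k: "\<forall>x>0. (theta ^^ k) f x = u k x" if "k \<le> 4" for k
    using that
  proof (induction k)
    case 0 then show ?case using f by simp
  next
    case (Suc k)
    have "has_theta (u k) (u (Suc k))" using u Suc.prems by (simp add: theta_tower_def)
    then have "has_theta ((theta ^^ k) f) (u (Suc k))"
      by (rule has_theta_cong) (use Suc in auto)
    then show ?case using theta_eq by auto
  qed
  have th: "has_theta ((theta ^^ k) f) (u (Suc k))" if "k < 4" for k
    by (rule has_theta_cong[of "u k" "u (Suc k)"]) (use u that k[of k] in \<open>auto simp: theta_tower_def\<close>)
  have v: "theta_tower v" unfolding theta_tower_def
  proof (intro allI impI)
    fix k :: nat assume "k < 4"
    then show "has_theta (v k) (v (Suc k))" using th[of k] u by (cases k) (auto simp: v_def theta_tower_def)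
  qed
  show ?thesis unfolding solves_on_Rplus_def
  proof (intro allI impI conjI)
    fix x :: real assume x: "x > 0"
    show "(theta ^^ k) f differentiable at x" if "k < 4" for k
      using has_thetaD[OF th[OF that] x] by (rule differentiableI_vector)
    have "opQP \<mu> \<nu> v x = opQP \<mu> \<nu> u x" using f[OF x] by (simp add: opQP_def v_def)
    then have "opD \<mu> \<nu> (v 0) x = lam * v 0 x"
      unfolding opD_tower_iff[OF v x] using eq[OF x] f[OF x] by (simp add: v_def)
    then show "opD \<mu> \<nu> f x = lam * f x" by (simp add: v_def)
  qed
qed

lemma solves_on_RplusD:
  assumes "solves_on_Rplus \<mu> \<nu> lam f"
  shows "theta_tower (\<lambda>k. (theta ^^ k) f)"
    and "x > 0 \<Longrightarrow> opQP \<mu> \<nu> (\<lambda>k. (theta ^^ k) f) x = of_real (x\<^sup>2) * ((lam + opC \<mu> \<nu>) * f x)"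
proof -
  show T: "theta_tower (\<lambda>k. (theta ^^ k) f)"
    unfolding theta_tower_def has_theta_def
  proof (intro allI impI)
    fix k :: nat and x :: real assume "k < 4" "x > 0"
    then have "((theta ^^ k) f has_vector_derivative vector_derivative ((theta ^^ k) f) (at x)) (at x)"
      using assms by (simp add: solves_on_Rplus_def vector_derivative_works[symmetric])
    then show "((theta ^^ k) f has_vector_derivative (theta ^^ Suc k) f x / of_real x) (at x)"
      using \<open>x > 0\<close> by (simp add: theta_def)
  qed
  assume x: "x > 0"
  from assms x have "opD \<mu> \<nu> f x = lam * f x" by (simp add: solves_on_Rplus_def)
  then show "opQP \<mu> \<nu> (\<lambda>k. (theta ^^ k) f) x = of_real (x\<^sup>2) * ((lam + opC \<mu> \<nu>) * f x)"
    using opD_tower_iff[OF T x, of \<mu> \<nu> lam] by simp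
qed

section \<open>Uniqueness for the initial value problem and the dimension of the solution
  space\<close>

lemma gronwall_zero:
  fixes E E' :: "real \<Rightarrow> real"
  assumes der: "\<And>x. a \<le> x \<Longrightarrow> x \<le> b \<Longrightarrow> (E has_real_derivative E' x) (at x)"
    and bound: "\<And>x. a \<le> x \<Longrightarrow> x \<le> b \<Longrightarrow> \<bar>E' x\<bar> \<le> K * E x"
    and nonneg: "\<And>x. E x \<ge> 0"
    and x0: "a \<le> x0" "x0 \<le> b" "E x0 = 0" and x: "a \<le> x" "x \<le> b"
  shows "E x = 0"
proof -
  have e: "((\<lambda>x. exp (c * x)) has_real_derivative c * exp (c * y)) (at y)" for c y :: real
    by (auto intro!: derivative_eq_intros)
  show ?thesis
  proof (cases "x0 \<le> x")
    case True
    \<comment> \<open>To the right of x0 the weight \<open>exp (-K x)\<close> makes E decrease, to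
      the left \<open>exp (K x)\<close> makes it increase; on either side E is then at most its
      value 0 at x0.\<close>
    have "E x * exp (- K * x) \<le> E x0 * exp (- K * x0)"
    proof (rule DERIV_nonpos_imp_nonincreasing[OF True])
      fix y assume y: "x0 \<le> y" "y \<le> x"
      have "((\<lambda>x. E x * exp (- K * x)) has_real_derivative (E' y - K * E y) * exp (- K * y)) (at y)"
        by (rule DERIV_cong[OF DERIV_mult[OF der e]]) (use x0 x y in \<open>auto simp: algebra_simps\<close>)
      moreover have "(E' y - K * E y) * exp (- K * y) \<le> 0"
        using bound[of y] x0 x y by (intro mult_nonpos_nonneg) auto
      ultimately show "\<exists>d. ((\<lambda>x. E x * exp (- K * x)) has_real_derivative d) (at y) \<and> d \<le> 0" by blast
    qed
    then show ?thesis using x0 nonneg[of x] by (simp add: mult_le_0_iff)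
  next
    case False
    then have le: "x \<le> x0" by simp
    have "E x * exp (K * x) \<le> E x0 * exp (K * x0)"
    proof (rule DERIV_nonneg_imp_nondecreasing[OF le])
      fix y assume y: "x \<le> y" "y \<le> x0"
      have "((\<lambda>x. E x * exp (K * x)) has_real_derivative (E' y + K * E y) * exp (K * y)) (at y)"
        by (rule DERIV_cong[OF DERIV_mult[OF der e]]) (use x0 x y in \<open>auto simp: algebra_simps\<close>)
      moreover have "(E' y + K * E y) * exp (K * y) \<ge> 0"
        using bound[of y] x0 x y by (intro mult_nonneg_nonneg) auto
      ultimately show "\<exists>d. ((\<lambda>x. E x * exp (K * x)) has_real_derivative d) (at y) \<and> 0 \<le> d" by blast
    qed
    then show ?thesis using x0 nonneg[of x] by (simp add: mult_le_0_iff)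
  qed
qed

text \<open>Gronwall applied to the sum of the squared moduli: on the compact interval between x and
  x0 the coefficients are bounded and \<open>1/y\<close> is at most \<open>1/a\<close>, so this sum
  bounds its own derivative up to a constant.\<close>

lemma theta_system_unique:
  fixes w :: "nat \<Rightarrow> real \<Rightarrow> complex" and P :: "nat \<Rightarrow> real \<Rightarrow> complex"
  assumes w: "\<And>k. k < n \<Longrightarrow> has_theta (w k) (w (Suc k))"
    and ode: "\<And>x. x > 0 \<Longrightarrow> w n x = (\<Sum>k<n. P k x * w k x)"
    and cont: "\<And>k. k < n \<Longrightarrow> continuous_on {0<..} (P k)"
    and x0: "x0 > 0" "\<And>k. k < n \<Longrightarrow> w k x0 = 0"
    and x: "x > 0" "k < n"
  shows "w k x = 0"
proof -
  define a where "a = min x x0"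
  define b where "b = max x x0"
  have ab: "0 < a" "a \<le> x" "x \<le> b" "a \<le> x0" "x0 \<le> b" using x x0 by (auto simp: a_def b_def)
  have "\<exists>M. \<forall>y\<in>{a..b}. norm (P k y) \<le> M" if "k < n" for k
  proof -
    have "compact (P k ` {a..b})"
      using ab by (intro compact_continuous_image continuous_on_subset[OF cont[OF that]]) auto
    then show ?thesis by (auto dest!: compact_imp_bounded simp: bounded_iff)
  qed
  then obtain M where M: "\<And>k y. k < n \<Longrightarrow> y \<in> {a..b} \<Longrightarrow> norm (P k y) \<le> M k" by metis
  define E where "E = (\<lambda>x. \<Sum>k<n. (norm (w k x))\<^sup>2)"
  define E' where "E' = (\<lambda>x. \<Sum>k<n. 2 * (w k x \<bullet> (w (Suc k) x / of_real x)))"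
  have le_E: "norm (w i y) * norm (w k y) \<le> E y" if "i < n" "k < n" for i k y
  proof -
    have s: "(norm (w k y))\<^sup>2 \<le> E y" if "k < n" for k
      unfolding E_def using that by (intro member_le_sum) auto
    have "2 * (norm (w i y) * norm (w k y)) \<le> (norm (w i y))\<^sup>2 + (norm (w k y))\<^sup>2"
      using sum_squares_bound[of "norm (w i y)" "norm (w k y)"] by (simp add: mult.assoc)
    then show ?thesis using s[OF that(1)] s[OF that(2)] by linarith
  qed
  \<comment> \<open>The neighbour \<open>w (Suc i)\<close> is itself a summand of E unless
    \<open>Suc i = n\<close>, where the equation replaces it by the lower ones;
    \<open>1 + (\<Sum>k<n. M k)\<close> covers both cases.\<close>
  have le_E': "norm (w i y) * norm (w (Suc i) y) \<le> (1 + (\<Sum>k<n. M k)) * E y" if i: "i < n" and y: "y \<in> {a..b}" for i y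
  proof -
    have M0: "M k \<ge> 0" if "k < n" for k using M[OF that y] norm_ge_zero order_trans by blast
    have E0: "E y \<ge> 0" by (simp add: E_def sum_nonneg)
    show ?thesis
    proof (cases "Suc i < n")
      case True
      have "0 \<le> (\<Sum>k<n. M k) * E y" using M0 E0 by (intro mult_nonneg_nonneg sum_nonneg) auto
      then show ?thesis using le_E[OF i True, of y] by (simp add: algebra_simps)
    next
      case False
      then have "Suc i = n" using i by simp
      then have "norm (w (Suc i) y) \<le> (\<Sum>k<n. norm (P k y * w k y))"
        using ode[of y] y ab norm_sum by auto
      then have "norm (w i y) * norm (w (Suc i) y) \<le> norm (w i y) * (\<Sum>k<n. norm (P k y * w k y))"
        by (rule mult_left_mono) auto
      also have "\<dots> = (\<Sum>k<n. norm (P k y) * (norm (w i y) * norm (w k y)))"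
        by (simp add: sum_distrib_left norm_mult mult_ac)
      also have "\<dots> \<le> (\<Sum>k<n. M k * E y)"
        using M y le_E[OF i] M0 by (intro sum_mono mult_mono) auto
      also have "\<dots> \<le> (1 + (\<Sum>k<n. M k)) * E y" using E0 by (simp add: sum_distrib_right[symmetric] distrib_right)
      finally show ?thesis .
    qed
  qed
  \<comment> \<open>In K the 2 comes from differentiating squares, \<open>1/a\<close> bounds the
    division by y in \<open>has_theta\<close>, and n counts the summands.\<close>
  have "E x = 0"
  proof (rule gronwall_zero[where a = a and b = b and E = E and E' = E' and ?x0.0 = x0
        and K = "real n * (2 / a * (1 + (\<Sum>k<n. M k)))"])
    fix y assume y: "a \<le> y" "y \<le> b"
    then have y0: "y > 0" using ab by simp
    show "(E has_real_derivative E' y) (at y)"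
      unfolding E_def E'_def power2_norm_eq_inner has_real_derivative_iff_has_vector_derivative
    proof (rule has_vector_derivative_sum)
      fix k assume "k \<in> {..<n}"
      then have "(w k has_vector_derivative w (Suc k) y / of_real y) (at y)" using has_thetaD[OF w y0] by simp
      from bounded_bilinear.has_vector_derivative[OF bounded_bilinear_inner this this]
      show "((\<lambda>x. w k x \<bullet> w k x) has_vector_derivative 2 * (w k y \<bullet> (w (Suc k) y / of_real y))) (at y)"
        by (simp add: inner_commute)
    qed
    have "\<bar>E' y\<bar> \<le> (\<Sum>k<n. \<bar>2 * (w k y \<bullet> (w (Suc k) y / of_real y))\<bar>)"
      unfolding E'_def by (rule sum_abs)
    also have "\<dots> \<le> (\<Sum>k<n. 2 / a * ((1 + (\<Sum>k<n. M k)) * E y))"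
    proof (rule sum_mono)
      fix k assume k: "k \<in> {..<n}"
      have "\<bar>w k y \<bullet> (w (Suc k) y / of_real y)\<bar> \<le> norm (w k y) * norm (w (Suc k) y / of_real y)"
        by (rule Cauchy_Schwarz_ineq2)
      also have "\<dots> = norm (w k y) * norm (w (Suc k) y) / y" using y0 by (simp add: norm_divide)
      also have "\<dots> \<le> norm (w k y) * norm (w (Suc k) y) / a"
        using y ab by (intro divide_left_mono) auto
      also have "\<dots> \<le> (1 + (\<Sum>k<n. M k)) * E y / a"
        using le_E'[of k y] k y ab by (intro divide_right_mono) auto
      finally show "\<bar>2 * (w k y \<bullet> (w (Suc k) y / of_real y))\<bar> \<le> 2 / a * ((1 + (\<Sum>k<n. M k)) * E y)"
        by (simp add: abs_mult)
    qed
    also have "\<dots> = (real n * (2 / a * (1 + (\<Sum>k<n. M k)))) * E y" by simp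
    finally show "\<bar>E' y\<bar> \<le> (real n * (2 / a * (1 + (\<Sum>k<n. M k)))) * E y" .
  qed (use ab x0 in \<open>auto simp: E_def intro!: sum_nonneg\<close>)
  then have "(norm (w k x))\<^sup>2 = 0"
    using x(2) by (simp add: E_def sum_nonneg_eq_0_iff)
  then show ?thesis by simp
qed

text \<open>Gaussian elimination: \<open>a'\<close> is the system after the last equation has been
  used to eliminate the unknown p, and \<open>e\<close> recovers that unknown by back
  substitution.\<close>

lemma homogeneous_system_solution:
  fixes a :: "nat \<Rightarrow> 'i \<Rightarrow> 'a::field"
  assumes "finite I" "n < card I"
  shows "\<exists>d. (\<exists>i\<in>I. d i \<noteq> 0) \<and> (\<forall>k<n. (\<Sum>i\<in>I. d i * a k i) = 0)"
  using assms
proof (induction n arbitrary: I a)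
  case 0
  then have "I \<noteq> {}" by auto
  then show ?case by (intro exI[of _ "\<lambda>_. 1"]) auto
next
  case (Suc n)
  show ?case
  proof (cases "\<forall>i\<in>I. a n i = 0")
    case True
    obtain d where d: "\<exists>i\<in>I. d i \<noteq> 0" "\<forall>k<n. (\<Sum>i\<in>I. d i * a k i) = 0"
      using Suc.IH[of I a] Suc.prems by auto
    have "(\<Sum>i\<in>I. d i * a n i) = 0" using True by simp
    with d show ?thesis by (auto simp: less_Suc_eq)
  next
    case False
    then obtain p where p: "p \<in> I" "a n p \<noteq> 0" by blast
    define a' where "a' = (\<lambda>k i. a k i - a n i * a k p / a n p)"
    have "n < card (I - {p})" using Suc.prems p by simp
    then obtain d where d: "\<exists>i\<in>I - {p}. d i \<noteq> 0" "\<forall>k<n. (\<Sum>i\<in>I - {p}. d i * a' k i) = 0"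
      using Suc.IH[of "I - {p}" a'] Suc.prems by auto
    define e where "e = d(p := - (\<Sum>i\<in>I - {p}. d i * a n i) / a n p)"
    have split: "(\<Sum>i\<in>I. e i * a k i) = (\<Sum>i\<in>I - {p}. d i * a' k i)" for k
    proof -
      have "(\<Sum>i\<in>I. e i * a k i) = e p * a k p + (\<Sum>i\<in>I - {p}. e i * a k i)"
        using Suc.prems(1) p(1) by (rule sum.remove)
      also have "(\<Sum>i\<in>I - {p}. e i * a k i) = (\<Sum>i\<in>I - {p}. d i * a k i)"
        by (rule sum.cong) (auto simp: e_def)
      also have "e p * a k p = (\<Sum>i\<in>I - {p}. d i * a n i) * (- a k p / a n p)" by (simp add: e_def)
      also have "\<dots> + (\<Sum>i\<in>I - {p}. d i * a k i) = (\<Sum>i\<in>I - {p}. d i * a' k i)"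
        unfolding sum_distrib_right sum.distrib[symmetric] a'_def
        by (rule sum.cong) (simp_all add: algebra_simps)
      finally show ?thesis .
    qed
    have "(\<Sum>i\<in>I - {p}. d i * a' n i) = 0" using p(2) by (simp add: a'_def)
    then have "\<forall>k<Suc n. (\<Sum>i\<in>I. e i * a k i) = 0"
      unfolding split using d(2) by (auto simp: less_Suc_eq)
    moreover have "\<exists>i\<in>I. e i \<noteq> 0" using d(1) by (auto simp: e_def)
    ultimately show ?thesis by blast
  qed
qed

text \<open>The operator is monic in \<theta>; these are the coefficients obtained by solving the
  eigenvalue equation for \<open>u 4\<close>, the form that \<open>theta_system_unique\<close>
  takes.\<close>

definition opQP_coeff :: "complex \<Rightarrow> complex \<Rightarrow> complex \<Rightarrow> nat \<Rightarrow> real \<Rightarrow> complex" where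
  "opQP_coeff \<mu> \<nu> l k x =
     (if k = 0 then of_real (x\<^sup>2) * (l + 4 + 2 * (\<mu> + 2 * \<nu>) + \<nu> * (\<mu> + \<nu>)) - of_real (x\<^sup>2) * of_real (x\<^sup>2)
      else if k = 1 then of_real (x\<^sup>2) * (4 + (\<mu> + 2 * \<nu>) + \<mu>) - \<nu> * (\<mu> + \<nu>) * \<mu>
      else if k = 2 then of_real (x\<^sup>2) * 2 - (\<mu> + 2 * \<nu>) * \<mu> - \<nu> * (\<mu> + \<nu>)
      else - \<mu> - (\<mu> + 2 * \<nu>))"

lemma opQP_solve:
  "opQP \<mu> \<nu> u x = of_real (x\<^sup>2) * (l * u 0 x) \<longleftrightarrow> u 4 x = (\<Sum>k<4. opQP_coeff \<mu> \<nu> l k x * u k x)"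
proof -
  have sum4: "(\<Sum>k<4. f k) = f 0 + f 1 + f 2 + f 3" for f :: "nat \<Rightarrow> complex"
    by (simp add: eval_nat_numeral)
  define y where "y = complex_of_real (x\<^sup>2)"
  have "u 4 x - (\<Sum>k<4. opQP_coeff \<mu> \<nu> l k x * u k x) = opQP \<mu> \<nu> u x - of_real (x\<^sup>2) * (l * u 0 x)"
    unfolding opQP_def sum4 opQP_coeff_def y_def[symmetric] by (simp add: algebra_simps)
  then show ?thesis by (metis eq_iff_diff_eq_0)
qed

lemma theta_tower_unique:
  assumes "theta_tower u" and "\<And>x. x > 0 \<Longrightarrow> opQP \<mu> \<nu> u x = of_real (x\<^sup>2) * (l * u 0 x)"
    and "x0 > 0" "\<And>k. k < 4 \<Longrightarrow> u k x0 = 0" and "x > 0"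
  shows "u 0 x = 0"
proof (rule theta_system_unique[where n = 4 and ?x0.0 = x0 and P = "opQP_coeff \<mu> \<nu> l" and k = 0 and w = u])
  show "k < 4 \<Longrightarrow> has_theta (u k) (u (Suc k))" for k using assms(1) by (simp add: theta_tower_def)
  show "x > 0 \<Longrightarrow> u 4 x = (\<Sum>k<4. opQP_coeff \<mu> \<nu> l k x * u k x)" for x
    using assms(2) unfolding opQP_solve by blast
  show "k < 4 \<Longrightarrow> continuous_on {0<..} (opQP_coeff \<mu> \<nu> l k)" for k
    unfolding opQP_coeff_def by (cases "k = 0"; cases "k = 1"; cases "k = 2") (auto intro!: continuous_intros)
qed (use assms in auto)

lemma opQP_sum:
  assumes "finite I"
  shows "opQP \<mu> \<nu> (\<lambda>k x. \<Sum>i\<in>I. d i * v i k x) x = (\<Sum>i\<in>I. d i * opQP \<mu> \<nu> (v i) x)"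
  using assms
proof (induction I)
  case empty
  show ?case by (simp add: opQP_def)
next
  case (insert i I)
  have "opQP \<mu> \<nu> (\<lambda>k x. c * v k x + w k x) x = c * opQP \<mu> \<nu> v x + opQP \<mu> \<nu> w x" for c v w
    unfolding opQP_def by (simp add: algebra_simps)
  with insert show ?case by simp
qed

text \<open>Five solutions have four initial values each at \<open>x = 1\<close>, so some nontrivial
  combination has zero initial data and vanishes by uniqueness. Independence of the f i forbids a
  zero coefficient at g, which sits at index 0 of h; dividing by that coefficient expresses
  g.\<close>

lemma fundamental_system:
  fixes f :: "nat \<Rightarrow> real \<Rightarrow> complex"
  assumes sol: "\<And>i. i \<in> {1..4} \<Longrightarrow> solves_on_Rplus \<mu> \<nu> lam (f i)"
    and indep: "\<And>c. \<forall>x>0. (\<Sum>i\<in>{1..4}. c i * f i x) = 0 \<Longrightarrow> \<forall>i\<in>{1..4}. c i = 0"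
    and g: "solves_on_Rplus \<mu> \<nu> lam g"
  shows "\<exists>c. \<forall>x>0. g x = (\<Sum>i\<in>{1..4}. c i * f i x)"
proof -
  define h where "h = f(0 := g)"
  have h: "solves_on_Rplus \<mu> \<nu> lam (h i)" if "i \<in> {0..4}" for i
    using sol[of i] g that by (auto simp: h_def)
  obtain d where d: "\<exists>i\<in>{0..4}. d i \<noteq> 0" "\<forall>k<4. (\<Sum>i\<in>{0..4}. d i * (theta ^^ k) (h i) 1) = 0"
    using homogeneous_system_solution[of "{0..4::nat}" 4 "\<lambda>k i. (theta ^^ k) (h i) 1"] by auto
  define u where "u = (\<lambda>k x. \<Sum>i\<in>{0..4}. d i * (theta ^^ k) (h i) x)"
  have "theta_tower u"
    unfolding theta_tower_def u_def
    using solves_on_RplusD(1)[OF h] by (auto intro!: has_theta_sum has_theta_cmult simp: theta_tower_def)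
  moreover have "opQP \<mu> \<nu> u x = of_real (x\<^sup>2) * ((lam + opC \<mu> \<nu>) * u 0 x)" if "x > 0" for x
  proof -
    have "opQP \<mu> \<nu> u x = (\<Sum>i\<in>{0..4}. d i * opQP \<mu> \<nu> (\<lambda>k. (theta ^^ k) (h i)) x)"
      unfolding u_def by (rule opQP_sum) simp
    also have "\<dots> = (\<Sum>i\<in>{0..4}. d i * (of_real (x\<^sup>2) * ((lam + opC \<mu> \<nu>) * h i x)))"
      by (intro sum.cong refl) (simp add: solves_on_RplusD(2)[OF h that])
    also have "\<dots> = of_real (x\<^sup>2) * ((lam + opC \<mu> \<nu>) * u 0 x)"
      by (simp add: u_def sum_distrib_left mult_ac)
    finally show ?thesis .
  qed
  ultimately have "u 0 x = 0" if "x > 0" for x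
    by (rule theta_tower_unique[where ?x0.0 = 1]) (use d(2) that in \<open>auto simp: u_def\<close>)
  then have eq: "d 0 * g x + (\<Sum>i\<in>{1..4}. d i * f i x) = 0" if "x > 0" for x
    using that by (simp add: u_def h_def sum.atLeast_Suc_atMost)
  have d0: "d 0 \<noteq> 0"
  proof
    assume "d 0 = 0"
    then have "\<forall>x>0. (\<Sum>i\<in>{1..4}. d i * f i x) = 0" using eq by simp
    then have "\<forall>i\<in>{1..4}. d i = 0" by (rule indep)
    then have "\<forall>i\<in>{0..4}. d i = 0" using \<open>d 0 = 0\<close> by (metis atLeastAtMost_iff One_nat_def Suc_leI neq0_conv)
    then show False using d(1) by blast
  qed
  show ?thesis
  proof (intro exI allI impI)
    fix x :: real assume "x > 0"
    from eq[OF this] d0 show "g x = (\<Sum>i\<in>{1..4}. (- d i / d 0) * f i x)"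
      by (simp add: sum_divide_distrib[symmetric] sum_negf field_simps eq_neg_iff_add_eq_0)
  qed
qed

section \<open>The generating function\<close>

lemma has_field_derivative_quadratic_mult:
  fixes F :: "complex \<Rightarrow> complex"
  assumes "(F has_field_derivative F1 / z) (at z)" "z \<noteq> 0"
  shows "((\<lambda>z. (c * z\<^sup>2 + e) * F z) has_field_derivative (2 * c * z\<^sup>2 * F z + (c * z\<^sup>2 + e) * F1) / z) (at z)"
proof -
  have "((\<lambda>z. c * z\<^sup>2 + e) has_field_derivative 2 * c * z) (at z)"
    by (auto intro!: derivative_eq_intros)
  from DERIV_mult[OF this assms(1)] show ?thesis
    by (rule DERIV_cong) (use assms(2) in \<open>simp add: field_simps power2_eq_square\<close>)
qed

text \<open>The value of \<open>G\<^sub>4 = \<theta>\<^sub>x\<^sup>4 G\<^sub>0\<close> on the generating function: here \<open>a, b, c, d\<close> stand for the four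
  products of \<open>A, \<theta>A\<close> with \<open>B, \<theta>B\<close>, \<open>r = t/(1-t)\<close>, \<open>r + 1 = 1/(1-t)\<close>, \<open>X = x\<^sup>2\<close>,
  and the last line collects \<open>4 \<theta>\<^sub>t\<^sup>2 + 4 (\<mu> + 1) \<theta>\<^sub>t + 2 (\<mu> - \<nu>) s\<close>.\<close>
lemma generating_function_identity:
  fixes a b c d r X \<mu> \<nu> s l :: complex
  assumes \<nu>: "\<nu> = 2 * s - \<mu> - 2" and q: "q = r + 1" and k: "k = r\<^sup>2" and m: "m = q\<^sup>2"
    and G2: "G2 = (k + m) * X * a - \<mu> * b - \<nu> * c + 2 * d"
    and G3: "G3 = ((2 - \<mu>) * k + (2 - \<nu>) * m) * X * a + ((k + 3 * m) * X + \<mu>\<^sup>2) * b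
                  + ((3 * k + m) * X + \<nu>\<^sup>2) * c - 3 * (\<mu> + \<nu>) * d"
    and G4: "G4 = 2 * ((2 - \<mu>) * k + (2 - \<nu>) * m) * X * a + 2 * (k + 3 * m) * X * b + 2 * (3 * k + m) * X * c
         + ((2 - \<mu>) * k + (2 - \<nu>) * m) * X * (b + c)
         + ((k + 3 * m) * X + \<mu>\<^sup>2) * (k * X * a - \<mu> * b + d)
         + ((3 * k + m) * X + \<nu>\<^sup>2) * (d + m * X * a - \<nu> * c)
         - 3 * (\<mu> + \<nu>) * (k * X * c - \<mu> * d + m * X * b - \<nu> * d)"
    and T1: "T1 = s * r * a + q * b + r * c"
    and T2: "T2 = s * (q * r) * a + s * r * T1 + q * r * b + q * (s * r * b + q * (k * X * a - \<mu> * b) + r * d)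
                 + q * r * c + r * (s * r * c + q * d + r * (m * X * a - \<nu> * c))"
  shows "G4 = (X * (l + 4 + 2 * (\<mu> + 2 * \<nu>) + \<nu> * (\<mu> + \<nu>)) - X * X) * a
       + (X * (4 + (\<mu> + 2 * \<nu>) + \<mu>) - \<nu> * (\<mu> + \<nu>) * \<mu>) * (b + c)
       + (X * 2 - (\<mu> + 2 * \<nu>) * \<mu> - \<nu> * (\<mu> + \<nu>)) * G2
       + (- \<mu> - (\<mu> + 2 * \<nu>)) * G3
       + X * (4 * T2 + 4 * (\<mu> + 1) * T1 + (2 * (\<mu> - \<nu>) * s - l) * a)"
  unfolding G4 G3 G2 T2 T1 k m q \<nu> by algebra

text \<open>Covers all four generating functions at once. A is allowed a pole at 0, of order at most
  N, with \<open>H = z^N * A\<close> as its entire completion; N is 0 for I and \<mu> for K. B is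
  required in the right half plane only.\<close>

locale bessel_product =
  fixes \<mu> \<nu> :: complex and N :: nat and A A1 H B B1 :: "complex \<Rightarrow> complex"
  assumes A: "bessel_system \<mu> (- {0}) (\<lambda>_. 0) A A1"
    and H: "H holomorphic_on UNIV" "\<And>z. z \<noteq> 0 \<Longrightarrow> z ^ N * A z = H z"
    and B: "bessel_system \<nu> {z. Re z > 0} (\<lambda>_. 0) B B1"
begin

definition "s = (\<mu> + \<nu> + 2) / 2"

definition V :: "(complex \<Rightarrow> complex) \<Rightarrow> (complex \<Rightarrow> complex) \<Rightarrow> complex \<Rightarrow> complex \<Rightarrow> complex" where
  "V f g t z = (1 - t) powr (- s) * f (t * z / (1 - t)) * g (z / (1 - t))"

definition A2 :: "complex \<Rightarrow> complex" where "A2 w = w\<^sup>2 * A w - \<mu> * A1 w"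
definition B2 :: "complex \<Rightarrow> complex" where "B2 w = w\<^sup>2 * B w - \<nu> * B1 w"

lemma derivs:
  shows "w \<noteq> 0 \<Longrightarrow> (A has_field_derivative A1 w / w) (at w)"
    and "w \<noteq> 0 \<Longrightarrow> (A1 has_field_derivative A2 w / w) (at w)"
    and "Re w > 0 \<Longrightarrow> (B has_field_derivative B1 w / w) (at w)"
    and "Re w > 0 \<Longrightarrow> (B1 has_field_derivative B2 w / w) (at w)"
  using bessel_systemD[OF A, of w] bessel_systemD[OF B, of w] by (auto simp: A2_def B2_def)

lemma domain:
  assumes "norm t < 1"
  shows "1 - t \<noteq> 0" "1 - t \<notin> \<real>\<^sub>\<le>\<^sub>0" "x > 0 \<Longrightarrow> Re (of_real x / (1 - t)) > 0"
proof -
  have "Re t < 1" using assms complex_Re_le_cmod[of t] by linarith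
  then show "1 - t \<noteq> 0" "1 - t \<notin> \<real>\<^sub>\<le>\<^sub>0" "x > 0 \<Longrightarrow> Re (of_real x / (1 - t)) > 0"
    by (auto simp: complex_nonpos_Reals_iff Re_complex_div_gt_0)
qed

text \<open>Both arguments are linear in z, so \<theta> in z acts on each factor as \<theta> in its
  own argument.\<close>

lemma V_deriv_z:
  assumes t: "norm t < 1" "t \<noteq> 0" and z: "z \<noteq> 0"
    and f: "(f has_field_derivative f1 (t * z / (1 - t)) / (t * z / (1 - t))) (at (t * z / (1 - t)))"
    and g: "(g has_field_derivative g1 (z / (1 - t)) / (z / (1 - t))) (at (z / (1 - t)))"
  shows "(V f g t has_field_derivative (V f1 g t z + V f g1 t z) / z) (at z)"
proof -
  have t1: "1 - t \<noteq> 0" using domain(1)[OF t(1)] .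
  have "((\<lambda>z. t * z / (1 - t)) has_field_derivative t / (1 - t)) (at z)"
    using t1 by (auto intro!: derivative_eq_intros)
  from DERIV_chain2[OF f this]
  have F: "((\<lambda>z. f (t * z / (1 - t))) has_field_derivative f1 (t * z / (1 - t)) / z) (at z)"
    by (rule DERIV_cong) (use t t1 z in simp)
  have "((\<lambda>z. z / (1 - t)) has_field_derivative 1 / (1 - t)) (at z)"
    using t1 by (auto intro!: derivative_eq_intros)
  from DERIV_chain2[OF g this]
  have G: "((\<lambda>z. g (z / (1 - t))) has_field_derivative g1 (z / (1 - t)) / z) (at z)"
    by (rule DERIV_cong) (use t1 z in simp)
  from DERIV_cmult[OF DERIV_mult[OF F G], of "(1 - t) powr (- s)"] show ?thesis
    unfolding V_def[abs_def] mult.assoc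
    by (rule DERIV_cong) (simp add: algebra_simps add_divide_distrib)
qed

text \<open>The logarithmic derivatives under \<theta> in t: \<open>s * t/(1-t)\<close> for the
  power of \<open>1 - t\<close>, \<open>1/(1-t)\<close> for the argument of f, and
  \<open>t/(1-t)\<close> for the argument of g.\<close>

lemma V_deriv_t:
  assumes t: "norm t < 1" "t \<noteq> 0" and z: "z \<noteq> 0"
    and f: "(f has_field_derivative f1 (t * z / (1 - t)) / (t * z / (1 - t))) (at (t * z / (1 - t)))"
    and g: "(g has_field_derivative g1 (z / (1 - t)) / (z / (1 - t))) (at (z / (1 - t)))"
  shows "((\<lambda>t. V f g t z) has_field_derivative
      (s * (t / (1 - t)) * V f g t z + 1 / (1 - t) * V f1 g t z + t / (1 - t) * V f g1 t z) / t) (at t)"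
proof -
  have t1: "1 - t \<noteq> 0" using domain(1)[OF t(1)] .
  have t1': "t - 1 \<noteq> 0" using t1 by auto
  have "((\<lambda>t. t * z / (1 - t)) has_field_derivative z / (1 - t)\<^sup>2) (at t)"
    using t1 t1' by (auto intro!: derivative_eq_intros simp: field_simps power2_eq_square)
  from DERIV_chain2[OF f this]
  have F: "((\<lambda>t. f (t * z / (1 - t))) has_field_derivative f1 (t * z / (1 - t)) * (1 / (1 - t) / t)) (at t)"
    by (rule DERIV_cong) (use t t1 z in \<open>simp add: power2_eq_square\<close>)
  have "((\<lambda>t. z / (1 - t)) has_field_derivative z / (1 - t)\<^sup>2) (at t)"
    using t1 by (auto intro!: derivative_eq_intros simp: power2_eq_square)
  from DERIV_chain2[OF g this]
  have G: "((\<lambda>t. g (z / (1 - t))) has_field_derivative g1 (z / (1 - t)) * (t / (1 - t) / t)) (at t)"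
    by (rule DERIV_cong) (use t t1 z in \<open>simp add: power2_eq_square\<close>)
  have P: "((\<lambda>t. (1 - t) powr (- s)) has_field_derivative (s * (t / (1 - t)) / t) * (1 - t) powr (- s)) (at t)"
    using domain[OF t(1)] t by (auto intro!: derivative_eq_intros simp: powr_diff)
  from DERIV_mult[OF P DERIV_mult[OF F G]] show ?thesis
    unfolding V_def[abs_def] mult.assoc add_divide_distrib
    by (rule DERIV_cong) (simp add: algebra_simps)
qed

lemma V_A2: "V A2 g t z = (t / (1 - t))\<^sup>2 * z\<^sup>2 * V A g t z - \<mu> * V A1 g t z"
  by (simp add: V_def A2_def algebra_simps power_mult_distrib power_divide)

lemma V_B2: "V f B2 t z = (1 / (1 - t))\<^sup>2 * z\<^sup>2 * V f B t z - \<nu> * V f B1 t z"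
  by (simp add: V_def B2_def algebra_simps power_mult_distrib power_divide)

lemma V_continuous:
  assumes f: "\<And>w. w \<noteq> 0 \<Longrightarrow> isCont f w" and g: "\<And>w. Re w > 0 \<Longrightarrow> isCont g w"
  shows "continuous_on ({0<..} \<times> sphere 0 (1/2)) (\<lambda>(x, t). V f g t (of_real x))"
proof -
  have f': "continuous_on (- {0}) f" and g': "continuous_on {z. Re z > 0} g"
    using f g by (auto intro!: continuous_at_imp_continuous_on)
  have d: "1 - t \<noteq> 0" "1 - t \<notin> \<real>\<^sub>\<le>\<^sub>0" "x > 0 \<Longrightarrow> Re (of_real x / (1 - t)) > 0" if "norm t = 1/2" for t x
    using domain[of t] that by auto
  have d': "Re t \<le> 1" if "norm t = 1/2" for t
    using complex_Re_le_cmod[of t] that by linarith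
  have "continuous_on ({0<..} \<times> sphere 0 (1/2)) (\<lambda>p. (1 - snd p) powr (- s) *
       f (snd p * of_real (fst p) / (1 - snd p)) * g (of_real (fst p) / (1 - snd p)))"
    by (intro continuous_intros continuous_on_compose2[OF f'] continuous_on_compose2[OF g'])
       (use d d' in auto)
  then show ?thesis by (simp add: V_def split_beta)
qed

section \<open>Iterates of the generating function under \<theta> in x\<close>

text \<open>Coefficients of degree at most two in z suffice for the iterates up to the third. The
  fourth has terms in \<open>z^4\<close>, so \<open>G 4\<close> is kept as a
  \<open>theta_comb\<close>.\<close>

definition comb where
  "comb c1 e1 c2 e2 c3 e3 c4 e4 t z =
     (c1 t * z\<^sup>2 + e1) * V A B t z + (c2 t * z\<^sup>2 + e2) * V A1 B t z
     + (c3 t * z\<^sup>2 + e3) * V A B1 t z + (c4 t * z\<^sup>2 + e4) * V A1 B1 t z"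

text \<open>\<open>a_sq t * z\<^sup>2\<close> and \<open>b_sq t * z\<^sup>2\<close> are the squares of the arguments of \<open>A\<close> and \<open>B\<close> in \<open>V\<close>;
  \<open>theta_comb\<close> is \<open>\<theta>\<^sub>z\<close> of \<open>comb\<close>, \<open>G j\<close> is \<open>\<theta>\<^sub>z\<^sup>j\<close> of \<open>G 0 = V A B\<close>, and \<open>T1, T2\<close> are its first two \<open>\<theta>\<^sub>t\<close>-iterates.\<close>
definition "a_sq t = (t / (1 - t))\<^sup>2"
definition "b_sq t = (1 / (1 - t))\<^sup>2"

definition theta_comb where
  "theta_comb c1 e1 c2 e2 c3 e3 c4 e4 t z =
     (2 * c1 t * z\<^sup>2 * V A B t z + (c1 t * z\<^sup>2 + e1) * (V A1 B t z + V A B1 t z))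
     + (2 * c2 t * z\<^sup>2 * V A1 B t z + (c2 t * z\<^sup>2 + e2) * (a_sq t * z\<^sup>2 * V A B t z - \<mu> * V A1 B t z + V A1 B1 t z))
     + (2 * c3 t * z\<^sup>2 * V A B1 t z + (c3 t * z\<^sup>2 + e3) * (V A1 B1 t z + (b_sq t * z\<^sup>2 * V A B t z - \<nu> * V A B1 t z)))
     + (2 * c4 t * z\<^sup>2 * V A1 B1 t z + (c4 t * z\<^sup>2 + e4) *
          (a_sq t * z\<^sup>2 * V A B1 t z - \<mu> * V A1 B1 t z + (b_sq t * z\<^sup>2 * V A1 B t z - \<nu> * V A1 B1 t z)))"

lemma comb_deriv:
  assumes t: "norm t < 1" "t \<noteq> 0" and x: "x > 0"
  shows "(comb c1 e1 c2 e2 c3 e3 c4 e4 t has_field_derivative theta_comb c1 e1 c2 e2 c3 e3 c4 e4 t (of_real x) / of_real x)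
           (at (of_real x))"
proof -
  have z: "of_real x \<noteq> (0::complex)" using x by simp
  have a: "t * of_real x / (1 - t) \<noteq> 0" using domain(1)[OF t(1)] t z by simp
  have b: "Re (of_real x / (1 - t)) > 0" using domain(3)[OF t(1) x] .
  note D = V_deriv_z[OF t z, where f = A and ?f1.0 = A1 and g = B and ?g1.0 = B1, OF derivs(1)[OF a] derivs(3)[OF b]]
     V_deriv_z[OF t z, where f = A1 and ?f1.0 = A2 and g = B and ?g1.0 = B1, OF derivs(2)[OF a] derivs(3)[OF b]]
     V_deriv_z[OF t z, where f = A and ?f1.0 = A1 and g = B1 and ?g1.0 = B2, OF derivs(1)[OF a] derivs(4)[OF b]]
     V_deriv_z[OF t z, where f = A1 and ?f1.0 = A2 and g = B1 and ?g1.0 = B2, OF derivs(2)[OF a] derivs(4)[OF b]]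
  show ?thesis unfolding comb_def[abs_def] theta_comb_def add_divide_distrib a_sq_def b_sq_def
    by (intro DERIV_add has_field_derivative_quadratic_mult[OF _ z, unfolded add_divide_distrib]
          D[unfolded V_A2 V_B2])
qed

definition G :: "nat \<Rightarrow> complex \<Rightarrow> complex \<Rightarrow> complex" where
  "G j = (if j = 0 then comb (\<lambda>_. 0) 1 (\<lambda>_. 0) 0 (\<lambda>_. 0) 0 (\<lambda>_. 0) 0
     else if j = 1 then comb (\<lambda>_. 0) 0 (\<lambda>_. 0) 1 (\<lambda>_. 0) 1 (\<lambda>_. 0) 0
     else if j = 2 then comb (\<lambda>t. a_sq t + b_sq t) 0 (\<lambda>_. 0) (-\<mu>) (\<lambda>_. 0) (-\<nu>) (\<lambda>_. 0) 2
     else if j = 3 then comb (\<lambda>t. (2 - \<mu>) * a_sq t + (2 - \<nu>) * b_sq t) 0 (\<lambda>t. a_sq t + 3 * b_sq t) (\<mu>\<^sup>2)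
        (\<lambda>t. 3 * a_sq t + b_sq t) (\<nu>\<^sup>2) (\<lambda>_. 0) (- 3 * (\<mu> + \<nu>))
     else theta_comb (\<lambda>t. (2 - \<mu>) * a_sq t + (2 - \<nu>) * b_sq t) 0 (\<lambda>t. a_sq t + 3 * b_sq t) (\<mu>\<^sup>2)
        (\<lambda>t. 3 * a_sq t + b_sq t) (\<nu>\<^sup>2) (\<lambda>_. 0) (- 3 * (\<mu> + \<nu>)))"

lemma G_deriv:
  assumes t: "norm t < 1" "t \<noteq> 0" and x: "x > 0" and j: "j < 4"
  shows "(G j t has_field_derivative G (Suc j) t (of_real x) / of_real x) (at (of_real x))"
proof -
  have 1: "theta_comb (\<lambda>_. 0) 1 (\<lambda>_. 0) 0 (\<lambda>_. 0) 0 (\<lambda>_. 0) 0 t z = G 1 t z" for z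
    by (simp add: theta_comb_def G_def comb_def algebra_simps)
  have 2: "theta_comb (\<lambda>_. 0) 0 (\<lambda>_. 0) 1 (\<lambda>_. 0) 1 (\<lambda>_. 0) 0 t z = G 2 t z" for z
    by (simp add: theta_comb_def G_def comb_def algebra_simps)
  have 3: "theta_comb (\<lambda>t. a_sq t + b_sq t) 0 (\<lambda>_. 0) (-\<mu>) (\<lambda>_. 0) (-\<nu>) (\<lambda>_. 0) 2 t z = G 3 t z" for z
    by (simp add: theta_comb_def G_def comb_def algebra_simps power2_eq_square)
  consider "j = 0" | "j = 1" | "j = 2" | "j = 3" using j by linarith
  then show ?thesis
  proof cases
    case 1
    then show ?thesis using comb_deriv[OF t x, of "\<lambda>_. 0" 1 "\<lambda>_. 0" 0 "\<lambda>_. 0" 0 "\<lambda>_. 0" 0]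
      unfolding \<open>theta_comb (\<lambda>_. 0) 1 (\<lambda>_. 0) 0 (\<lambda>_. 0) 0 (\<lambda>_. 0) 0 t (of_real x) = G 1 t (of_real x)\<close>
      by (simp add: G_def)
  next
    case 2
    then show ?thesis using comb_deriv[OF t x, of "\<lambda>_. 0" 0 "\<lambda>_. 0" 1 "\<lambda>_. 0" 1 "\<lambda>_. 0" 0]
      unfolding \<open>theta_comb (\<lambda>_. 0) 0 (\<lambda>_. 0) 1 (\<lambda>_. 0) 1 (\<lambda>_. 0) 0 t (of_real x) = G 2 t (of_real x)\<close>
      by (simp add: G_def numeral_2_eq_2)
  next
    case 3
    then show ?thesis using comb_deriv[OF t x, of "\<lambda>t. a_sq t + b_sq t" 0 "\<lambda>_. 0" "-\<mu>" "\<lambda>_. 0" "-\<nu>" "\<lambda>_. 0" 2]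
      unfolding \<open>theta_comb (\<lambda>t. a_sq t + b_sq t) 0 (\<lambda>_. 0) (-\<mu>) (\<lambda>_. 0) (-\<nu>) (\<lambda>_. 0) 2 t (of_real x) = G 3 t (of_real x)\<close>
      by (simp add: G_def numeral_3_eq_3)
  next
    case 4
    then show ?thesis using comb_deriv[OF t x, of "\<lambda>t. (2 - \<mu>) * a_sq t + (2 - \<nu>) * b_sq t" 0 "\<lambda>t. a_sq t + 3 * b_sq t" "\<mu>\<^sup>2"
        "\<lambda>t. 3 * a_sq t + b_sq t" "\<nu>\<^sup>2" "\<lambda>_. 0" "- 3 * (\<mu> + \<nu>)"]
      by (simp add: G_def)
  qed
qed

lemma V_conts:
  shows "continuous_on ({0<..} \<times> sphere 0 (1/2)) (\<lambda>p. V A B (snd p) (of_real (fst p)))"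
    and "continuous_on ({0<..} \<times> sphere 0 (1/2)) (\<lambda>p. V A1 B (snd p) (of_real (fst p)))"
    and "continuous_on ({0<..} \<times> sphere 0 (1/2)) (\<lambda>p. V A B1 (snd p) (of_real (fst p)))"
    and "continuous_on ({0<..} \<times> sphere 0 (1/2)) (\<lambda>p. V A1 B1 (snd p) (of_real (fst p)))"
  using V_continuous[of A B] V_continuous[of A1 B] V_continuous[of A B1] V_continuous[of A1 B1]
    derivs[THEN DERIV_isCont] by (auto simp: split_beta)

lemma comb_cont:
  fixes c1 c2 c3 c4 :: "complex \<Rightarrow> complex"
  assumes c: "continuous_on ({0<..} \<times> sphere 0 (1/2)) (\<lambda>p::real \<times> complex. c1 (snd p))"
    "continuous_on ({0<..} \<times> sphere 0 (1/2)) (\<lambda>p::real \<times> complex. c2 (snd p))"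
    "continuous_on ({0<..} \<times> sphere 0 (1/2)) (\<lambda>p::real \<times> complex. c3 (snd p))"
    "continuous_on ({0<..} \<times> sphere 0 (1/2)) (\<lambda>p::real \<times> complex. c4 (snd p))"
  shows "continuous_on ({0<..} \<times> sphere 0 (1/2)) (\<lambda>p. comb c1 e1 c2 e2 c3 e3 c4 e4 (snd p) (of_real (fst p)))"
    and "continuous_on ({0<..} \<times> sphere 0 (1/2)) (\<lambda>p. theta_comb c1 e1 c2 e2 c3 e3 c4 e4 (snd p) (of_real (fst p)))"
proof -
  have *: "1 - t \<noteq> 0" if "norm t = 1/2" for t :: complex using that by auto
  have k: "continuous_on ({0<..} \<times> sphere 0 (1/2)) (\<lambda>p::real \<times> complex. a_sq (snd p))"
    "continuous_on ({0<..} \<times> sphere 0 (1/2)) (\<lambda>p::real \<times> complex. b_sq (snd p))"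
    unfolding a_sq_def b_sq_def using * by (auto intro!: continuous_intros)
  have z: "continuous_on ({0<..} \<times> sphere 0 (1/2)) (\<lambda>p::real \<times> complex. (of_real (fst p) :: complex)\<^sup>2)"
    by (intro continuous_intros)
  note rules = continuous_on_add continuous_on_diff continuous_on_mult continuous_on_const c k z V_conts
  show "continuous_on ({0<..} \<times> sphere 0 (1/2)) (\<lambda>p. comb c1 e1 c2 e2 c3 e3 c4 e4 (snd p) (of_real (fst p)))"
    unfolding comb_def by (intro rules)
  show "continuous_on ({0<..} \<times> sphere 0 (1/2)) (\<lambda>p. theta_comb c1 e1 c2 e2 c3 e3 c4 e4 (snd p) (of_real (fst p)))"
    unfolding theta_comb_def by (intro rules)
qed

lemma G_cont: "continuous_on ({0<..} \<times> sphere 0 (1/2)) (\<lambda>p. G j (snd p) (of_real (fst p)))"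
proof -
  have *: "1 - t \<noteq> 0" if "norm t = 1/2" for t :: complex using that by auto
  have k: "continuous_on ({0<..} \<times> sphere 0 (1/2)) (\<lambda>p::real \<times> complex. a_sq (snd p))"
    "continuous_on ({0<..} \<times> sphere 0 (1/2)) (\<lambda>p::real \<times> complex. b_sq (snd p))"
    unfolding a_sq_def b_sq_def using * by (auto intro!: continuous_intros)
  \<comment> \<open>Naming the property lets \<open>if_split\<close> push it through the case
    distinction in \<open>G\<close>.\<close>
  define P where "P = (\<lambda>F::complex \<Rightarrow> complex \<Rightarrow> complex.
    continuous_on ({0<..} \<times> sphere 0 (1/2)) (\<lambda>p::real \<times> complex. F (snd p) (of_real (fst p))))"
  have "P (G j)"
    unfolding G_def if_split[of P] unfolding P_def
    by (intro conjI impI comb_cont continuous_on_add continuous_on_mult continuous_on_const k)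
  then show ?thesis by (simp add: P_def)
qed

lemma fix_x_cont:
  fixes F :: "complex \<Rightarrow> complex \<Rightarrow> complex"
  assumes "continuous_on ({0<..} \<times> sphere 0 (1/2)) (\<lambda>p. F (snd p) (of_real (fst p)))" "x > 0"
  shows "continuous_on (sphere 0 (1/2)) (\<lambda>t. F t (of_real x))"
proof -
  have "continuous_on (sphere 0 (1/2)) (\<lambda>t. F (snd (x, t)) (of_real (fst (x, t))))"
    by (rule continuous_on_compose2[OF assms(1), of "sphere 0 (1/2)" "\<lambda>t. (x, t)"])
       (use assms(2) in \<open>auto intro!: continuous_intros\<close>)
  then show ?thesis by simp
qed

definition coeff :: "int \<Rightarrow> nat \<Rightarrow> real \<Rightarrow> complex" where
  "coeff n j x = circle_coeff (1/2) n (\<lambda>t. G j t (of_real x))"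

lemma coeff_tower: "theta_tower (coeff n)"
  unfolding theta_tower_def has_theta_def
proof (intro allI impI)
  fix j :: nat and x :: real assume j: "j < 4" and x: "x > 0"
  have "((\<lambda>x. circle_coeff (1/2) n (\<lambda>t. G j t (of_real x))) has_vector_derivative
      circle_coeff (1/2) n (\<lambda>t. G (Suc j) t (of_real x) / of_real x)) (at x)"
  proof (rule circle_coeff_has_vector_derivative[where U = "{0<..}"])
    fix t :: complex and y :: real assume "norm t = 1/2" "y \<in> {0<..}"
    then show "((\<lambda>x. G j t (of_real x)) has_vector_derivative G (Suc j) t (of_real y) / of_real y) (at y)"
      by (intro has_vector_derivative_real_field G_deriv j) auto
  next
    show "continuous_on (sphere 0 (1/2)) (\<lambda>t. G j t (of_real y))" if "y \<in> {0<..}" for y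
      using fix_x_cont[OF G_cont] that by auto
    show "continuous_on ({0<..} \<times> sphere 0 (1/2)) (\<lambda>(y, t). G (Suc j) t (of_real y) / of_real y)"
      unfolding split_beta by (intro continuous_intros G_cont) auto
  qed (use x in auto)
  moreover have "circle_coeff (1/2) n (\<lambda>t. G (Suc j) t (of_real x) / of_real x) = coeff n (Suc j) x / of_real x"
    using circle_coeff_cmult[of "1/2" n "1 / of_real x" "\<lambda>t. G (Suc j) t (of_real x)"] by (simp add: coeff_def)
  ultimately show "(coeff n j has_vector_derivative coeff n (Suc j) x / of_real x) (at x)"
    by (simp add: coeff_def[abs_def])
qed

section \<open>Iterates under \<theta> in t and the passage to coefficients\<close>

definition T1 where
  "T1 t z = s * (t / (1 - t)) * V A B t z + 1 / (1 - t) * V A1 B t z + t / (1 - t) * V A B1 t z"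

definition T2 where
  "T2 t z = s * (1 / (1 - t) * (t / (1 - t))) * V A B t z + s * (t / (1 - t)) * T1 t z
     + 1 / (1 - t) * (t / (1 - t)) * V A1 B t z
     + 1 / (1 - t) * (s * (t / (1 - t)) * V A1 B t z + 1 / (1 - t) * (a_sq t * z\<^sup>2 * V A B t z - \<mu> * V A1 B t z) + t / (1 - t) * V A1 B1 t z)
     + 1 / (1 - t) * (t / (1 - t)) * V A B1 t z
     + t / (1 - t) * (s * (t / (1 - t)) * V A B1 t z + 1 / (1 - t) * V A1 B1 t z + t / (1 - t) * (b_sq t * z\<^sup>2 * V A B t z - \<nu> * V A B1 t z))"

lemma T_derivs:
  assumes t: "norm t < 1" "t \<noteq> 0" and x: "x > 0"
  shows "((\<lambda>t. V A B t (of_real x)) has_field_derivative T1 t (of_real x) / t) (at t)"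
    and "((\<lambda>t. T1 t (of_real x)) has_field_derivative T2 t (of_real x) / t) (at t)"
proof -
  have z: "of_real x \<noteq> (0::complex)" using x by simp
  have a: "t * of_real x / (1 - t) \<noteq> 0" using domain(1)[OF t(1)] t z by simp
  have b: "Re (of_real x / (1 - t)) > 0" using domain(3)[OF t(1) x] .
  note D = V_deriv_t[OF t z, where f = A and ?f1.0 = A1 and g = B and ?g1.0 = B1, OF derivs(1)[OF a] derivs(3)[OF b]]
     V_deriv_t[OF t z, where f = A1 and ?f1.0 = A2 and g = B and ?g1.0 = B1, OF derivs(2)[OF a] derivs(3)[OF b]]
     V_deriv_t[OF t z, where f = A and ?f1.0 = A1 and g = B1 and ?g1.0 = B2, OF derivs(1)[OF a] derivs(4)[OF b]]
  show D1: "((\<lambda>t. V A B t (of_real x)) has_field_derivative T1 t (of_real x) / t) (at t)"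
    using D(1) by (simp add: T1_def)
  have t1: "1 - t \<noteq> 0" "t - 1 \<noteq> 0" using domain(1)[OF t(1)] by auto
  have "((\<lambda>t. 1 / (1 - t)) has_field_derivative 1 / (1 - t)\<^sup>2) (at t)"
    using t1 by (auto intro!: derivative_eq_intros simp: power2_eq_square)
  then have q: "((\<lambda>t. 1 / (1 - t)) has_field_derivative 1 / (1 - t) * (t / (1 - t)) / t) (at t)"
    by (rule DERIV_cong) (use t t1 in \<open>simp add: power2_eq_square\<close>)
  have "((\<lambda>t. t / (1 - t)) has_field_derivative 1 / (1 - t)\<^sup>2) (at t)"
    using t1 by (auto intro!: derivative_eq_intros simp: power2_eq_square)
  then have r: "((\<lambda>t. t / (1 - t)) has_field_derivative 1 / (1 - t) * (t / (1 - t)) / t) (at t)"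
    by (rule DERIV_cong) (use t t1 in \<open>simp add: power2_eq_square\<close>)
  show "((\<lambda>t. T1 t (of_real x)) has_field_derivative T2 t (of_real x) / t) (at t)"
    unfolding T1_def
  proof (rule DERIV_cong[OF DERIV_add[OF DERIV_add[OF
          DERIV_mult[OF DERIV_cmult[OF r, of s] D1] DERIV_mult[OF q D(2)[unfolded V_A2]]] DERIV_mult[OF r D(3)[unfolded V_B2]]]], goal_cases)
    case 1
    define q where "q = 1 / (1 - t)"
    define r where "r = t / (1 - t)"
    show ?case
      unfolding T2_def T1_def a_sq_def b_sq_def q_def[symmetric] r_def[symmetric]
      using t(2) by (simp add: field_simps)
  qed
qed

lemma T_cont:
  assumes x: "x > 0"
  shows "continuous_on (sphere 0 (1/2)) (\<lambda>t. T1 t (of_real x))"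
    and "continuous_on (sphere 0 (1/2)) (\<lambda>t. T2 t (of_real x))"
proof -
  note V = V_conts[THEN fix_x_cont[OF _ x]]
  have *: "1 - t \<noteq> 0" if "norm t = 1/2" for t :: complex using that by auto
  show 1: "continuous_on (sphere 0 (1/2)) (\<lambda>t. T1 t (of_real x))"
    unfolding T1_def using * by (intro continuous_intros V) auto
  show "continuous_on (sphere 0 (1/2)) (\<lambda>t. T2 t (of_real x))"
    unfolding T2_def a_sq_def b_sq_def using * by (intro continuous_intros V 1) auto
qed

lemma coeff_T:
  assumes x: "x > 0"
  shows "circle_coeff (1/2) n (\<lambda>t. T1 t (of_real x)) = of_int n * coeff n 0 x"
    and "circle_coeff (1/2) n (\<lambda>t. T2 t (of_real x)) = (of_int n)\<^sup>2 * coeff n 0 x"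
proof -
  have G0: "G 0 t z = V A B t z" for t z by (simp add: G_def comb_def)
  have nz: "t \<noteq> 0" "norm t < 1" if "norm t = 1/2" for t :: complex using that by auto
  have "circle_coeff (1/2) n (\<lambda>t. t * (T1 t (of_real x) / t)) = of_int n * circle_coeff (1/2) n (\<lambda>t. V A B t (of_real x))"
    by (rule circle_coeff_theta) (use nz x in \<open>auto intro!: T_derivs continuous_intros T_cont\<close>)
  moreover have "circle_coeff (1/2) n (\<lambda>t. t * (T1 t (of_real x) / t)) = circle_coeff (1/2) n (\<lambda>t. T1 t (of_real x))"
    by (rule circle_coeff_cong) (use nz in auto)
  ultimately show 1: "circle_coeff (1/2) n (\<lambda>t. T1 t (of_real x)) = of_int n * coeff n 0 x"
    by (simp add: coeff_def G0)
  have "circle_coeff (1/2) n (\<lambda>t. t * (T2 t (of_real x) / t)) = of_int n * circle_coeff (1/2) n (\<lambda>t. T1 t (of_real x))"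
    by (rule circle_coeff_theta) (use nz x in \<open>auto intro!: T_derivs continuous_intros T_cont\<close>)
  moreover have "circle_coeff (1/2) n (\<lambda>t. t * (T2 t (of_real x) / t)) = circle_coeff (1/2) n (\<lambda>t. T2 t (of_real x))"
    by (rule circle_coeff_cong) (use nz in auto)
  ultimately show "circle_coeff (1/2) n (\<lambda>t. T2 t (of_real x)) = (of_int n)\<^sup>2 * coeff n 0 x"
    by (simp add: 1 power2_eq_square mult.assoc)
qed

text \<open>The parameter l is free: it enters the sum through \<open>opQP_coeff\<close> and the
  final bracket with opposite signs. The right value is fixed only after passing to
  coefficients.\<close>

lemma G4_eq:
  assumes "norm t < 1"
  shows "G 4 t (of_real x) = (\<Sum>k<4. opQP_coeff \<mu> \<nu> l k x * G k t (of_real x))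
     + of_real (x\<^sup>2) * (4 * T2 t (of_real x) + 4 * (\<mu> + 1) * T1 t (of_real x) + (2 * (\<mu> - \<nu>) * s - l) * G 0 t (of_real x))"
proof -
  define r where "r = t / (1 - t)"
  define q where "q = 1 / (1 - t)"
  define z where "z = complex_of_real x"
  have qr: "q = r + 1" using domain(1)[OF assms] by (simp add: q_def r_def field_simps)
  have z2: "complex_of_real (x\<^sup>2) = z\<^sup>2" by (simp add: z_def)
  have \<nu>: "\<nu> = 2 * s - \<mu> - 2" by (simp add: s_def add_divide_distrib)
  have sum4: "(\<Sum>k<4. f k) = f 0 + f 1 + f 2 + f 3" for f :: "nat \<Rightarrow> complex"
    by (simp add: eval_nat_numeral)
  have kl: "a_sq t = r\<^sup>2" "b_sq t = q\<^sup>2" by (simp_all add: a_sq_def b_sq_def r_def q_def)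
  have G0: "G 0 t z = V A B t z" by (simp add: G_def comb_def)
  have G1: "G 1 t z = V A1 B t z + V A B1 t z" by (simp add: G_def comb_def)
  have id: "G 4 t z = (z\<^sup>2 * (l + 4 + 2 * (\<mu> + 2 * \<nu>) + \<nu> * (\<mu> + \<nu>)) - z\<^sup>2 * z\<^sup>2) * V A B t z
       + (z\<^sup>2 * (4 + (\<mu> + 2 * \<nu>) + \<mu>) - \<nu> * (\<mu> + \<nu>) * \<mu>) * (V A1 B t z + V A B1 t z)
       + (z\<^sup>2 * 2 - (\<mu> + 2 * \<nu>) * \<mu> - \<nu> * (\<mu> + \<nu>)) * G 2 t z
       + (- \<mu> - (\<mu> + 2 * \<nu>)) * G 3 t z
       + z\<^sup>2 * (4 * T2 t z + 4 * (\<mu> + 1) * T1 t z + (2 * (\<mu> - \<nu>) * s - l) * V A B t z)"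
  proof (rule generating_function_identity[OF \<nu> qr refl refl, where d = "V A1 B1 t z"])
    show "G 2 t z = (r\<^sup>2 + q\<^sup>2) * z\<^sup>2 * V A B t z - \<mu> * V A1 B t z - \<nu> * V A B1 t z + 2 * V A1 B1 t z"
      by (simp add: G_def comb_def kl)
    show "G 3 t z = ((2 - \<mu>) * r\<^sup>2 + (2 - \<nu>) * q\<^sup>2) * z\<^sup>2 * V A B t z + ((r\<^sup>2 + 3 * q\<^sup>2) * z\<^sup>2 + \<mu>\<^sup>2) * V A1 B t z
                  + ((3 * r\<^sup>2 + q\<^sup>2) * z\<^sup>2 + \<nu>\<^sup>2) * V A B1 t z - 3 * (\<mu> + \<nu>) * V A1 B1 t z"
      by (simp add: G_def comb_def kl algebra_simps)
    show "G 4 t z = 2 * ((2 - \<mu>) * r\<^sup>2 + (2 - \<nu>) * q\<^sup>2) * z\<^sup>2 * V A B t z + 2 * (r\<^sup>2 + 3 * q\<^sup>2) * z\<^sup>2 * V A1 B t z + 2 * (3 * r\<^sup>2 + q\<^sup>2) * z\<^sup>2 * V A B1 t z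
         + ((2 - \<mu>) * r\<^sup>2 + (2 - \<nu>) * q\<^sup>2) * z\<^sup>2 * (V A1 B t z + V A B1 t z)
         + ((r\<^sup>2 + 3 * q\<^sup>2) * z\<^sup>2 + \<mu>\<^sup>2) * (r\<^sup>2 * z\<^sup>2 * V A B t z - \<mu> * V A1 B t z + V A1 B1 t z)
         + ((3 * r\<^sup>2 + q\<^sup>2) * z\<^sup>2 + \<nu>\<^sup>2) * (V A1 B1 t z + q\<^sup>2 * z\<^sup>2 * V A B t z - \<nu> * V A B1 t z)
         - 3 * (\<mu> + \<nu>) * (r\<^sup>2 * z\<^sup>2 * V A B1 t z - \<mu> * V A1 B1 t z + q\<^sup>2 * z\<^sup>2 * V A1 B t z - \<nu> * V A1 B1 t z)"
      by (simp add: G_def theta_comb_def kl algebra_simps)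
  qed (simp_all only: T1_def T2_def kl q_def[symmetric] r_def[symmetric])
  show ?thesis
    unfolding z_def[symmetric] sum4 opQP_coeff_def z2 G0 G1 using id by simp
qed

lemma coeff_ode:
  assumes x: "x > 0"
  shows "opQP \<mu> \<nu> (coeff n) x = of_real (x\<^sup>2) * ((eigval \<mu> \<nu> n + opC \<mu> \<nu>) * coeff n 0 x)"
  unfolding opQP_solve
proof -
  define l where "l = eigval \<mu> \<nu> n + opC \<mu> \<nu>"
  \<comment> \<open>On the n-th coefficient T1 and T2 act as n and n squared. Here l equals
    \<open>(2*n + \<mu> + 1)^2 - (\<nu> + 1)^2\<close>, exactly the value for which the bracket in
    \<open>G4_eq\<close> contributes nothing.\<close>
  have l: "4 * (of_int n)\<^sup>2 + 4 * (\<mu> + 1) * of_int n + (2 * (\<mu> - \<nu>) * s - l) = 0"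
    unfolding l_def eigval_def opC_def s_def by (simp add: power2_eq_square field_simps)
  note GC = fix_x_cont[OF G_cont x] and TC = T_cont[OF x]
  have half: "(1/2::real) > 0" by simp
  have "coeff n 4 x = circle_coeff (1/2) n (\<lambda>t. (\<Sum>k<4. opQP_coeff \<mu> \<nu> l k x * G k t (of_real x))
     + of_real (x\<^sup>2) * (4 * T2 t (of_real x) + 4 * (\<mu> + 1) * T1 t (of_real x) + (2 * (\<mu> - \<nu>) * s - l) * G 0 t (of_real x)))"
    unfolding coeff_def by (rule circle_coeff_cong, simp, rule G4_eq, simp)
  also have "\<dots> = circle_coeff (1/2) n (\<lambda>t. \<Sum>k<4. opQP_coeff \<mu> \<nu> l k x * G k t (of_real x))
     + circle_coeff (1/2) n (\<lambda>t. of_real (x\<^sup>2) * (4 * T2 t (of_real x) + 4 * (\<mu> + 1) * T1 t (of_real x) + (2 * (\<mu> - \<nu>) * s - l) * G 0 t (of_real x)))"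
    by (intro circle_coeff_add half continuous_intros GC TC)
  also have "circle_coeff (1/2) n (\<lambda>t. \<Sum>k<4. opQP_coeff \<mu> \<nu> l k x * G k t (of_real x)) =
      (\<Sum>k<4. circle_coeff (1/2) n (\<lambda>t. opQP_coeff \<mu> \<nu> l k x * G k t (of_real x)))"
    by (intro circle_coeff_sum half continuous_intros GC finite_lessThan)
  also have "\<dots> = (\<Sum>k<4. opQP_coeff \<mu> \<nu> l k x * coeff n k x)"
    unfolding circle_coeff_cmult coeff_def ..
  also have "circle_coeff (1/2) n (\<lambda>t. of_real (x\<^sup>2) * (4 * T2 t (of_real x) + 4 * (\<mu> + 1) * T1 t (of_real x) + (2 * (\<mu> - \<nu>) * s - l) * G 0 t (of_real x)))
    = of_real (x\<^sup>2) * circle_coeff (1/2) n (\<lambda>t. 4 * T2 t (of_real x) + 4 * (\<mu> + 1) * T1 t (of_real x) + (2 * (\<mu> - \<nu>) * s - l) * G 0 t (of_real x))"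
    by (rule circle_coeff_cmult)
  also have "circle_coeff (1/2) n (\<lambda>t. 4 * T2 t (of_real x) + 4 * (\<mu> + 1) * T1 t (of_real x) + (2 * (\<mu> - \<nu>) * s - l) * G 0 t (of_real x))
    = circle_coeff (1/2) n (\<lambda>t. 4 * T2 t (of_real x) + 4 * (\<mu> + 1) * T1 t (of_real x)) + circle_coeff (1/2) n (\<lambda>t. (2 * (\<mu> - \<nu>) * s - l) * G 0 t (of_real x))"
    by (intro circle_coeff_add half continuous_intros GC TC)
  also have "circle_coeff (1/2) n (\<lambda>t. 4 * T2 t (of_real x) + 4 * (\<mu> + 1) * T1 t (of_real x)) =
      circle_coeff (1/2) n (\<lambda>t. 4 * T2 t (of_real x)) + circle_coeff (1/2) n (\<lambda>t. 4 * (\<mu> + 1) * T1 t (of_real x))"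
    by (intro circle_coeff_add half continuous_intros GC TC)
  also have "\<dots> + circle_coeff (1/2) n (\<lambda>t. (2 * (\<mu> - \<nu>) * s - l) * G 0 t (of_real x)) =
     (4 * (of_int n)\<^sup>2 + 4 * (\<mu> + 1) * of_int n + (2 * (\<mu> - \<nu>) * s - l)) * coeff n 0 x"
    unfolding circle_coeff_cmult coeff_T[OF x] coeff_def[symmetric] by (simp only: algebra_simps)
  finally show "coeff n 4 x = (\<Sum>k<4. opQP_coeff \<mu> \<nu> (eigval \<mu> \<nu> n + opC \<mu> \<nu>) k x * coeff n k x)"
    unfolding l by (simp add: l_def)
qed

lemma solves_coeff:
  assumes "\<And>x. x > 0 \<Longrightarrow> f x = circle_coeff (1/2) n (\<lambda>t. V A B t (of_real x))"
  shows "solves_on_Rplus \<mu> \<nu> (eigval \<mu> \<nu> n) f"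
proof (rule solves_on_RplusI[OF coeff_tower])
  show "f x = coeff n 0 x" if "x > 0" for x
    using assms[OF that] by (simp add: coeff_def G_def comb_def)
qed (rule coeff_ode)

text \<open>The function h is \<open>t^N\<close> times the generating function. Writing A as H over
  the N-th power of \<open>t*x/(1-t)\<close> cancels \<open>t^N\<close>, so h is holomorphic on the
  whole unit disc and its Taylor series can be divided by \<open>t^N\<close>.\<close>

lemma V_expansion:
  assumes x: "x > 0"
  shows "\<exists>c. \<forall>t. 0 < norm t \<and> norm t < 1 \<longrightarrow> ((\<lambda>n. c n * t powi n) has_sum V A B t (of_real x)) UNIV"
proof -
  define h where "h = (\<lambda>t. (1 - t) powr (- s) * ((1 - t) / of_real x) ^ N * H (t * of_real x / (1 - t)) * B (of_real x / (1 - t)))"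
  have Bh: "B holomorphic_on {z. Re z > 0}"
    unfolding holomorphic_on_def field_differentiable_def
    using derivs(3) has_field_derivative_at_within by blast
  have "h holomorphic_on ball 0 1"
    unfolding h_def
    by (intro holomorphic_intros holomorphic_on_compose_gen[OF _ H(1), unfolded o_def]
          holomorphic_on_compose_gen[OF _ Bh, unfolded o_def])
       (use domain x in auto)
  then have "(\<lambda>n. (deriv ^^ n) h 0 / fact n * t ^ n) sums h t" if "norm t < 1" for t
    using holomorphic_power_series[of h 0 1 t] that by simp
  from shifted_power_series_has_sum[OF this, where N = N]
  have "((\<lambda>j::int. (if j + int N \<ge> 0 then (deriv ^^ nat (j + int N)) h 0 / fact (nat (j + int N)) else 0) * t powi j) has_sum h t / t ^ N) UNIV"
    if "0 < norm t" "norm t < 1" for t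
    using that by simp
  moreover have "h t / t ^ N = V A B t (of_real x)" if "0 < norm t" "norm t < 1" for t
  proof -
    define a where "a = t * of_real x / (1 - t)"
    have a: "a \<noteq> 0" using that x domain(1)[OF that(2)] by (auto simp: a_def)
    have "((1 - t) / of_real x) ^ N / t ^ N * a ^ N = 1"
      using that x domain(1)[OF that(2)] unfolding a_def power_divide power_mult_distrib by simp
    then have "((1 - t) / of_real x) ^ N / t ^ N * H a = A a"
      unfolding H(2)[OF a, symmetric] mult.assoc[symmetric] using that by simp
    from this[symmetric] show ?thesis unfolding h_def V_def a_def[symmetric] by simp
  qed
  ultimately show ?thesis
    by (intro exI[of _ "\<lambda>j. if j + int N \<ge> 0 then (deriv ^^ nat (j + int N)) h 0 / fact (nat (j + int N)) else 0"]) auto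
qed

lemma Lambda_eq:
  assumes "\<And>t. genfun i \<mu> \<nu> t x = V A B t (of_real x)" "x > 0"
  shows "Lambda i \<mu> \<nu> j x = circle_coeff (1/2) j (\<lambda>t. V A B t (of_real x))"
proof -
  from V_expansion[OF assms(2)] obtain c where
    "\<And>t. 0 < norm t \<Longrightarrow> norm t < 1 \<Longrightarrow> ((\<lambda>n. c n * t powi n) has_sum V A B t (of_real x)) UNIV" by blast
  from Lambda_eq_circle_coeff[OF _ this] assms(1) show ?thesis by blast
qed

end

section \<open>Behaviour at the origin\<close>

text \<open>The arguments shrink like x uniformly in t, so a limit at 0 becomes uniform on the
  circle, as \<open>circle_coeff_tendsto\<close> requires.\<close>

lemma uniform_limit_compose_small:
  fixes F :: "'a::real_normed_vector \<Rightarrow> 'b::metric_space"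
  assumes lim: "(F \<longlongrightarrow> L) (at 0 within S)" and "C > 0"
    and w: "\<And>x t. x > 0 \<Longrightarrow> t \<in> T \<Longrightarrow> w x t \<in> S \<and> w x t \<noteq> 0 \<and> norm (w x t) \<le> C * x"
  shows "uniform_limit T (\<lambda>x t. F (w x t)) (\<lambda>_. L) (at_right (0::real))"
proof (rule uniform_limitI)
  fix e :: real assume "e > 0"
  then obtain d where d: "d > 0" "\<And>z. z \<in> S \<Longrightarrow> z \<noteq> 0 \<Longrightarrow> norm z < d \<Longrightarrow> dist (F z) L < e"
    using lim unfolding tendsto_iff eventually_at by (auto simp: dist_norm)
  show "\<forall>\<^sub>F x in at_right 0. \<forall>t\<in>T. dist (F (w x t)) L < e"
  proof (rule eventually_at_rightI)
    fix x assume x: "x \<in> {0<..<d / C}"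
    then have "C * x < d" using \<open>C > 0\<close> by (simp add: field_simps)
    then show "\<forall>t\<in>T. dist (F (w x t)) L < e"
      using w[of x] x d(2) by (meson greaterThanLessThan_iff order_le_less_trans)
  qed (use d \<open>C > 0\<close> in simp)
qed

context bessel_product
begin

text \<open>Near \<open>x = 0\<close> the first factor contributes \<open>H 0\<close> over the N-th
  power of its argument, the second \<beta> over the E-th power of half its argument. With the
  powers of x removed, the t-dependence left is \<open>(1-t) powr (N + E - s) / t^N\<close>, whose
  Laurent coefficients are signed binomial coefficients.\<close>

lemma coeff_asymptotics:
  assumes lim: "((\<lambda>z. (z/2) powr of_real E * B z) \<longlongrightarrow> \<beta>) (at 0 within {z. Re z > 0})"
  shows "((\<lambda>x. of_real (x ^ N * (x/2) powr E) * circle_coeff (1/2) (int j) (\<lambda>t. V A B t (of_real x))) \<longlongrightarrow>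
           H 0 * \<beta> * (((- s + of_nat N + of_real E) gchoose (j + N)) * (-1) ^ (j + N))) (at_right 0)"
proof -
  define w where "w = - s + of_nat N + of_real E"
  define K where "K = (\<lambda>t::complex. (1 - t) powr w / t ^ N)"
  have d: "1 - t \<noteq> 0" "1 - t \<notin> \<real>\<^sub>\<le>\<^sub>0" "t \<noteq> 0" if "norm t = 1/2" for t :: complex
    using domain[of t] that by auto
  \<comment> \<open>This bound yields the constants \<open>C = 1\<close> and \<open>C = 2\<close> in
    the two uniform limits: the first argument has the additional factor
    \<open>|t| = 1/2\<close>.\<close>
  have nt: "norm (1 / (1 - t)) \<le> 2" if "norm t = 1/2" for t :: complex
  proof -
    have "norm (1 - t) \<ge> 1/2" using norm_triangle_ineq2[of 1 t] that by simp
    then have "1 / norm (1 - t) \<le> 1 / (1/2)" by (intro divide_left_mono) auto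
    then show ?thesis by (simp add: norm_divide)
  qed
  have d': "Re t \<le> 1" if "norm t = 1/2" for t
    using complex_Re_le_cmod[of t] that by linarith
  have contK: "continuous_on (sphere 0 (1/2)) K"
    unfolding K_def by (intro continuous_intros) (use d d' in auto)
  have pos: "Re (of_real x / (1 - t)) > 0" if "x > 0" "norm t = 1/2" for x t
    using domain(3)[of t x] that by simp
  have limH: "(H \<longlongrightarrow> H 0) (at 0 within UNIV)"
    using H(1) holomorphic_on_imp_continuous_on continuous_on_eq_continuous_at isContD by (metis UNIV_I open_UNIV)
  have U1: "uniform_limit (sphere 0 (1/2)) (\<lambda>x t. H (t * of_real x / (1 - t))) (\<lambda>_. H 0) (at_right (0::real))"
  proof (rule uniform_limit_compose_small[OF limH, where C = 1])
    fix x :: real and t :: complex assume x: "x > 0" and "t \<in> sphere 0 (1/2)"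
    then have t: "norm t = 1/2" by simp
    have "norm (t * of_real x / (1 - t)) = norm t * x * norm (1 / (1 - t))"
      using x by (simp add: norm_divide norm_mult)
    also have "\<dots> \<le> norm t * x * 2" using nt[OF t] x by (intro mult_left_mono) auto
    finally show "t * of_real x / (1 - t) \<in> UNIV \<and> t * of_real x / (1 - t) \<noteq> 0 \<and> norm (t * of_real x / (1 - t)) \<le> 1 * x"
      using t d[OF t] x by simp
  qed simp
  have U2: "uniform_limit (sphere 0 (1/2)) (\<lambda>x t. (of_real x / (1 - t) / 2) powr of_real E * B (of_real x / (1 - t))) (\<lambda>_. \<beta>) (at_right (0::real))"
  proof (rule uniform_limit_compose_small[OF lim, where C = 2])
    fix x :: real and t :: complex assume x: "x > 0" and "t \<in> sphere 0 (1/2)"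
    then have t: "norm t = 1/2" by simp
    have "norm (of_real x / (1 - t)) = x * norm (1 / (1 - t))"
      using x by (simp add: norm_divide)
    also have "\<dots> \<le> x * 2" using nt[OF t] x by (intro mult_left_mono) auto
    finally show "of_real x / (1 - t) \<in> {z. Re z > 0} \<and> of_real x / (1 - t) \<noteq> 0 \<and> norm (of_real x / (1 - t)) \<le> 2 * x"
      using pos[OF x t] d[OF t] x by auto
  qed simp
  define f where "f = (\<lambda>(x::real) t. K t * (H (t * of_real x / (1 - t)) * ((of_real x / (1 - t) / 2) powr of_real E * B (of_real x / (1 - t)))))"
  have "bounded (K ` sphere 0 (1/2))"
    by (intro compact_imp_bounded compact_continuous_image contK) simp
  then have U: "uniform_limit (sphere 0 (1/2)) f (\<lambda>t. K t * (H 0 * \<beta>)) (at_right 0)"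
    unfolding f_def
    by (intro uniform_lim_mult U1 U2 uniform_limit_const) (auto simp: bounded_iff)
  have f_eq: "f x t = of_real (x ^ N * (x/2) powr E) * V A B t (of_real x)" if x: "x > 0" and t: "norm t = 1/2" for x t
  proof -
    define a where "a = t * of_real x / (1 - t)"
    have a: "a \<noteq> 0" using x d[OF t] by (simp add: a_def)
    \<comment> \<open>On the principal branch the logarithm splits because \<open>x/2\<close> is a
      positive real and \<open>1 - t\<close> avoids the cut.\<close>
    have Ln: "Ln (of_real x / (1 - t) / 2) = of_real (ln (x/2)) - Ln (1 - t)"
    proof -
      have "Ln (of_real (x/2) * inverse (1 - t)) = Ln (of_real (x/2)) + Ln (inverse (1 - t))"
        by (rule Ln_times_of_real) (use x d[OF t] in auto)
      also have "Ln (of_real (x/2)) = of_real (ln (x/2))" by (rule Ln_of_real) (use x in simp)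
      also have "Ln (inverse (1 - t)) = - Ln (1 - t)" by (rule Ln_inverse) (use d[OF t] in auto)
      finally have "Ln (of_real (x/2) * inverse (1 - t)) = of_real (ln (x/2)) - Ln (1 - t)" by simp
      moreover have "of_real (x/2) * inverse (1 - t) = of_real x / (1 - t) / 2"
        using d[OF t] by (simp add: field_simps)
      ultimately show ?thesis by (simp only:)
    qed
    have pE: "(of_real x / (1 - t) / 2) powr of_real E = of_real ((x/2) powr E) * (1 - t) powr (- of_real E)"
    proof -
      have "of_real x / (1 - t) / 2 \<noteq> 0" using x d[OF t] by simp
      then have "(of_real x / (1 - t) / 2) powr of_real E = exp (of_real E * (of_real (ln (x/2)) - Ln (1 - t)))"
        unfolding powr_def Ln by (simp only: if_False)
      also have "\<dots> = exp (of_real (E * ln (x/2))) * exp (- of_real E * Ln (1 - t))"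
        unfolding exp_add[symmetric] by (simp add: algebra_simps)
      also have "exp (of_real (E * ln (x/2))) = complex_of_real ((x/2) powr E)"
        using x by (simp only: exp_of_real powr_def) simp
      also have "exp (- of_real E * Ln (1 - t)) = (1 - t) powr (- of_real E)"
        using d[OF t] by (simp add: powr_def)
      finally show ?thesis .
    qed
    have pw: "(1 - t) powr w = (1 - t) powr (- s) * (1 - t) ^ N * (1 - t) powr (of_real E)"
      using d[OF t] unfolding w_def powr_add by (simp add: powr_nat)
    have p1: "(1 - t) powr (of_real E) * (1 - t) powr (- of_real E) = 1"
      using d[OF t] by (simp add: powr_minus)
    have pH: "(1 - t) ^ N / t ^ N * H a = of_real (x ^ N) * A a"
      unfolding H(2)[OF a, symmetric] using d[OF t] by (simp add: a_def power_mult_distrib power_divide)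
    have "f x t = (1 - t) powr (- s) * ((1 - t) ^ N / t ^ N * H a) * ((1 - t) powr (of_real E) * (1 - t) powr (- of_real E))
        * of_real ((x/2) powr E) * B (of_real x / (1 - t))"
      unfolding f_def K_def a_def[symmetric] pE pw
      by (simp only: times_divide_eq_left times_divide_eq_right mult_ac)
    also have "\<dots> = of_real (x ^ N * (x/2) powr E) * V A B t (of_real x)"
      unfolding p1 pH V_def a_def[symmetric] by simp
    finally show ?thesis .
  qed
  have contf: "continuous_on (sphere 0 (1/2)) (f x)" if "x > 0" for x
  proof -
    have "continuous_on (sphere 0 (1/2)) (\<lambda>t. of_real (x ^ N * (x/2) powr E) * V A B t (of_real x))"
      by (intro continuous_intros fix_x_cont[OF V_conts(1) that])
    then show ?thesis using f_eq[OF that] by (subst continuous_on_cong[OF refl]) auto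
  qed
  have half: "(1/2::real) > 0" by simp
  have "((\<lambda>x. circle_coeff (1/2) (int j) (f x)) \<longlongrightarrow> circle_coeff (1/2) (int j) (\<lambda>t. K t * (H 0 * \<beta>))) (at_right 0)"
  proof (rule circle_coeff_tendsto[OF half U])
    show "\<forall>\<^sub>F x in at_right 0. continuous_on (sphere 0 (1/2)) (f x)"
      by (rule eventually_at_rightI[of 0 1]) (auto intro: contf)
  qed (intro continuous_intros contK)
  moreover have "\<forall>\<^sub>F x in at_right 0. circle_coeff (1/2) (int j) (f x) =
      of_real (x ^ N * (x/2) powr E) * circle_coeff (1/2) (int j) (\<lambda>t. V A B t (of_real x))"
  proof (rule eventually_at_rightI[of 0 1])
    fix x :: real assume "x \<in> {0<..<1}"
    then have x: "x > 0" by simp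
    show "circle_coeff (1/2) (int j) (f x) = of_real (x ^ N * (x/2) powr E) * circle_coeff (1/2) (int j) (\<lambda>t. V A B t (of_real x))"
      unfolding circle_coeff_cmult[symmetric] by (rule circle_coeff_cong[OF half]) (rule f_eq[OF x])
  qed simp
  ultimately have L: "((\<lambda>x. of_real (x ^ N * (x/2) powr E) * circle_coeff (1/2) (int j) (\<lambda>t. V A B t (of_real x))) \<longlongrightarrow>
       circle_coeff (1/2) (int j) (\<lambda>t. K t * (H 0 * \<beta>))) (at_right 0)"
    by (rule Lim_transform_eventually)
  have sums: "(\<lambda>n. (w gchoose n) * (-1) ^ n * t ^ n) sums (1 - t) powr w" if "norm t < 1" for t
  proof -
    have "(\<lambda>n. (w gchoose n) * (- t) ^ n) = (\<lambda>n. (w gchoose n) * (-1) ^ n * t ^ n)"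
      unfolding power_minus[of t] by (simp add: mult.assoc)
    then show ?thesis using gen_binomial_complex[of "-t" w] that by simp
  qed
  have "circle_coeff (1/2) (int j) K = (w gchoose (j + N)) * (-1) ^ (j + N)"
  proof -
    have hs: "((\<lambda>j. (if j + int N \<ge> 0 then (w gchoose nat (j + int N)) * (-1) ^ nat (j + int N) else 0) * t powi j)
        has_sum K t) UNIV" if "norm t = 1/2" for t
      unfolding K_def by (rule shifted_power_series_has_sum[OF sums]) (use that in auto)
    have "circle_coeff (1/2) (int j) K =
      (if int j + int N \<ge> 0 then (w gchoose nat (int j + int N)) * (-1) ^ nat (int j + int N) else 0)"
      by (rule circle_coeff_has_sum[where c = "\<lambda>j. if j + int N \<ge> 0 then (w gchoose nat (j + int N)) * (-1) ^ nat (j + int N) else 0"])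
         (use hs in auto)
    then show ?thesis by (simp add: nat_add_distrib)
  qed
  moreover have "circle_coeff (1/2) (int j) (\<lambda>t. K t * (H 0 * \<beta>)) = (H 0 * \<beta>) * circle_coeff (1/2) (int j) K"
    unfolding circle_coeff_cmult[symmetric] by (simp only: mult.commute)
  ultimately show ?thesis using L by (simp add: w_def)
qed

end

section \<open>Nonvanishing constants and independence through distinct exponents\<close>

lemma gchoose_nonzero:
  fixes w :: "'a::field_char_0"
  assumes "\<And>k::nat. w \<noteq> of_nat k"
  shows "w gchoose n \<noteq> 0"
  using assms by (auto simp: gbinomial_prod_rev)

text \<open>Among the indices with nonzero coefficient let m have the largest exponent, so that
  \<open>f m\<close> is the most singular at 0. After multiplication by \<open>x powr e m\<close>
  all other terms tend to 0, and the relation forces \<open>c m * L m = 0\<close>.\<close>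

lemma independent_of_exponents:
  fixes f :: "'i \<Rightarrow> real \<Rightarrow> complex" and e :: "'i \<Rightarrow> real"
  assumes I: "finite I" and inj: "inj_on e I"
    and lim: "\<And>i. i \<in> I \<Longrightarrow> ((\<lambda>x. of_real (x powr e i) * f i x) \<longlongrightarrow> L i) (at_right 0)" "\<And>i. i \<in> I \<Longrightarrow> L i \<noteq> 0"
    and zero: "\<forall>x>0. (\<Sum>i\<in>I. c i * f i x) = 0"
  shows "\<forall>i\<in>I. c i = 0"
proof (rule ccontr)
  assume neg: "\<not> (\<forall>i\<in>I. c i = 0)"
  define J where "J = {i\<in>I. c i \<noteq> 0}"
  have J: "finite J" "J \<noteq> {}" "J \<subseteq> I" using I neg by (auto simp: J_def)
  then obtain m where m: "m \<in> J" "\<And>i. i \<in> J \<Longrightarrow> e i \<le> e m"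
    using finite_imageI[OF J(1), of e] Max_in[of "e ` J"] Max_ge[of "e ` J"] by (metis (no_types, lifting) imageE image_eqI image_is_empty)
  have "((\<lambda>x. c i * (of_real (x powr e m) * f i x)) \<longlongrightarrow> (if i = m then c m * L m else 0)) (at_right 0)" if i: "i \<in> J" for i
  proof (cases "i = m")
    case True
    then show ?thesis using lim(1)[of m] m J by (auto intro!: tendsto_intros)
  next
    case False
    then have lt: "e i < e m" using m i J inj by (metis inj_onD less_eq_real_def subsetD)
    have "((\<lambda>x. x powr (e m - e i)) \<longlongrightarrow> 0) (at_right 0)"
      using lt by real_asymp
    then have "((\<lambda>x. c i * (of_real (x powr (e m - e i)) * (of_real (x powr e i) * f i x))) \<longlongrightarrow> c i * (of_real 0 * L i)) (at_right 0)"
      using lim(1)[of i] i J by (intro tendsto_intros) auto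
    moreover have "\<forall>\<^sub>F x in at_right 0. c i * (of_real (x powr (e m - e i)) * (of_real (x powr e i) * f i x)) = c i * (of_real (x powr e m) * f i x)"
      by (rule eventually_at_rightI[of 0 1]) (auto simp: powr_diff)
    ultimately have "((\<lambda>x. c i * (of_real (x powr e m) * f i x)) \<longlongrightarrow> c i * (of_real 0 * L i)) (at_right 0)"
      by (rule Lim_transform_eventually)
    then show ?thesis using False by simp
  qed
  then have "((\<lambda>x. \<Sum>i\<in>J. c i * (of_real (x powr e m) * f i x)) \<longlongrightarrow> (\<Sum>i\<in>J. if i = m then c m * L m else 0)) (at_right 0)"
    by (rule tendsto_sum)
  moreover have "\<forall>\<^sub>F x in at_right 0. (\<Sum>i\<in>J. c i * (of_real (x powr e m) * f i x)) = 0"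
  proof (rule eventually_at_rightI[of 0 1])
    fix x :: real assume "x \<in> {0<..<1}"
    have "(\<Sum>i\<in>J. c i * (of_real (x powr e m) * f i x)) = (\<Sum>i\<in>I. c i * (of_real (x powr e m) * f i x))"
      using I by (intro sum.mono_neutral_left) (auto simp: J_def)
    also have "\<dots> = of_real (x powr e m) * (\<Sum>i\<in>I. c i * f i x)"
      by (simp add: sum_distrib_left mult_ac)
    also have "\<dots> = 0" using zero \<open>x \<in> _\<close> by simp
    finally show "(\<Sum>i\<in>J. c i * (of_real (x powr e m) * f i x)) = 0" .
  qed simp
  ultimately have "((\<lambda>x::real. 0::complex) \<longlongrightarrow> (\<Sum>i\<in>J. if i = m then c m * L m else 0)) (at_right 0)"
    by (rule Lim_transform_eventually)
  then have "(\<Sum>i\<in>J. if i = m then c m * L m else 0) = 0"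
    using tendsto_unique[OF _ _ tendsto_const] trivial_limit_at_right_real by blast
  then show False using m(1) J lim(2)[of m] by (auto simp: J_def)
qed

text \<open>Besides placing each generating function in the locale, this exports what the
  asymptotics need: the pole order N, the value \<open>H 0\<close>, and which function B is.\<close>

lemma bessel_product_genfun:
  fixes \<mu> \<nu> :: complex and i :: nat
  assumes "i \<in> {1, 2} \<or> (i \<in> {3, 4} \<and> (\<exists>m::nat. \<mu> = of_nat (2 * m + 1)))"
  obtains N A A1 H B B1 where "bessel_product \<mu> \<nu> N A A1 H B B1"
    and "\<And>t x. genfun i \<mu> \<nu> t x = bessel_product.V \<mu> \<nu> A B t (of_real x)"
    and "if i \<in> {1, 2} then N = 0 \<and> H 0 = rGamma (\<mu>/2 + 1) else \<mu> = of_nat N \<and> H 0 \<noteq> 0"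
    and "B = (if i \<in> {1, 3} then bessel_I_tilde (\<nu>/2) else bessel_K_tilde (\<nu>/2))"
proof -
  define B where "B = (if i \<in> {1, 3} then bessel_I_tilde (\<nu>/2) else bessel_K_tilde (\<nu>/2))"
  obtain B1 where B: "bessel_system \<nu> {z. Re z > 0} (\<lambda>_. 0) B B1"
  proof (cases "i \<in> {1, 3}")
    case True
    then show ?thesis
      using bessel_system_I_tilde[where S = "{z. Re z > 0}" and \<nu> = \<nu>] that
      by (auto simp: B_def open_halfspace_Re_gt)
  next
    case False
    then show ?thesis using bessel_system_K_tilde[where \<nu> = \<nu>] that by (auto simp: B_def)
  qed
  show ?thesis
  proof (cases "i \<in> {1, 2}")
    case True
    obtain A1 where A: "bessel_system \<mu> (- {0}) (\<lambda>_. 0) (bessel_I_tilde (\<mu>/2)) A1"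
      using bessel_system_I_tilde[where S = "- {0}" and \<nu> = \<mu>] by auto
    define H where "H = (\<lambda>z. bessel_phi (\<mu>/2) ((z/2)\<^sup>2))"
    have "H holomorphic_on UNIV" unfolding H_def by (intro holomorphic_intros) auto
    then interpret bessel_product \<mu> \<nu> 0 "bessel_I_tilde (\<mu>/2)" A1 H B B1
      by unfold_locales (use A B in \<open>auto simp: H_def bessel_I_tilde_conv_phi\<close>)
    have se: "- (\<mu> + \<nu> + 2) / 2 = - s" unfolding s_def by (rule minus_divide_left[symmetric])
    show ?thesis
    proof (rule that)
      show "bessel_product \<mu> \<nu> 0 (bessel_I_tilde (\<mu>/2)) A1 H B B1" by unfold_locales
      show "genfun i \<mu> \<nu> t x = V (bessel_I_tilde (\<mu>/2)) B t (of_real x)" for t x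
        using True unfolding genfun_def V_def Let_def se by (auto simp: B_def)
    qed (use True in \<open>auto simp: H_def B_def\<close>)
  next
    case False
    then have i: "i \<in> {3, 4}" and "\<exists>m::nat. \<mu> = of_nat (2 * m + 1)" using assms by auto
    then obtain m where m: "\<mu> = of_nat (2 * m + 1)" by blast
    obtain A1 H where KA: "bessel_system \<mu> (- {0}) (\<lambda>_. 0) (bessel_K_tilde (\<mu>/2)) A1" "H holomorphic_on UNIV"
      "\<And>z. z \<noteq> 0 \<Longrightarrow> z ^ (2 * m + 1) * bessel_K_tilde (\<mu>/2) z = H z" "H 0 \<noteq> 0"
      using bessel_K_tilde_half_odd[of m] unfolding m by blast
    interpret bessel_product \<mu> \<nu> "2 * m + 1" "bessel_K_tilde (\<mu>/2)" A1 H B B1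
      by unfold_locales (use KA B in auto)
    have se: "- (\<mu> + \<nu> + 2) / 2 = - s" unfolding s_def by (rule minus_divide_left[symmetric])
    show ?thesis
    proof (rule that)
      show "bessel_product \<mu> \<nu> (2 * m + 1) (bessel_K_tilde (\<mu>/2)) A1 H B B1" by unfold_locales
      show "genfun i \<mu> \<nu> t x = V (bessel_K_tilde (\<mu>/2)) B t (of_real x)" for t x
        using i unfolding genfun_def V_def Let_def se by (auto simp: B_def)
    qed (use False KA(4) m in \<open>auto simp: B_def\<close>)
  qed
qed

lemma solves_Lambda:
  assumes "i \<in> {1, 2} \<or> (i \<in> {3, 4} \<and> (\<exists>m::nat. \<mu> = of_nat (2 * m + 1)))"
  shows "solves_on_Rplus \<mu> \<nu> (eigval \<mu> \<nu> j) (Lambda i \<mu> \<nu> j)"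
proof -
  obtain N A A1 H B B1 where P: "bessel_product \<mu> \<nu> N A A1 H B B1"
    and G: "\<And>t x. genfun i \<mu> \<nu> t x = bessel_product.V \<mu> \<nu> A B t (of_real x)"
    using bessel_product_genfun[OF assms] by metis
  interpret bessel_product \<mu> \<nu> N A A1 H B B1 by (rule P)
  show ?thesis by (rule solves_coeff) (rule Lambda_eq[OF G])
qed

text \<open>The exponent e adds the pole order of the first factor to that of the second. The limit
  is nonzero because \<open>H 0\<close>, \<beta> and a generalised binomial coefficient with upper
  argument w all are.\<close>

lemma Lambda_asymptotics:
  fixes m :: nat and \<nu> :: real and i j :: nat
  defines "\<mu> \<equiv> complex_of_nat (2 * m + 1)"
  defines "e \<equiv> (if i \<in> {1, 2} then 0 else real (2 * m + 1)) + (if i \<in> {1, 3} then 0 else \<nu>)"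
  assumes i: "i \<in> {1..4}" and \<nu>: "\<nu> > 0" "\<forall>k::int. of_int (2 * k) \<noteq> real (2 * m + 1) - \<nu>"
  obtains L where "((\<lambda>x. of_real (x powr e) * Lambda i \<mu> (of_real \<nu>) (int j) x) \<longlongrightarrow> L) (at_right 0)" "L \<noteq> 0"
proof -
  have "i \<in> {1, 2} \<or> (i \<in> {3, 4} \<and> (\<exists>m::nat. \<mu> = of_nat (2 * m + 1)))" using i by (auto simp: \<mu>_def)
  from bessel_product_genfun[OF this, of "of_real \<nu>"] obtain N A A1 H B B1 where P: "bessel_product \<mu> (of_real \<nu>) N A A1 H B B1"
    and G: "\<And>t x. genfun i \<mu> (of_real \<nu>) t x = bessel_product.V \<mu> (of_real \<nu>) A B t (of_real x)"
    and NH: "if i \<in> {1, 2} then N = 0 \<and> H 0 = rGamma (\<mu>/2 + 1) else \<mu> = of_nat N \<and> H 0 \<noteq> 0"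
    and B_eq: "B = (if i \<in> {1, 3} then bessel_I_tilde (of_real \<nu>/2) else bessel_K_tilde (of_real \<nu>/2))"
    by metis
  interpret bessel_product \<mu> "of_real \<nu>" N A A1 H B B1 by (rule P)
  define E where "E = (if i \<in> {1, 3} then 0 else \<nu>)"
  have N: "N = (if i \<in> {1, 2} then 0 else 2 * m + 1)"
    using NH of_nat_eq_iff[of "2 * m + 1" N, where ?'a = complex] by (auto simp: \<mu>_def split: if_splits)
  have e: "e = real N + E" by (simp add: e_def E_def N)
  have "Re (\<mu>/2 + 1) > 0" by (simp add: \<mu>_def add_nonneg_pos)
  then have "\<mu>/2 + 1 \<notin> \<int>\<^sub>\<le>\<^sub>0"
    by (metis nonpos_Ints_cases Re_complex_of_real of_real_of_int_eq of_int_0_less_iff not_less)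
  then have H0: "H 0 \<noteq> 0" using NH by (auto simp: rGamma_eq_zero_iff split: if_splits)
  obtain \<beta> where \<beta>: "((\<lambda>z. (z/2) powr of_real E * B z) \<longlongrightarrow> \<beta>) (at 0 within {z. Re z > 0})" "\<beta> \<noteq> 0"
  proof (cases "i \<in> {1, 3}")
    case True
    obtain C where C: "(bessel_I_tilde (of_real \<nu> / 2) \<longlongrightarrow> C) (at 0 within {z. Re z > 0})" "C \<noteq> 0"
      using bessel_I_tilde_at_0[OF \<nu>(1)] by blast
    have "\<forall>\<^sub>F z in at 0 within {z. Re z > 0}. bessel_I_tilde (of_real \<nu> / 2) z = (z/2) powr of_real E * B z"
      unfolding eventually_at_filter using True by (auto intro!: always_eventually simp: E_def B_eq)
    from Lim_transform_eventually[OF C(1) this] C(2) show ?thesis using that by blast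
  next
    case False
    then show ?thesis using bessel_K_tilde_at_0[OF \<nu>(1)] that by (auto simp: E_def B_eq)
  qed
  define w where "w = - s + of_nat N + of_real E"
  \<comment> \<open>For i = 1, 2, 3, 4 the number \<open>w + 1\<close> is
    \<open>-(\<mu>+\<nu>)/2\<close>, \<open>(\<nu>-\<mu>)/2\<close>, \<open>(\<mu>-\<nu>)/2\<close>
    and \<open>(\<mu>+\<nu>)/2\<close>. The first is negative. A natural w in the second or third
    case makes \<open>\<mu> - \<nu>\<close> an even integer, and in the fourth case too, because
    \<mu> is an integer.\<close>
  have w: "w \<noteq> of_nat k" for k
  proof
    assume "w = of_nat k"
    moreover have "w = of_real (- (real (2 * m + 1) + \<nu> + 2) / 2 + real N + E)"
      unfolding w_def s_def unfolding \<mu>_def by (simp add: field_simps)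
    ultimately have "complex_of_real (- (real (2 * m + 1) + \<nu> + 2) / 2 + real N + E) = of_real (real k)" by simp
    then have k: "- (real (2 * m + 1) + \<nu> + 2) / 2 + real N + E = real k" using of_real_eq_iff by blast
    consider "i = 1" | "i = 2" | "i = 3" | "i = 4" using i by force
    then show False
    proof cases
      case 1 then show False using k \<nu>(1) by (simp add: N E_def field_simps)
    next
      case 2
      then have "real (2 * m + 1) - \<nu> = of_int (2 * (- int k - 1))"
        using k by (simp add: N E_def field_simps)
      then show False using \<nu>(2) by metis
    next
      case 3
      then have "real (2 * m + 1) - \<nu> = of_int (2 * (int k + 1))"
        using k by (simp add: N E_def field_simps)
      then show False using \<nu>(2) by metis
    next
      case 4
      then have "real (2 * m + 1) - \<nu> = of_int (2 * (2 * int m - int k))"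
        using k by (simp add: N E_def field_simps)
      then show False using \<nu>(2) by metis
    qed
  qed
  define L where "L = H 0 * \<beta> * ((w gchoose (j + N)) * (-1) ^ (j + N))"
  have "L \<noteq> 0" using H0 \<beta>(2) gchoose_nonzero[OF w] by (simp add: L_def)
  have lim: "((\<lambda>x. of_real (x ^ N * (x/2) powr E) * circle_coeff (1/2) (int j) (\<lambda>t. V A B t (of_real x))) \<longlongrightarrow> L) (at_right 0)"
    unfolding L_def w_def by (rule coeff_asymptotics[OF \<beta>(1)])
  \<comment> \<open>The factor \<open>2 powr E\<close> trades \<open>(x/2) powr E\<close> for
    \<open>x powr E\<close>.\<close>
  have "((\<lambda>x. of_real (2 powr E) * (of_real (x ^ N * (x/2) powr E) * circle_coeff (1/2) (int j) (\<lambda>t. V A B t (of_real x)))) \<longlongrightarrow> of_real (2 powr E) * L) (at_right 0)"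
    by (rule tendsto_mult_left[OF lim])
  moreover have "\<forall>\<^sub>F x in at_right 0. of_real (2 powr E) * (of_real (x ^ N * (x/2) powr E) * circle_coeff (1/2) (int j) (\<lambda>t. V A B t (of_real x)))
      = of_real (x powr e) * Lambda i \<mu> (of_real \<nu>) (int j) x"
  proof (rule eventually_at_rightI[of 0 1])
    fix x :: real assume "x \<in> {0<..<1}"
    then have x: "x > 0" by simp
    have "x powr e = 2 powr E * (x ^ N * (x/2) powr E)"
      using x by (simp add: e powr_add powr_realpow powr_divide)
    then show "of_real (2 powr E) * (of_real (x ^ N * (x/2) powr E) * circle_coeff (1/2) (int j) (\<lambda>t. V A B t (of_real x)))
      = of_real (x powr e) * Lambda i \<mu> (of_real \<nu>) (int j) x"
      unfolding Lambda_eq[OF G x] by simp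
  qed simp
  ultimately have "((\<lambda>x. of_real (x powr e) * Lambda i \<mu> (of_real \<nu>) (int j) x) \<longlongrightarrow> of_real (2 powr E) * L) (at_right 0)"
    by (rule Lim_transform_eventually)
  then show ?thesis by (rule that) (use \<open>L \<noteq> 0\<close> in simp)
qed

theorem theorem4p5:
  shows
  "(\<forall>(\<mu>::complex) (\<nu>::complex) (i::nat) (j::int).
      (i \<in> {1, 2} \<or> (i \<in> {3, 4} \<and> (\<exists>m::nat. \<mu> = of_nat (2 * m + 1))))
      \<longrightarrow> solves_on_Rplus \<mu> \<nu> (eigval \<mu> \<nu> j) (Lambda i \<mu> \<nu> j))
   \<and>
   (\<forall>(m::nat) (\<nu>::real) (j::nat).
      let \<mu> = complex_of_nat (2 * m + 1); \<nu>' = complex_of_real \<nu> in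
      \<nu> > 0 \<and> (\<forall>k::int. of_int (2 * k) \<noteq> real (2 * m + 1) - \<nu>) \<longrightarrow>
        (\<forall>c :: nat \<Rightarrow> complex.
            (\<forall>x>0. (\<Sum>i\<in>{1..4}. c i * Lambda i \<mu> \<nu>' (int j) x) = 0)
            \<longrightarrow> (\<forall>i\<in>{1..4}. c i = 0))
        \<and> (\<forall>i\<in>{1..4}. solves_on_Rplus \<mu> \<nu>' (eigval \<mu> \<nu>' (int j)) (Lambda i \<mu> \<nu>' (int j)))
        \<and> (\<forall>u. solves_on_Rplus \<mu> \<nu>' (eigval \<mu> \<nu>' (int j)) u \<longrightarrow>
              (\<exists>c :: nat \<Rightarrow> complex. \<forall>x>0. u x = (\<Sum>i\<in>{1..4}. c i * Lambda i \<mu> \<nu>' (int j) x))))"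
proof (intro conjI allI impI)
  show "solves_on_Rplus \<mu> \<nu> (eigval \<mu> \<nu> j) (Lambda i \<mu> \<nu> j)"
    if "i \<in> {1, 2} \<or> (i \<in> {3, 4} \<and> (\<exists>m::nat. \<mu> = of_nat (2 * m + 1)))" for \<mu> \<nu> i j
    using that by (rule solves_Lambda)
next
  fix m :: nat and \<nu> :: real and j :: nat
  define \<mu> where "\<mu> = complex_of_nat (2 * m + 1)"
  define \<nu>' where "\<nu>' = complex_of_real \<nu>"
  define f where "f = (\<lambda>i. Lambda i \<mu> \<nu>' (int j))"
  have *: "(\<forall>c :: nat \<Rightarrow> complex. (\<forall>x>0. (\<Sum>i\<in>{1..4}. c i * f i x) = 0) \<longrightarrow> (\<forall>i\<in>{1..4}. c i = 0))
        \<and> (\<forall>i\<in>{1..4}. solves_on_Rplus \<mu> \<nu>' (eigval \<mu> \<nu>' (int j)) (f i))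
        \<and> (\<forall>u. solves_on_Rplus \<mu> \<nu>' (eigval \<mu> \<nu>' (int j)) u \<longrightarrow>
              (\<exists>c :: nat \<Rightarrow> complex. \<forall>x>0. u x = (\<Sum>i\<in>{1..4}. c i * f i x)))"
    if \<nu>: "\<nu> > 0" "\<forall>k::int. of_int (2 * k) \<noteq> real (2 * m + 1) - \<nu>"
  proof -
    define e :: "nat \<Rightarrow> real" where "e = (\<lambda>i. (if i \<in> {1, 2} then 0 else real (2 * m + 1)) + (if i \<in> {1, 3} then 0 else \<nu>))"
    have "\<exists>L. ((\<lambda>x. of_real (x powr e i) * f i x) \<longlongrightarrow> L) (at_right 0) \<and> L \<noteq> 0" if "i \<in> {1..4}" for i
      using Lambda_asymptotics[OF that \<nu>, of j] unfolding e_def f_def \<mu>_def \<nu>'_def by metis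
    then obtain L where L: "\<And>i. i \<in> {1..4} \<Longrightarrow> ((\<lambda>x. of_real (x powr e i) * f i x) \<longlongrightarrow> L i) (at_right 0)"
      "\<And>i. i \<in> {1..4} \<Longrightarrow> L i \<noteq> 0" by metis
    \<comment> \<open>The instance k = 0 separates the exponents \<nu> and \<mu> of the second and
      third functions; positivity of \<mu> and \<nu> separates the rest.\<close>
    have "real (2 * m + 1) \<noteq> \<nu>" using \<nu>(2)[rule_format, of 0] by simp
    then have inj: "inj_on e {1..4}"
      using \<nu>(1) by (auto simp: inj_on_def e_def split: if_splits)
    have indep: "\<forall>i\<in>{1..4}. c i = 0" if "\<forall>x>0. (\<Sum>i\<in>{1..4}. c i * f i x) = 0" for c
      by (rule independent_of_exponents[OF _ inj L that]) auto
    have sol: "solves_on_Rplus \<mu> \<nu>' (eigval \<mu> \<nu>' (int j)) (f i)" if "i \<in> {1..4}" for i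
      unfolding f_def using that by (intro solves_Lambda) (auto simp: \<mu>_def)
    show ?thesis
      using indep sol fundamental_system[of \<mu> \<nu>' "eigval \<mu> \<nu>' (int j)" f, OF sol indep] by blast
  qed
  show "let \<mu> = complex_of_nat (2 * m + 1); \<nu>' = complex_of_real \<nu> in
      \<nu> > 0 \<and> (\<forall>k::int. of_int (2 * k) \<noteq> real (2 * m + 1) - \<nu>) \<longrightarrow>
        (\<forall>c :: nat \<Rightarrow> complex.
            (\<forall>x>0. (\<Sum>i\<in>{1..4}. c i * Lambda i \<mu> \<nu>' (int j) x) = 0)
            \<longrightarrow> (\<forall>i\<in>{1..4}. c i = 0))
        \<and> (\<forall>i\<in>{1..4}. solves_on_Rplus \<mu> \<nu>' (eigval \<mu> \<nu>' (int j)) (Lambda i \<mu> \<nu>' (int j)))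
        \<and> (\<forall>u. solves_on_Rplus \<mu> \<nu>' (eigval \<mu> \<nu>' (int j)) u \<longrightarrow>
              (\<exists>c :: nat \<Rightarrow> complex. \<forall>x>0. u x = (\<Sum>i\<in>{1..4}. c i * Lambda i \<mu> \<nu>' (int j) x)))"
    using * unfolding Let_def \<mu>_def[symmetric] \<nu>'_def[symmetric] f_def by blast
qed

end
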